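(* Let $A$ be a twisted generalized Weyl construction with data $(R,\boldsymbol{\sigma},\boldsymbol{t},\boldsymbol{\mu})$ over a field $K$, let $\mathfrak{m}$ be a maximal ideal of $R$, and let $\omega$ be its $\mathbb{Z}^n$-orbit. Let $s_1,\ldots,s_k$ be a $\mathbb{Z}$-basis of $G_\mathfrak{m}$, let $b_i=\varphi_\mathfrak{m}(a_{s_i})$ for $i=1,\ldots,k$, and let $\{\rho_j\}_{j\in J}$ be a basis of $R_\mathfrak{m}$ over $K$. Then: a) $B_\mathfrak{m}^{(0)}M_\mathfrak{m}=0$ for any simple weight module $M$ over $A$ with no proper inner breaks; and b) the $b_i$ are invertible and, as a $K$-linear space, $B_\mathfrak{m}^{(1)}$ has a basis $$\{\rho_j b_1^{l_1}\cdots b_k^{l_k}\;|\; j\in J \text{ and } l_i\in\mathbb{Z}\text{ for }1\le i\le k\},$$ and the following commutation relations hold: $$b_i\lambda=s_i(\lambda)b_i,\qquad i=1,\ldots,k,\ \lambda\in R_\mathfrak{m},$$ $$b_ib_j=\lambda_{ij}b_jb_i,\qquad i,j=1,\ldots,k,$$ for some nonzero $\lambda_{ij}\in R_\mathfrak{m}$.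
   Context: Twisted generalized Weyl construction (TGWC). Let $n\ge 1$, $K$ a field, $R$ a commutative unital $K$-algebra, $\boldsymbol{\sigma}=(\sigma_1,\ldots,\sigma_n)$ pairwise commuting $K$-automorphisms of $R$, $\boldsymbol{\mu}=(\mu_{ij})_{1\le i,j\le n}$ a matrix with entries in $K^*=K\setminus\{0\}$, $\boldsymbol{t}=(t_1,\ldots,t_n)$ nonzero elements of $R$. The TGWC $A$ is the unital $K$-algebra generated over $R$ by $X_i,Y_i$ ($1\le i\le n$) with relations $X_ir=\sigma_i(r)X_i$, $Y_ir=\sigma_i^{-1}(r)Y_i$ ($r\in R$), $Y_iX_i=t_i$, $X_iY_i=\sigma_i(t_i)$, and $X_iY_j=\mu_{ij}Y_jX_i$ for $i\ne j$. It is $\mathbb{Z}^n$-graded, $A=\bigoplus_g A_g$, by $\deg X_i=e_i$, $\deg Y_i=-e_i$, $\deg r=0$ for $r\in R$ ($e_i$ the standard basis vectors). $R$ is identified with $A_0$ (so the canonical map $R\to A$ is taken to be injective). Action. $g=(g_1,\ldots,g_n)\in\mathbb{Z}^n$ acts on $R$ by $g(r)=\sigma_1^{g_1}\cdots\sigma_n^{g_n}(r)$ and on the set $\mathrm{Max}(R)$ of maximal ideals by $g(\mathfrak{m})=\{g(r)\mid r\in\mathfrak{m}\}$. $\mathbb{Z}^n_\omega=\{g\in\mathbb{Z}^n\mid g(\mathfrak{m})=\mathfrak{m}\}$, which depends only on the orbit $\omega$. $R_\mathfrak{m}=R/\mathfrak{m}$, on which $\mathbb{Z}^n_\omega$ acts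 naturally by $K$-automorphisms. Words. A word is an element $a=Z_1\cdots Z_k$ ($k\ge0$, the empty word being $1$) with each $Z_j\in\{X_i,Y_i\}_i$, together with this representation; $X_i^*=Y_i$, $Y_i^*=X_i$, $a^*=Z_k^*\cdots Z_1^*$; then $a^*a\in R$. Modules. An $A$-module $M$ is a weight module if $M=\bigoplus_{\mathfrak{n}\in\mathrm{Max}(R)}M_\mathfrak{n}$, $M_\mathfrak{n}=\{v\in M\mid \mathfrak{n}v=0\}$; $\mathrm{supp}(M)=\{\mathfrak{n}\mid M_\mathfrak{n}\neq0\}$. A simple weight module $M$ has no proper inner breaks if for any $\mathfrak{n}\in\mathrm{supp}(M)$ and any word $a$ with $aM_\mathfrak{n}\ne0$ we have $a^*a\notin\mathfrak{n}$. Subalgebra. $B(\omega)=\bigoplus_{g\in\mathbb{Z}^n_\omega}A_g$, a subalgebra of $A$ containing $R$; $B_\mathfrak{m}=B(\omega)/(\mathfrak{m})$, where $(\mathfrak{m})$ is the two-sided ideal of $B(\omega)$ generated by $\mathfrak{m}$; $\varphi_\mathfrak{m}:B(\omega)\to B_\mathfrak{m}$ is the projection. $B_\mathfrak{m}$ is graded by $\mathbb{Z}^n_\omega$ and acts on $M_\mathfrak{m}$ for every weight module $M$. Put $\tilde G_\mathfrak{m}=\{g\in\mathbb{Z}^n\mid a^*a\notin\mathfrak{m}\text{ for some word }a\in A_g\}$ and $G_\mathfrak{m}=\tilde G_\mathfrak{m}\cap\mathbb{Z}^n_\omega$. $G_\mathfrak{m}$ is a subgroup of $\mathbb{Z}^n_\omega$,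 hence free abelian of some rank $k\le n$. For each $g\in\tilde G_\mathfrak{m}$ a word $a_g\in A_g$ with $a_g^*a_g\notin\mathfrak{m}$ is fixed, with $a_0=1$. Finally $B_\mathfrak{m}^{(1)}=\bigoplus_{g\in G_\mathfrak{m}}\varphi_\mathfrak{m}(A_g)$ and $B_\mathfrak{m}^{(0)}=\bigoplus_{g\in\mathbb{Z}^n_\omega\setminus G_\mathfrak{m}}\varphi_\mathfrak{m}(A_g)$, so $B_\mathfrak{m}=B_\mathfrak{m}^{(1)}\oplus B_\mathfrak{m}^{(0)}$. *)

theory Defs
  imports "HOL-Algebra.QuotRing" "HOL-Algebra.Module" "HOL-Analysis.Finite_Cartesian_Product"
begin

text \<open>
  The index set \<open>{1..n}\<close>, with \<open>n\<close> at least 1, is a finite linearly ordered type \<open>'n\<close>, and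
  \<open>\<int>\<^sup>n\<close> is \<open>int ^ 'n\<close>.  The order is used only to write down the product
  \<open>\<sigma>\<^sub>1^g\<^sub>1 \<dots> \<sigma>\<^sub>n^g\<^sub>n\<close>.  Algebras over a field are \<open>module\<close> records: their ring operations
  together with the scalar multiplication.
\<close>

definition is_basis :: "'k ring \<Rightarrow> ('k, 'v) module \<Rightarrow> 'i set \<Rightarrow> ('i \<Rightarrow> 'v) \<Rightarrow> bool" where
  "is_basis K V I b \<longleftrightarrow>
     b \<in> I \<rightarrow> carrier V \<and>
     (\<forall>F c. finite F \<longrightarrow> F \<subseteq> I \<longrightarrow> c \<in> F \<rightarrow> carrier K \<longrightarrow>
        (\<Oplus>\<^bsub>V\<^esub>i\<in>F. c i \<odot>\<^bsub>V\<^esub> b i) = \<zero>\<^bsub>V\<^esub> \<longrightarrow> (\<forall>i\<in>F. c i = \<zero>\<^bsub>K\<^esub>)) \<and>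
     (\<forall>v\<in>carrier V. \<exists>F c. finite F \<and> F \<subseteq> I \<and> c \<in> F \<rightarrow> carrier K \<and>
        v = (\<Oplus>\<^bsub>V\<^esub>i\<in>F. c i \<odot>\<^bsub>V\<^esub> b i))"

definition sum_of :: "('a, 'v, 'z) module_scheme \<Rightarrow> 'i set \<Rightarrow> ('i \<Rightarrow> 'v set) \<Rightarrow> 'v set" where
  "sum_of V I C = {(\<Oplus>\<^bsub>V\<^esub>i\<in>F. x i) | F x. finite F \<and> F \<subseteq> I \<and> x \<in> Pi F C}"

definition is_direct_sum_of :: "('a, 'v, 'z) module_scheme \<Rightarrow> 'i set \<Rightarrow> ('i \<Rightarrow> 'v set) \<Rightarrow> bool" where
  "is_direct_sum_of V I C \<longleftrightarrow>
     carrier V = sum_of V I C \<and>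
     (\<forall>F x. finite F \<longrightarrow> F \<subseteq> I \<longrightarrow> x \<in> Pi F C \<longrightarrow>
        (\<Oplus>\<^bsub>V\<^esub>i\<in>F. x i) = \<zero>\<^bsub>V\<^esub> \<longrightarrow> (\<forall>i\<in>F. x i = \<zero>\<^bsub>V\<^esub>))"

text \<open>The library's quotient ring, with the scalar multiplication \<open>c (I + x) = I + c x\<close>.\<close>

definition quot_alg :: "('k, 'a) module \<Rightarrow> 'a set \<Rightarrow> ('k, 'a set) module" where
  "quot_alg A I =
     ring.extend (A Quot I) (module.fields (\<lambda>c C. \<Union>x\<in>C. I +>\<^bsub>A\<^esub> (c \<odot>\<^bsub>A\<^esub> x)))"

text \<open>The library's \<open>module\<close> locale requires a commutative ring of scalars.\<close>

locale left_module = ring A + M: abelian_group M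
  for A :: "('a, 'z) ring_scheme" (structure) and M :: "('a, 'm) module" +
  assumes smult_closed:
      "\<lbrakk>a \<in> carrier A; x \<in> carrier M\<rbrakk> \<Longrightarrow> a \<odot>\<^bsub>M\<^esub> x \<in> carrier M"
    and smult_l_distr:
      "\<lbrakk>a \<in> carrier A; b \<in> carrier A; x \<in> carrier M\<rbrakk> \<Longrightarrow>
        (a \<oplus> b) \<odot>\<^bsub>M\<^esub> x = a \<odot>\<^bsub>M\<^esub> x \<oplus>\<^bsub>M\<^esub> b \<odot>\<^bsub>M\<^esub> x"
    and smult_r_distr:
      "\<lbrakk>a \<in> carrier A; x \<in> carrier M; y \<in> carrier M\<rbrakk> \<Longrightarrow>
        a \<odot>\<^bsub>M\<^esub> (x \<oplus>\<^bsub>M\<^esub> y) = a \<odot>\<^bsub>M\<^esub> x \<oplus>\<^bsub>M\<^esub> a \<odot>\<^bsub>M\<^esub> y"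
    and smult_assoc:
      "\<lbrakk>a \<in> carrier A; b \<in> carrier A; x \<in> carrier M\<rbrakk> \<Longrightarrow>
        (a \<otimes> b) \<odot>\<^bsub>M\<^esub> x = a \<odot>\<^bsub>M\<^esub> (b \<odot>\<^bsub>M\<^esub> x)"
    and smult_one:
      "x \<in> carrier M \<Longrightarrow> \<one> \<odot>\<^bsub>M\<^esub> x = x"

definition simple_module :: "('a, 'z) ring_scheme \<Rightarrow> ('a, 'm) module \<Rightarrow> bool" where
  "simple_module A M \<longleftrightarrow>
     left_module A M \<and> carrier M \<noteq> {\<zero>\<^bsub>M\<^esub>} \<and>
     (\<forall>N. submodule N A M \<longrightarrow> N = {\<zero>\<^bsub>M\<^esub>} \<or> N = carrier M)"

record ('k, 'r, 'n) tgw_data =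
  tgw_K :: "'k ring"
  tgw_R :: "('k, 'r) module"
  tgw_sigma :: "'n \<Rightarrow> 'r \<Rightarrow> 'r"
  tgw_t :: "'n \<Rightarrow> 'r"
  tgw_mu :: "'n \<Rightarrow> 'n \<Rightarrow> 'k"

definition is_tgw_data :: "('k, 'r, 'n) tgw_data \<Rightarrow> bool" where
  "is_tgw_data D \<longleftrightarrow>
     field (tgw_K D) \<and>
     algebra (tgw_K D) (tgw_R D) \<and>
     (\<forall>i. tgw_sigma D i \<in> ring_iso (tgw_R D) (tgw_R D)) \<and>
     (\<forall>i. \<forall>c\<in>carrier (tgw_K D). \<forall>r\<in>carrier (tgw_R D).
        tgw_sigma D i (c \<odot>\<^bsub>tgw_R D\<^esub> r) = c \<odot>\<^bsub>tgw_R D\<^esub> tgw_sigma D i r) \<and>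
     (\<forall>i j. \<forall>r\<in>carrier (tgw_R D).
        tgw_sigma D i (tgw_sigma D j r) = tgw_sigma D j (tgw_sigma D i r)) \<and>
     (\<forall>i j. tgw_mu D i j \<in> carrier (tgw_K D) - {\<zero>\<^bsub>tgw_K D\<^esub>}) \<and>
     (\<forall>i. tgw_t D i \<in> carrier (tgw_R D) - {\<zero>\<^bsub>tgw_R D\<^esub>})"

abbreviation sigma_inv :: "('k, 'r, 'n) tgw_data \<Rightarrow> 'n \<Rightarrow> 'r \<Rightarrow> 'r" where
  "sigma_inv D i \<equiv> inv_into (carrier (tgw_R D)) (tgw_sigma D i)"

definition sigma_pow :: "('k, 'r, 'n) tgw_data \<Rightarrow> 'n \<Rightarrow> int \<Rightarrow> 'r \<Rightarrow> 'r" where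
  "sigma_pow D i z =
     (if 0 \<le> z then (tgw_sigma D i) ^^ nat z else (sigma_inv D i) ^^ nat (- z))"

definition act :: "('k, 'r, 'n::{finite, linorder}) tgw_data \<Rightarrow> (int, 'n) vec \<Rightarrow> 'r \<Rightarrow> 'r" where
  "act D g = foldr (\<lambda>i. sigma_pow D i (g $ i)) (sorted_list_of_set UNIV)"

definition max_spec :: "('k, 'r, 'n) tgw_data \<Rightarrow> 'r set set" where
  "max_spec D = {\<nn>. maximalideal \<nn> (tgw_R D)}"

text \<open>The group \<open>\<int>\<^sup>n\<^sub>\<omega>\<close>, for \<open>\<omega>\<close> the orbit of \<open>\<mm>\<close>: \<open>\<int>\<^sup>n\<close> is abelian, so all points of \<open>\<omega>\<close> have
  the same stabilizer.\<close>

definition stab :: "('k, 'r, 'n::{finite, linorder}) tgw_data \<Rightarrow> 'r set \<Rightarrow> (int, 'n) vec set" where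
  "stab D \<mm> = {g. act D g ` \<mm> = \<mm>}"

datatype 'n gen = X 'n | Y 'n

datatype ('r, 'n) letter = Coef 'r | Gen "'n gen"

text \<open>
  The free unital \<open>K\<close>-algebra on the symbols \<open>Coef r\<close> (\<open>r\<close> in \<open>R\<close>), \<open>X\<^sub>i\<close>, \<open>Y\<^sub>i\<close>: finitely supported
  \<open>K\<close>-valued functions on lists of symbols, with the product extending concatenation.
\<close>

definition free_alg ::
  "('k, 'r, 'n) tgw_data \<Rightarrow> ('k, ('r, 'n) letter list \<Rightarrow> 'k) module" where
  "free_alg D = (let K = tgw_K D in
     \<lparr>carrier = {p. (\<forall>w. p w \<in> carrier K) \<and> finite {w. p w \<noteq> \<zero>\<^bsub>K\<^esub>} \<and>
                   (\<forall>w. p w \<noteq> \<zero>\<^bsub>K\<^esub> \<longrightarrow> w \<in> lists (Coef ` carrier (tgw_R D) \<union> range Gen))},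
      mult = (\<lambda>p q w. \<Oplus>\<^bsub>K\<^esub>i\<in>{..length w}. p (take i w) \<otimes>\<^bsub>K\<^esub> q (drop i w)),
      one = (\<lambda>w. if w = [] then \<one>\<^bsub>K\<^esub> else \<zero>\<^bsub>K\<^esub>),
      zero = (\<lambda>w. \<zero>\<^bsub>K\<^esub>),
      add = (\<lambda>p q w. p w \<oplus>\<^bsub>K\<^esub> q w),
      smult = (\<lambda>c p w. c \<otimes>\<^bsub>K\<^esub> p w)\<rparr>)"

definition monomial ::
  "('k, 'r, 'n) tgw_data \<Rightarrow> ('r, 'n) letter list \<Rightarrow> ('r, 'n) letter list \<Rightarrow> 'k" where
  "monomial D u = (\<lambda>w. if w = u then \<one>\<^bsub>tgw_K D\<^esub> else \<zero>\<^bsub>tgw_K D\<^esub>)"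

text \<open>The first four families make \<open>r \<mapsto> Coef r\<close> a homomorphism of unital \<open>K\<close>-algebras from \<open>R\<close>.\<close>

definition relators ::
  "('k, 'r, 'n) tgw_data \<Rightarrow> (('r, 'n) letter list \<Rightarrow> 'k) set" where
  "relators D = (let K = tgw_K D; R = tgw_R D; F = free_alg D; \<sigma> = tgw_sigma D;
       x = (\<lambda>i. Gen (X i)); y = (\<lambda>i. Gen (Y i)) in
     {monomial D [Coef (r \<oplus>\<^bsub>R\<^esub> s)] \<ominus>\<^bsub>F\<^esub> (monomial D [Coef r] \<oplus>\<^bsub>F\<^esub> monomial D [Coef s]) | r s.
        r \<in> carrier R \<and> s \<in> carrier R} \<union>
     {monomial D [Coef (r \<otimes>\<^bsub>R\<^esub> s)] \<ominus>\<^bsub>F\<^esub> monomial D [Coef r, Coef s] | r s.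
        r \<in> carrier R \<and> s \<in> carrier R} \<union>
     {monomial D [Coef (c \<odot>\<^bsub>R\<^esub> r)] \<ominus>\<^bsub>F\<^esub> c \<odot>\<^bsub>F\<^esub> monomial D [Coef r] | c r.
        c \<in> carrier K \<and> r \<in> carrier R} \<union>
     {monomial D [Coef \<one>\<^bsub>R\<^esub>] \<ominus>\<^bsub>F\<^esub> monomial D []} \<union>
     {monomial D [x i, Coef r] \<ominus>\<^bsub>F\<^esub> monomial D [Coef (\<sigma> i r), x i] | i r. r \<in> carrier R} \<union>
     {monomial D [y i, Coef r] \<ominus>\<^bsub>F\<^esub> monomial D [Coef (sigma_inv D i r), y i] | i r.
        r \<in> carrier R} \<union>
     {monomial D [y i, x i] \<ominus>\<^bsub>F\<^esub> monomial D [Coef (tgw_t D i)] | i. True} \<union>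
     {monomial D [x i, y i] \<ominus>\<^bsub>F\<^esub> monomial D [Coef (\<sigma> i (tgw_t D i))] | i. True} \<union>
     {monomial D [x i, y j] \<ominus>\<^bsub>F\<^esub> tgw_mu D i j \<odot>\<^bsub>F\<^esub> monomial D [y j, x i] | i j. i \<noteq> j})"

definition rel_ideal ::
  "('k, 'r, 'n) tgw_data \<Rightarrow> (('r, 'n) letter list \<Rightarrow> 'k) set" where
  "rel_ideal D = Idl\<^bsub>free_alg D\<^esub> (relators D)"

definition tgwc ::
  "('k, 'r, 'n) tgw_data \<Rightarrow> ('k, (('r, 'n) letter list \<Rightarrow> 'k) set) module" where
  "tgwc D = quot_alg (free_alg D) (rel_ideal D)"

definition emb ::
  "('k, 'r, 'n) tgw_data \<Rightarrow> 'r \<Rightarrow> (('r, 'n) letter list \<Rightarrow> 'k) set" where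
  "emb D r = rel_ideal D +>\<^bsub>free_alg D\<^esub> monomial D [Coef r]"

text \<open>A word is a list of generators; \<open>word D a\<close> is the element of \<open>A\<close> it represents.\<close>

definition word ::
  "('k, 'r, 'n) tgw_data \<Rightarrow> 'n gen list \<Rightarrow> (('r, 'n) letter list \<Rightarrow> 'k) set" where
  "word D a = rel_ideal D +>\<^bsub>free_alg D\<^esub> monomial D (map Gen a)"

fun gen_star :: "'n gen \<Rightarrow> 'n gen" where
  "gen_star (X i) = Y i"
| "gen_star (Y i) = X i"

definition star :: "'n gen list \<Rightarrow> 'n gen list" where
  "star a = rev (map gen_star a)"

fun letter_deg :: "('r, 'n::finite) letter \<Rightarrow> (int, 'n) vec" where
  "letter_deg (Coef r) = 0"
| "letter_deg (Gen (X i)) = axis i 1"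
| "letter_deg (Gen (Y i)) = - axis i 1"

definition deg :: "('r, 'n::finite) letter list \<Rightarrow> (int, 'n) vec" where
  "deg w = sum_list (map letter_deg w)"

definition comp ::
  "('k, 'r, 'n::finite) tgw_data \<Rightarrow> (int, 'n) vec \<Rightarrow> (('r, 'n) letter list \<Rightarrow> 'k) set set" where
  "comp D g = {rel_ideal D +>\<^bsub>free_alg D\<^esub> p | p.
     p \<in> carrier (free_alg D) \<and> (\<forall>w. p w \<noteq> \<zero>\<^bsub>tgw_K D\<^esub> \<longrightarrow> deg w = g)}"

text \<open>The condition that \<open>a\<^sup>*a\<close> is not in \<open>\<nn>\<close>, where \<open>R\<close> is identified with its image in \<open>A\<close>.\<close>

definition star_notin :: "('k, 'r, 'n) tgw_data \<Rightarrow> 'n gen list \<Rightarrow> 'r set \<Rightarrow> bool" where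
  "star_notin D a \<nn> \<longleftrightarrow> word D (star a) \<otimes>\<^bsub>tgwc D\<^esub> word D a \<notin> emb D ` \<nn>"

definition weight_space ::
  "('k, 'r, 'n) tgw_data \<Rightarrow> ((('r, 'n) letter list \<Rightarrow> 'k) set, 'm) module \<Rightarrow> 'r set \<Rightarrow> 'm set" where
  "weight_space D M \<nn> = {v \<in> carrier M. \<forall>r\<in>\<nn>. emb D r \<odot>\<^bsub>M\<^esub> v = \<zero>\<^bsub>M\<^esub>}"

definition weight_module ::
  "('k, 'r, 'n) tgw_data \<Rightarrow> ((('r, 'n) letter list \<Rightarrow> 'k) set, 'm) module \<Rightarrow> bool" where
  "weight_module D M \<longleftrightarrow>
     left_module (tgwc D) M \<and> is_direct_sum_of M (max_spec D) (weight_space D M)"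

definition supp ::
  "('k, 'r, 'n) tgw_data \<Rightarrow> ((('r, 'n) letter list \<Rightarrow> 'k) set, 'm) module \<Rightarrow> 'r set set" where
  "supp D M = {\<nn> \<in> max_spec D. weight_space D M \<nn> \<noteq> {\<zero>\<^bsub>M\<^esub>}}"

definition no_proper_inner_breaks ::
  "('k, 'r, 'n) tgw_data \<Rightarrow> ((('r, 'n) letter list \<Rightarrow> 'k) set, 'm) module \<Rightarrow> bool" where
  "no_proper_inner_breaks D M \<longleftrightarrow>
     (\<forall>\<nn>\<in>supp D M. \<forall>a. (\<exists>v\<in>weight_space D M \<nn>. word D a \<odot>\<^bsub>M\<^esub> v \<noteq> \<zero>\<^bsub>M\<^esub>) \<longrightarrow> star_notin D a \<nn>)"

definition Bomega :: "('k, 'r, 'n::{finite, linorder}) tgw_data \<Rightarrow> 'r set \<Rightarrow>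
    ('k, (('r, 'n) letter list \<Rightarrow> 'k) set) module" where
  "Bomega D \<mm> = (tgwc D)\<lparr>carrier := sum_of (tgwc D) (stab D \<mm>) (comp D)\<rparr>"

definition m_ideal :: "('k, 'r, 'n::{finite, linorder}) tgw_data \<Rightarrow> 'r set \<Rightarrow>
    (('r, 'n) letter list \<Rightarrow> 'k) set set" where
  "m_ideal D \<mm> = Idl\<^bsub>Bomega D \<mm>\<^esub> (emb D ` \<mm>)"

definition Bm :: "('k, 'r, 'n::{finite, linorder}) tgw_data \<Rightarrow> 'r set \<Rightarrow>
    ('k, (('r, 'n) letter list \<Rightarrow> 'k) set set) module" where
  "Bm D \<mm> = quot_alg (Bomega D \<mm>) (m_ideal D \<mm>)"

definition phi :: "('k, 'r, 'n::{finite, linorder}) tgw_data \<Rightarrow> 'r set \<Rightarrow>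
    (('r, 'n) letter list \<Rightarrow> 'k) set \<Rightarrow> (('r, 'n) letter list \<Rightarrow> 'k) set set" where
  "phi D \<mm> x = m_ideal D \<mm> +>\<^bsub>Bomega D \<mm>\<^esub> x"

definition Gtilde :: "('k, 'r, 'n::{finite, linorder}) tgw_data \<Rightarrow> 'r set \<Rightarrow> (int, 'n) vec set" where
  "Gtilde D \<mm> = {g. \<exists>a. word D a \<in> comp D g \<and> star_notin D a \<mm>}"

definition Gm :: "('k, 'r, 'n::{finite, linorder}) tgw_data \<Rightarrow> 'r set \<Rightarrow> (int, 'n) vec set" where
  "Gm D \<mm> = Gtilde D \<mm> \<inter> stab D \<mm>"

definition word_choice ::
  "('k, 'r, 'n::{finite, linorder}) tgw_data \<Rightarrow> 'r set \<Rightarrow> ((int, 'n) vec \<Rightarrow> 'n gen list) \<Rightarrow> bool" where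
  "word_choice D \<mm> a \<longleftrightarrow>
     a 0 = [] \<and> (\<forall>g\<in>Gtilde D \<mm>. word D (a g) \<in> comp D g \<and> star_notin D (a g) \<mm>)"

definition Bm1 :: "('k, 'r, 'n::{finite, linorder}) tgw_data \<Rightarrow> 'r set \<Rightarrow>
    (('r, 'n) letter list \<Rightarrow> 'k) set set set" where
  "Bm1 D \<mm> = sum_of (Bm D \<mm>) (Gm D \<mm>) (\<lambda>g. phi D \<mm> ` comp D g)"

definition Bm0 :: "('k, 'r, 'n::{finite, linorder}) tgw_data \<Rightarrow> 'r set \<Rightarrow>
    (('r, 'n) letter list \<Rightarrow> 'k) set set set" where
  "Bm0 D \<mm> = sum_of (Bm D \<mm>) (stab D \<mm> - Gm D \<mm>) (\<lambda>g. phi D \<mm> ` comp D g)"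

text \<open>
  The action of \<open>B\<^sub>\<mm>\<close> on \<open>M\<^sub>\<mm>\<close>: all representatives \<open>x\<close> of the coset \<open>b\<close> act on a vector of \<open>M\<^sub>\<mm>\<close>
  in the same way.
\<close>

definition Bm_act :: "('a, 'm) module \<Rightarrow> 'a set \<Rightarrow> 'm \<Rightarrow> 'm" where
  "Bm_act M b v = the_elem ((\<lambda>x. x \<odot>\<^bsub>M\<^esub> v) ` b)"

definition Rm :: "('k, 'r, 'n) tgw_data \<Rightarrow> 'r set \<Rightarrow> ('k, 'r set) module" where
  "Rm D \<mm> = quot_alg (tgw_R D) \<mm>"

text \<open>The image in \<open>B\<^sub>\<mm>\<close> of \<open>l\<close> in \<open>R\<^sub>\<mm>\<close>: the common value of \<open>phi\<close> on the coset \<open>l\<close>.\<close>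

definition Rm_emb :: "('k, 'r, 'n::{finite, linorder}) tgw_data \<Rightarrow> 'r set \<Rightarrow>
    'r set \<Rightarrow> (('r, 'n) letter list \<Rightarrow> 'k) set set" where
  "Rm_emb D \<mm> l = the_elem ((\<lambda>r. phi D \<mm> (emb D r)) ` l)"

text \<open>\<open>g (\<mm> + r) = \<mm> + g(r)\<close> for \<open>g\<close> in the stabilizer of \<open>\<mm>\<close>.\<close>

definition Rm_act ::
  "('k, 'r, 'n::{finite, linorder}) tgw_data \<Rightarrow> (int, 'n) vec \<Rightarrow> 'r set \<Rightarrow> 'r set" where
  "Rm_act D g l = act D g ` l"

definition is_Z_basis :: "nat \<Rightarrow> (nat \<Rightarrow> (int, 'n::finite) vec) \<Rightarrow> (int, 'n) vec set \<Rightarrow> bool" where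
  "is_Z_basis k s G \<longleftrightarrow>
     bij_betw (\<lambda>l. \<Sum>i<k. l i *s s i) ({..<k} \<rightarrow>\<^sub>E (UNIV :: int set)) G"

definition ordered_monomial ::
  "('a, 'z) monoid_scheme \<Rightarrow> nat \<Rightarrow> (nat \<Rightarrow> 'a) \<Rightarrow> (nat \<Rightarrow> int) \<Rightarrow> 'a" where
  "ordered_monomial B k b l = foldr (\<lambda>i p. b i [^]\<^bsub>B\<^esub> l i \<otimes>\<^bsub>B\<^esub> p) [0..<k] \<one>\<^bsub>B\<^esub>"

end

theory Submission
  imports Defs
begin

text \<open>
  Everything rests on gradings.  The defining relations are homogeneous, so the ideal they generate
  in the free algebra is the sum of its homogeneous parts (\<open>rel_ideal_eq\<close>), and \<open>A\<close> is the direct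
  sum of its components \<open>A\<^sub>g\<close>.  The component \<open>A\<^sub>g\<close> is spanned over \<open>R\<close> by the words of degree \<open>g\<close>
  (\<open>comp_induct\<close>), its elements satisfy \<open>x r = g(r) x\<close> (\<open>comp_emb\<close>), and \<open>A\<^sub>0 = R\<close> (\<open>comp_zero\<close>),
  because the letters \<open>X\<close> of a word can be moved to the right of the letters \<open>Y\<close>.

  The elements of the stabilizer of \<open>\<mm>\<close> preserve \<open>\<mm>\<close>, so the two-sided ideal \<open>(\<mm>)\<close> of \<open>B(\<omega>)\<close> is
  just the sum of the \<open>A\<^sub>g \<mm>\<close> (\<open>m_ideal_eq\<close>).  Hence \<open>B\<^sub>\<mm>\<close> is graded as well, and since
  \<open>A\<^sub>0 \<mm> = \<mm>\<close>, the field \<open>R\<^sub>\<mm>\<close> embeds as the component of degree zero.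

  Part a).  An element of \<open>A\<^sub>g\<close> with \<open>g\<close> outside \<open>G\<^sub>\<mm>\<close> is a combination of words \<open>a\<close> of degree \<open>g\<close>.
  If \<open>a\<close> did not kill \<open>M\<^sub>\<mm>\<close>, then \<open>a\<^sup>*a\<close> would not be in \<open>\<mm>\<close>, as \<open>M\<close> has no proper inner breaks, and \<open>g\<close>
  would be in \<open>G\<^sub>\<mm>\<close> (\<open>comp_kills\<close>).  The ideal \<open>(\<mm>)\<close> kills \<open>M\<^sub>\<mm>\<close>, so this passes to \<open>B\<^sub>\<mm>\<close>.

  Part b).  For \<open>g\<close> in \<open>G\<^sub>\<mm>\<close> and \<open>a = a\<^sub>g\<close>, both \<open>a\<^sup>*a\<close> and \<open>a a\<^sup>*\<close> are elements of \<open>R\<close> outside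
  \<open>\<mm>\<close>, so the image of \<open>a\<close> is a unit, with inverse in degree \<open>- g\<close> (\<open>word_hunit\<close>).  Therefore the
  ordered monomials in the \<open>b\<^sub>i\<close> give a homogeneous unit in each degree of \<open>G\<^sub>\<mm>\<close>, exactly one per
  degree because the \<open>s\<^sub>i\<close> are a basis.  A component that contains a homogeneous unit \<open>u\<close> is
  \<open>R\<^sub>\<mm> u\<close>, as dividing by \<open>u\<close> leads to degree zero (\<open>Qc_unit_multiple\<close>).  This gives the basis
  (\<open>basis_Bm1\<close>), and also \<open>\<lambda>\<^sub>i\<^sub>j\<close>, because \<open>b\<^sub>i b\<^sub>j\<close> and \<open>b\<^sub>j b\<^sub>i\<close> are homogeneous units of the same
  degree.
\<close>

section \<open>Sums of subgroups\<close>

text \<open>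
  Subalgebras and subspaces are records whose carrier was replaced by a subgroup.  Sums in the
  smaller record are those of the larger one.
\<close>

lemma abelian_group_carrier_update:
  assumes V: "abelian_group V" and H: "additive_subgroup H V"
  shows "abelian_group (V\<lparr>carrier := H\<rparr>)"
proof -
  interpret V: abelian_group V by (fact V)
  interpret H: additive_subgroup H V by (fact H)
  have H: "x \<in> carrier V" if "x \<in> H" for x
    using that by (rule H.a_Hcarr)
  show ?thesis
  proof (rule abelian_groupI)
    fix x assume "x \<in> carrier (V\<lparr>carrier := H\<rparr>)"
    then have x: "x \<in> H" by simp
    show "\<exists>y\<in>carrier (V\<lparr>carrier := H\<rparr>). y \<oplus>\<^bsub>V\<lparr>carrier := H\<rparr>\<^esub> x = \<zero>\<^bsub>V\<lparr>carrier := H\<rparr>\<^esub>"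
      using V.l_neg[OF H[OF x]] H.a_inv_closed[OF x] by (intro bexI[of _ "\<ominus>\<^bsub>V\<^esub> x"]) simp_all
  next
    fix x y assume "x \<in> carrier (V\<lparr>carrier := H\<rparr>)" "y \<in> carrier (V\<lparr>carrier := H\<rparr>)"
    then show "x \<oplus>\<^bsub>V\<lparr>carrier := H\<rparr>\<^esub> y = y \<oplus>\<^bsub>V\<lparr>carrier := H\<rparr>\<^esub> x"
      using V.a_comm[OF H H] by simp
  qed (simp_all add: H V.a_assoc H.a_closed H.zero_closed)
qed

lemma finsum_carrier_update:
  assumes V: "abelian_group V" and H: "additive_subgroup H V" and f: "f \<in> F \<rightarrow> H"
  shows "finsum (V\<lparr>carrier := H\<rparr>) f F = finsum V f F"
proof (cases "finite F")
  case True
  interpret V: abelian_group V by (fact V)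
  interpret H: additive_subgroup H V by (fact H)
  interpret VH: abelian_group "V\<lparr>carrier := H\<rparr>"
    using V H by (rule abelian_group_carrier_update)
  from True f show ?thesis
  proof (induction F)
    case empty
    show ?case by simp
  next
    case (insert i F)
    then have H: "f \<in> F \<rightarrow> H" "f i \<in> H" by auto
    then have "f \<in> F \<rightarrow> carrier V" "f i \<in> carrier V" using H.a_subset by blast+
    then show ?case
      using V.finsum_insert[OF insert(1,2)] VH.finsum_insert[OF insert(1,2)] H insert(3) by simp
  qed
next
  case False
  then show ?thesis by (simp add: finsum_def finprod_def)
qed

lemma finsum_subgroup:
  assumes "abelian_group V" "additive_subgroup H V" "f \<in> F \<rightarrow> H"
  shows "finsum V f F \<in> H"
proof -
  interpret H: abelian_group "V\<lparr>carrier := H\<rparr>"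
    using assms(1,2) by (rule abelian_group_carrier_update)
  have "finsum (V\<lparr>carrier := H\<rparr>) f F \<in> carrier (V\<lparr>carrier := H\<rparr>)"
    using assms(3) by (intro H.finsum_closed) simp
  then show ?thesis using finsum_carrier_update[OF assms] by simp
qed

lemma finsum_hom:
  assumes V: "abelian_group V" and W: "abelian_group W"
    and h: "\<And>x. x \<in> carrier V \<Longrightarrow> h x \<in> carrier W"
      "\<And>x y. x \<in> carrier V \<Longrightarrow> y \<in> carrier V \<Longrightarrow> h (x \<oplus>\<^bsub>V\<^esub> y) = h x \<oplus>\<^bsub>W\<^esub> h y"
      "h \<zero>\<^bsub>V\<^esub> = \<zero>\<^bsub>W\<^esub>"
    and F: "finite F" and f: "f \<in> F \<rightarrow> carrier V"
  shows "h (finsum V f F) = finsum W (\<lambda>i. h (f i)) F"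
proof -
  interpret V: abelian_group V by (fact V)
  interpret W: abelian_group W by (fact W)
  from F f show ?thesis
  proof (induction F)
    case empty
    show ?case by (simp add: h)
  next
    case (insert i F)
    then have "(\<lambda>i. h (f i)) \<in> F \<rightarrow> carrier W" "f \<in> F \<rightarrow> carrier V" "f i \<in> carrier V"
      using h(1) by auto
    with insert show ?case by (simp add: h)
  qed
qed

lemma sum_of_induct:
  assumes V: "abelian_group V" and C: "\<And>i. i \<in> I \<Longrightarrow> C i \<subseteq> carrier V"
    and v: "v \<in> sum_of V I C"
    and zero: "P \<zero>\<^bsub>V\<^esub>"
    and add: "\<And>i x y. i \<in> I \<Longrightarrow> x \<in> C i \<Longrightarrow> y \<in> sum_of V I C \<Longrightarrow> P y \<Longrightarrow> P (x \<oplus>\<^bsub>V\<^esub> y)"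
  shows "P v"
proof -
  interpret V: abelian_group V by (fact V)
  obtain F x where F: "finite F" "F \<subseteq> I" "x \<in> Pi F C" and v: "v = finsum V x F"
    using v by (auto simp: sum_of_def)
  have "P (finsum V x F)" using F
  proof (induction F)
    case empty
    show ?case using zero by simp
  next
    case (insert i F)
    have *: "x \<in> F \<rightarrow> carrier V" "x i \<in> carrier V" using insert C by auto
    have "finsum V x F \<in> sum_of V I C" using insert by (auto simp: sum_of_def)
    moreover have "P (finsum V x F)" using insert by simp
    ultimately have "P (x i \<oplus>\<^bsub>V\<^esub> finsum V x F)" using insert.prems by (intro add[of i]) auto
    then show ?case using insert * by simp
  qed
  then show ?thesis by (simp add: v)
qed

text \<open>
  Subgroups \<open>C i\<close> of \<open>V\<close>, indexed by a set; their sum is \<open>sum_of V I C\<close>.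
\<close>

locale subgroup_family = abelian_group V for V :: "('k, 'v) module" (structure) +
  fixes I :: "'i set" and C :: "'i \<Rightarrow> 'v set"
  assumes component: "i \<in> I \<Longrightarrow> additive_subgroup (C i) V"

lemma subgroup_familyI:
  assumes "abelian_group V" "\<And>i. i \<in> I \<Longrightarrow> additive_subgroup (C i) V"
  shows "subgroup_family V I C"
  using assms by (intro subgroup_family.intro subgroup_family_axioms.intro)

context subgroup_family
begin

lemma component_carrier: "i \<in> I \<Longrightarrow> x \<in> C i \<Longrightarrow> x \<in> carrier V"
  by (rule additive_subgroup.a_Hcarr[OF component])

lemma component_zero: "i \<in> I \<Longrightarrow> \<zero> \<in> C i"
  by (rule additive_subgroup.zero_closed[OF component])

lemma component_add: "i \<in> I \<Longrightarrow> x \<in> C i \<Longrightarrow> y \<in> C i \<Longrightarrow> x \<oplus> y \<in> C i"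
  by (rule additive_subgroup.a_closed[OF component])

lemma component_uminus: "i \<in> I \<Longrightarrow> x \<in> C i \<Longrightarrow> \<ominus> x \<in> C i"
  by (rule additive_subgroup.a_inv_closed[OF component])

lemma family_carrier: "F \<subseteq> I \<Longrightarrow> x \<in> Pi F C \<Longrightarrow> x \<in> F \<rightarrow> carrier V"
  using component_carrier by blast

lemma sum_of_carrier: "v \<in> sum_of V I C \<Longrightarrow> v \<in> carrier V"
  by (auto simp: sum_of_def intro!: finsum_closed dest: family_carrier)

lemma sum_of_zero: "\<zero> \<in> sum_of V I C"
  unfolding sum_of_def by (rule CollectI, rule exI[of _ "{}"]) simp

lemma sum_of_add_component:
  assumes i: "i \<in> I" and x: "x \<in> C i" and y: "y \<in> sum_of V I C"
  shows "x \<oplus> y \<in> sum_of V I C"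
proof -
  obtain F f where F: "finite F" "F \<subseteq> I" "f \<in> Pi F C" and y: "y = finsum V f F"
    using y by (auto simp: sum_of_def)
  note fF = family_carrier[OF F(2,3)] component_carrier[OF i x]
  define f' where "f' = f(i := if i \<in> F then x \<oplus> f i else x)"
  have f': "f' \<in> Pi (insert i F) C"
    using F(3) x component_add[OF i x] by (auto simp: f'_def Pi_iff)
  have "x \<oplus> y = finsum V f' (insert i F)"
  proof (cases "i \<in> F")
    case True
    define F' where "F' = F - {i}"
    have F': "F = insert i F'" "i \<notin> F'" "finite F'" using True F by (auto simp: F'_def)
    have *: "f \<in> F' \<rightarrow> carrier V" "f i \<in> carrier V" using fF F' by auto
    have "finsum V f' F' = finsum V f F'"
      using F' * by (intro finsum_cong') (auto simp: f'_def)
    moreover have "f' \<in> F' \<rightarrow> carrier V" using F' * by (auto simp: f'_def)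
    ultimately show ?thesis using F' * fF True
      unfolding y by (simp add: a_assoc f'_def)
  next
    case False
    have "finsum V f' F = finsum V f F"
      using fF False by (intro finsum_cong') (auto simp: f'_def)
    moreover have "f' \<in> F \<rightarrow> carrier V" using False fF by (auto simp: f'_def)
    ultimately show ?thesis using False F fF
      unfolding y by (simp add: f'_def)
  qed
  then show ?thesis using f' F i unfolding sum_of_def by blast
qed

lemma component_sum_of: "i \<in> I \<Longrightarrow> x \<in> C i \<Longrightarrow> x \<in> sum_of V I C"
  using sum_of_add_component[of i x \<zero>] sum_of_zero component_carrier[of i x] by simp

lemma sum_of_add:
  assumes "x \<in> sum_of V I C" "y \<in> sum_of V I C"
  shows "x \<oplus> y \<in> sum_of V I C"
  using abelian_group_axioms _ assms(1)
proof (rule sum_of_induct)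
  show "C i \<subseteq> carrier V" if "i \<in> I" for i using that component_carrier by blast
  show "\<zero> \<oplus> y \<in> sum_of V I C" using assms(2) sum_of_carrier by simp
next
  fix i x z assume "i \<in> I" "x \<in> C i" "z \<in> sum_of V I C" "z \<oplus> y \<in> sum_of V I C"
  then show "x \<oplus> z \<oplus> y \<in> sum_of V I C"
    using sum_of_add_component[of i x "z \<oplus> y"] component_carrier sum_of_carrier assms(2)
    by (simp add: a_assoc)
qed

lemma sum_of_uminus:
  assumes "x \<in> sum_of V I C"
  shows "\<ominus> x \<in> sum_of V I C"
  using abelian_group_axioms _ assms(1)
proof (rule sum_of_induct)
  show "C i \<subseteq> carrier V" if "i \<in> I" for i using that component_carrier by blast
  have "\<ominus> \<zero> = \<zero>" by (rule minus_equality) simp_all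
  then show "\<ominus> \<zero> \<in> sum_of V I C" by (simp only: sum_of_zero)
next
  fix i x y assume *: "i \<in> I" "x \<in> C i" "y \<in> sum_of V I C" "\<ominus> y \<in> sum_of V I C"
  then show "\<ominus> (x \<oplus> y) \<in> sum_of V I C"
    using sum_of_add_component[OF *(1) component_uminus[OF *(1,2)] *(4)]
      component_carrier sum_of_carrier by (simp add: minus_add)
qed

lemma sum_of_subgroup: "additive_subgroup (sum_of V I C) V"
proof (rule additive_subgroupI, unfold_locales)
  show "sum_of V I C \<subseteq> carrier (add_monoid V)" using sum_of_carrier by auto
  show "inv\<^bsub>add_monoid V\<^esub> x \<in> sum_of V I C" if "x \<in> sum_of V I C" for x
    using sum_of_uminus[OF that] by (simp add: a_inv_def)
qed (use sum_of_add sum_of_zero in auto)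

lemma sum_of_closed_induct:
  assumes "v \<in> sum_of V I C" "P \<zero>"
    and "\<And>i x y. i \<in> I \<Longrightarrow> x \<in> C i \<Longrightarrow> y \<in> sum_of V I C \<Longrightarrow> P y \<Longrightarrow> P (x \<oplus> y)"
  shows "P v"
  using abelian_group_axioms _ assms by (rule sum_of_induct) (use component_carrier in blast)

lemma subfamily: "T \<subseteq> I \<Longrightarrow> subgroup_family V T C"
  using component by (intro subgroup_familyI abelian_group_axioms) blast

lemma sum_of_carrier_update:
  assumes "additive_subgroup H V" "\<And>i. i \<in> I \<Longrightarrow> C i \<subseteq> H"
  shows "sum_of (V\<lparr>carrier := H\<rparr>) I C = sum_of V I C"
proof -
  have "finsum (V\<lparr>carrier := H\<rparr>) x F = finsum V x F" if "F \<subseteq> I" "x \<in> Pi F C" for x F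
  proof (rule finsum_carrier_update[OF abelian_group_axioms assms(1)])
    show "x \<in> F \<rightarrow> H" using that assms(2) by blast
  qed
  then show ?thesis unfolding sum_of_def by (intro Collect_cong) metis
qed

text \<open>Two finite sums can be compared even when they run over different index sets.\<close>

lemma direct_sum_unique:
  assumes direct: "is_direct_sum_of V I C"
    and F: "finite F" "F \<subseteq> I" "x \<in> Pi F C" and F': "finite F'" "F' \<subseteq> I" "y \<in> Pi F' C"
    and eq: "finsum V x F = finsum V y F'" and i: "i \<in> F"
  shows "x i = (if i \<in> F' then y i else \<zero>)"
proof -
  define x' y' where "x' i = (if i \<in> F then x i else \<zero>)"
    and "y' i = (if i \<in> F' then y i else \<zero>)" for i
  have sum: "finsum V (\<lambda>i. if i \<in> E then z i else \<zero>) (F \<union> F') = finsum V z E"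
    if "E \<subseteq> F \<union> F'" "z \<in> E \<rightarrow> carrier V" for E z
  proof -
    have "finsum V z E = finsum V (\<lambda>i. if i \<in> E then z i else \<zero>) E"
      using that by (intro finsum_cong') auto
    also have "\<dots> = finsum V (\<lambda>i. if i \<in> E then z i else \<zero>) (F \<union> F')"
      using that F(1) F'(1) by (intro add.finprod_mono_neutral_cong_left) auto
    finally show ?thesis by simp
  qed
  have x': "x' \<in> Pi (F \<union> F') C" and y': "y' \<in> Pi (F \<union> F') C"
    using F F' component_zero by (auto simp: x'_def y'_def subset_iff)
  have sub: "F \<union> F' \<subseteq> I" using F F' by blast
  note c = family_carrier[OF sub x'] family_carrier[OF sub y']
  have "finsum V x' (F \<union> F') = finsum V y' (F \<union> F')"
    using eq sum[of F x] sum[of F' y] family_carrier[OF F(2,3)] family_carrier[OF F'(2,3)]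
    by (simp add: x'_def[abs_def] y'_def[abs_def])
  moreover have "finsum V (\<lambda>i. x' i \<oplus> \<ominus> y' i) (F \<union> F') =
      finsum V x' (F \<union> F') \<oplus> finsum V (\<lambda>i. \<ominus> y' i) (F \<union> F')"
    using c by (intro finsum_addf) auto
  moreover have "finsum V (\<lambda>i. \<ominus> y' i) (F \<union> F') = \<ominus> finsum V y' (F \<union> F')"
    using finsum_hom[OF abelian_group_axioms abelian_group_axioms, of "a_inv V" "F \<union> F'" y'] c F(1) F'(1)
    by (simp add: minus_add)
  ultimately have "finsum V (\<lambda>i. x' i \<oplus> \<ominus> y' i) (F \<union> F') = \<zero>"
    using c by (simp add: r_neg)
  moreover have "(\<lambda>i. x' i \<oplus> \<ominus> y' i) \<in> Pi (F \<union> F') C"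
    using x' y' sub component_add component_uminus by (auto simp: subset_iff Pi_iff)
  ultimately have "x' i \<oplus> \<ominus> y' i = \<zero>"
    using direct F(1) F'(1) sub i unfolding is_direct_sum_of_def by blast
  moreover have "x' i \<in> carrier V" "y' i \<in> carrier V" using c i by auto
  ultimately have "x' i = y' i" using minus_equality[of "x' i" "\<ominus> y' i"] by (simp add: minus_minus)
  then show ?thesis using i by (simp add: x'_def y'_def)
qed

end

lemma is_basis_independent:
  assumes "is_basis K V I b" "finite F" "F \<subseteq> I" "c \<in> F \<rightarrow> carrier K"
    "finsum V (\<lambda>i. c i \<odot>\<^bsub>V\<^esub> b i) F = \<zero>\<^bsub>V\<^esub>" "i \<in> F"
  shows "c i = \<zero>\<^bsub>K\<^esub>"
  using assms(1)[unfolded is_basis_def, THEN conjunct2, THEN conjunct1, rule_format, OF assms(2-6)] .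

section \<open>Graded rings\<close>

text \<open>
  A ring graded by a submonoid \<open>S\<close> of an abelian group.  The family \<open>C\<close> is defined on the whole
  group; its values outside \<open>S\<close> are irrelevant.  The scalar multiplication of \<open>V\<close> plays no role.
\<close>

locale graded_ring = ring V + subgroup_family V S C
  for V :: "('k, 'v) module" (structure) and S :: "'g::ab_group_add set" and C :: "'g \<Rightarrow> 'v set" +
  assumes zero_degree: "0 \<in> S"
    and add_degree: "g \<in> S \<Longrightarrow> h \<in> S \<Longrightarrow> g + h \<in> S"
    and one_component: "\<one> \<in> C 0"
    and mult_component: "g \<in> S \<Longrightarrow> h \<in> S \<Longrightarrow> x \<in> C g \<Longrightarrow> y \<in> C h \<Longrightarrow> x \<otimes> y \<in> C (g + h)"
    and direct: "is_direct_sum_of V S C"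
begin

lemma carrier_sum_of: "carrier V = sum_of V S C"
  using direct by (simp add: is_direct_sum_of_def)

lemma graded_induct:
  assumes "v \<in> carrier V" "P \<zero>"
    and "\<And>g x y. g \<in> S \<Longrightarrow> x \<in> C g \<Longrightarrow> y \<in> carrier V \<Longrightarrow> P y \<Longrightarrow> P (x \<oplus> y)"
  shows "P v"
  using assms unfolding carrier_sum_of by (rule sum_of_closed_induct)

text \<open>
  A sum of subgroups \<open>N\<^sub>g\<close> of the components is an ideal if the family \<open>N\<close> is stable under
  multiplication by homogeneous elements, and then the quotient is graded again.  Both the ideal of
  relations and the ideal generated by \<open>\<mm>\<close> turn out to be of this form.
\<close>

lemma graded_ideal:
  assumes N: "\<And>g. g \<in> S \<Longrightarrow> additive_subgroup (N g) V"
    and l: "\<And>g h x y. g \<in> S \<Longrightarrow> h \<in> S \<Longrightarrow> x \<in> C h \<Longrightarrow> y \<in> N g \<Longrightarrow> x \<otimes> y \<in> N (h + g)"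
    and r: "\<And>g h x y. g \<in> S \<Longrightarrow> h \<in> S \<Longrightarrow> x \<in> C h \<Longrightarrow> y \<in> N g \<Longrightarrow> y \<otimes> x \<in> N (g + h)"
  shows "ideal (sum_of V S N) V"
proof -
  interpret N: subgroup_family V S N using abelian_group_axioms N by (rule subgroup_familyI)
  have l1: "x \<otimes> y \<in> sum_of V S N" if "x \<in> carrier V" "g \<in> S" "y \<in> N g" for g x y
    using that(1)
  proof (rule graded_induct)
    show "\<zero> \<otimes> y \<in> sum_of V S N" using that N.component_carrier N.sum_of_zero by simp
    show "(z \<oplus> w) \<otimes> y \<in> sum_of V S N"
      if "h \<in> S" "z \<in> C h" "w \<in> carrier V" "w \<otimes> y \<in> sum_of V S N" for h z w
    proof -
      have "z \<otimes> y \<in> N (h + g)" using that \<open>g \<in> S\<close> \<open>y \<in> N g\<close> l by blast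
      moreover have "(z \<oplus> w) \<otimes> y = z \<otimes> y \<oplus> w \<otimes> y"
        using that component_carrier N.component_carrier[OF \<open>g \<in> S\<close> \<open>y \<in> N g\<close>] by (simp add: l_distr)
      ultimately show ?thesis
        using that \<open>g \<in> S\<close> add_degree N.sum_of_add_component by fastforce
    qed
  qed
  have r1: "y \<otimes> x \<in> sum_of V S N" if "x \<in> carrier V" "g \<in> S" "y \<in> N g" for g x y
    using that(1)
  proof (rule graded_induct)
    show "y \<otimes> \<zero> \<in> sum_of V S N" using that N.component_carrier N.sum_of_zero by simp
    show "y \<otimes> (z \<oplus> w) \<in> sum_of V S N"
      if "h \<in> S" "z \<in> C h" "w \<in> carrier V" "y \<otimes> w \<in> sum_of V S N" for h z w
    proof -
      have "y \<otimes> z \<in> N (g + h)" using that \<open>g \<in> S\<close> \<open>y \<in> N g\<close> r by blast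
      moreover have "y \<otimes> (z \<oplus> w) = y \<otimes> z \<oplus> y \<otimes> w"
        using that component_carrier N.component_carrier[OF \<open>g \<in> S\<close> \<open>y \<in> N g\<close>] by (simp add: r_distr)
      ultimately show ?thesis
        using that \<open>g \<in> S\<close> add_degree N.sum_of_add_component by fastforce
    qed
  qed
  show ?thesis
  proof (rule idealI)
    show "ring V" by (rule ring_axioms)
    show "subgroup (sum_of V S N) (add_monoid V)"
      using N.sum_of_subgroup by (simp add: additive_subgroup_def)
  next
    fix v x assume v: "v \<in> sum_of V S N" and x: "x \<in> carrier V"
    from v show "x \<otimes> v \<in> sum_of V S N"
      by (rule N.sum_of_closed_induct)
        (use x N.sum_of_zero l1 N.component_carrier N.sum_of_carrier in \<open>auto simp: r_distr intro!: N.sum_of_add\<close>)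
    from v show "v \<otimes> x \<in> sum_of V S N"
      by (rule N.sum_of_closed_induct)
        (use x N.sum_of_zero r1 N.component_carrier N.sum_of_carrier in \<open>auto simp: l_distr intro!: N.sum_of_add\<close>)
  qed
qed

lemma restrict_degrees:
  assumes T: "T \<subseteq> S" "0 \<in> T" "\<And>g h. g \<in> T \<Longrightarrow> h \<in> T \<Longrightarrow> g + h \<in> T"
  shows "graded_ring (V\<lparr>carrier := sum_of V T C\<rparr>) T C"
proof -
  let ?H = "sum_of V T C"
  interpret T: subgroup_family V T C using T(1) by (rule subfamily)
  have m1: "x \<otimes> y \<in> ?H" if "g \<in> T" "x \<in> C g" "y \<in> ?H" for g x y
    using that(3)
  proof (rule T.sum_of_closed_induct)
    show "x \<otimes> \<zero> \<in> ?H" using that T.component_carrier T.sum_of_zero by simp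
    show "x \<otimes> (z \<oplus> w) \<in> ?H" if "h \<in> T" "z \<in> C h" "w \<in> ?H" "x \<otimes> w \<in> ?H" for h z w
    proof -
      have "x \<otimes> z \<in> C (g + h)"
        using that \<open>g \<in> T\<close> \<open>x \<in> C g\<close> T(1) by (intro mult_component) auto
      moreover have "x \<otimes> (z \<oplus> w) = x \<otimes> z \<oplus> x \<otimes> w"
        using that T.component_carrier T.sum_of_carrier \<open>g \<in> T\<close> \<open>x \<in> C g\<close> by (simp add: r_distr)
      ultimately show ?thesis
        using T.sum_of_add_component[OF T(3)[OF \<open>g \<in> T\<close> \<open>h \<in> T\<close>]] that by simp
    qed
  qed
  have m: "x \<otimes> y \<in> ?H" if "x \<in> ?H" "y \<in> ?H" for x y
    using that(1)
    by (rule T.sum_of_closed_induct)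
      (use that T.sum_of_zero m1 T.component_carrier T.sum_of_carrier
        in \<open>auto simp: l_distr intro!: T.sum_of_add\<close>)
  have one: "\<one> \<in> ?H" using T(2) one_component by (rule T.component_sum_of)
  interpret H: ring "V\<lparr>carrier := ?H\<rparr>"
  proof (rule ringI)
    show "abelian_group (V\<lparr>carrier := ?H\<rparr>)"
      using abelian_group_axioms T.sum_of_subgroup by (rule abelian_group_carrier_update)
    show "Group.monoid (V\<lparr>carrier := ?H\<rparr>)"
      by (rule monoidI) (simp_all add: m one m_assoc T.sum_of_carrier)
  qed (simp_all add: l_distr r_distr T.sum_of_carrier)
  have sub: "additive_subgroup (C g) (V\<lparr>carrier := ?H\<rparr>)" if "g \<in> T" for g
  proof (rule additive_subgroupI, rule subgroup.intro)
    show "C g \<subseteq> carrier (add_monoid (V\<lparr>carrier := ?H\<rparr>))"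
      using that T.component_sum_of by auto
  next
    fix x assume x: "x \<in> C g"
    note x' = T.component_uminus[OF that x] T.component_carrier[OF that x]
      T.component_sum_of[OF that x]
    have "a_inv (V\<lparr>carrier := ?H\<rparr>) x = \<ominus> x"
      using l_neg[OF x'(2)] x'(3) T.component_sum_of[OF that x'(1)]
      by (intro H.minus_equality) simp_all
    then show "inv\<^bsub>add_monoid (V\<lparr>carrier := ?H\<rparr>)\<^esub> x \<in> C g"
      using x'(1) by (simp add: a_inv_def)
  qed (use T.component_add[OF that] T.component_zero[OF that] in simp_all)
  have sum: "finsum (V\<lparr>carrier := ?H\<rparr>) x F = finsum V x F" if "F \<subseteq> T" "x \<in> Pi F C" for x F
  proof (rule finsum_carrier_update[OF abelian_group_axioms T.sum_of_subgroup])
    show "x \<in> F \<rightarrow> ?H" using that T.component_sum_of by blast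
  qed
  have "is_direct_sum_of (V\<lparr>carrier := ?H\<rparr>) T C"
    unfolding is_direct_sum_of_def
  proof (intro conjI)
    show "carrier (V\<lparr>carrier := ?H\<rparr>) = sum_of (V\<lparr>carrier := ?H\<rparr>) T C"
      using T.sum_of_carrier_update[OF T.sum_of_subgroup] T.component_sum_of by (simp add: subset_iff)
    show "\<forall>F x. finite F \<longrightarrow> F \<subseteq> T \<longrightarrow> x \<in> Pi F C \<longrightarrow>
      finsum (V\<lparr>carrier := ?H\<rparr>) x F = \<zero>\<^bsub>V\<lparr>carrier := ?H\<rparr>\<^esub> \<longrightarrow> (\<forall>i\<in>F. x i = \<zero>\<^bsub>V\<lparr>carrier := ?H\<rparr>\<^esub>)"
    proof (intro allI impI)
      fix F x assume F: "finite F" "F \<subseteq> T" "x \<in> Pi F C"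
        and "finsum (V\<lparr>carrier := ?H\<rparr>) x F = \<zero>\<^bsub>V\<lparr>carrier := ?H\<rparr>\<^esub>"
      then have "finsum V x F = \<zero>" by (simp add: sum)
      then show "\<forall>i\<in>F. x i = \<zero>\<^bsub>V\<lparr>carrier := ?H\<rparr>\<^esub>"
        using direct F order_trans[OF F(2) T(1)] by (simp add: is_direct_sum_of_def)
    qed
  qed
  moreover have "subgroup_family (V\<lparr>carrier := ?H\<rparr>) T C"
    using H.abelian_group_axioms sub by (rule subgroup_familyI)
  moreover have "x \<otimes> y \<in> C (g + h)" if "g \<in> T" "h \<in> T" "x \<in> C g" "y \<in> C h" for g h x y
    using that T(1) by (intro mult_component) auto
  ultimately show ?thesis
    using T one_component
    by (intro graded_ring.intro graded_ring_axioms.intro H.ring_axioms) auto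
qed

end

lemma quot_alg_simps:
  "carrier (quot_alg A I) = carrier (A Quot I)"
  "mult (quot_alg A I) = mult (A Quot I)" "one (quot_alg A I) = one (A Quot I)"
  "add (quot_alg A I) = add (A Quot I)" "zero (quot_alg A I) = zero (A Quot I)"
  by (simp_all add: quot_alg_def ring.defs)

lemma ring_quot_alg:
  assumes "ideal I A"
  shows "ring (quot_alg A I)"
proof -
  interpret Q: ring "A Quot I" using assms by (rule ideal.quotient_is_ring)
  have "\<exists>y\<in>carrier (A Quot I). y \<oplus>\<^bsub>A Quot I\<^esub> x = \<zero>\<^bsub>A Quot I\<^esub>"
    if "x \<in> carrier (A Quot I)" for x
    using Q.l_neg[OF that] Q.a_inv_closed[OF that] by (rule bexI)
  then have "abelian_group (quot_alg A I)"
    by (intro abelian_groupI) (simp_all add: quot_alg_simps Q.a_assoc, rule Q.a_comm)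
  moreover have "Group.monoid (quot_alg A I)"
    by (rule monoidI) (simp_all add: quot_alg_simps Q.m_assoc)
  ultimately show ?thesis
    by (rule ringI) (simp_all add: quot_alg_simps Q.l_distr Q.r_distr)
qed

lemma cring_quot_alg:
  assumes "ideal I A" "cring A"
  shows "cring (quot_alg A I)"
proof -
  interpret Q: cring "A Quot I" using assms by (rule ideal.quotient_is_cring)
  show ?thesis
    using ring_quot_alg[OF assms(1)]
    by (auto simp: cring_def comm_monoid_def comm_monoid_axioms_def quot_alg_simps Q.m_comm ring_def)
qed

context ideal
begin

lemma coset_hom:
  "x \<in> carrier R \<Longrightarrow> I +> x \<in> carrier (R Quot I)"
  "x \<in> carrier R \<Longrightarrow> y \<in> carrier R \<Longrightarrow> (I +> x) \<oplus>\<^bsub>R Quot I\<^esub> (I +> y) = I +> (x \<oplus> y)"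
  "x \<in> carrier R \<Longrightarrow> y \<in> carrier R \<Longrightarrow> (I +> x) \<otimes>\<^bsub>R Quot I\<^esub> (I +> y) = I +> (x \<otimes> y)"
  "\<one>\<^bsub>R Quot I\<^esub> = I +> \<one>"
  "\<zero>\<^bsub>R Quot I\<^esub> = I +> \<zero>"
proof -
  show "\<zero>\<^bsub>R Quot I\<^esub> = I +> \<zero>"
    using a_rcos_const[OF additive_subgroup.zero_closed[OF additive_subgroup_axioms]]
    by (simp add: FactRing_def)
qed (use ring_hom_memE[OF rcos_ring_hom] in simp_all)

lemma coset_zero_iff: "x \<in> carrier R \<Longrightarrow> I +> x = \<zero>\<^bsub>R Quot I\<^esub> \<longleftrightarrow> x \<in> I"
  using a_rcos_const[of x] a_rcos_self[of x] by (auto simp: FactRing_def)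

lemma coset_cases:
  assumes "Z \<in> carrier (R Quot I)"
  obtains x where "x \<in> carrier R" "Z = I +> x"
  using assms by (auto simp: FactRing_simps)

end

text \<open>
  In every algebra below, a scalar \<open>c\<close> acts as left multiplication by an element \<open>d\<close>; this passes
  to the quotient.
\<close>

lemma quot_alg_smult:
  assumes I: "ideal I V" and d: "d \<in> carrier V"
    and c: "\<And>y. y \<in> carrier V \<Longrightarrow> c \<odot>\<^bsub>V\<^esub> y = d \<otimes>\<^bsub>V\<^esub> y" and x: "x \<in> carrier V"
  shows "c \<odot>\<^bsub>quot_alg V I\<^esub> (I +>\<^bsub>V\<^esub> x) = I +>\<^bsub>V\<^esub> (d \<otimes>\<^bsub>V\<^esub> x)"
proof -
  interpret I: ideal I V by (fact I)
  have "I +>\<^bsub>V\<^esub> (c \<odot>\<^bsub>V\<^esub> y) = I +>\<^bsub>V\<^esub> (d \<otimes>\<^bsub>V\<^esub> x)" if y: "y \<in> I +>\<^bsub>V\<^esub> x" for y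
  proof -
    have yV: "y \<in> carrier V" using I.a_elemrcos_carrier[OF x y] .
    have "I +>\<^bsub>V\<^esub> x = I +>\<^bsub>V\<^esub> y" using y x by (rule I.a_repr_independence')
    then show ?thesis
      using I.coset_hom(3)[OF d x] I.coset_hom(3)[OF d yV] c[OF yV] by simp
  qed
  moreover have "x \<in> I +>\<^bsub>V\<^esub> x" using x by (rule I.a_rcos_self)
  ultimately have "(\<Union>y\<in>I +>\<^bsub>V\<^esub> x. I +>\<^bsub>V\<^esub> (c \<odot>\<^bsub>V\<^esub> y)) = I +>\<^bsub>V\<^esub> (d \<otimes>\<^bsub>V\<^esub> x)" by blast
  then show ?thesis by (simp add: quot_alg_def ring.defs module.defs)
qed

lemma (in graded_ring) homogeneous_in_sum_of:
  assumes N: "\<And>g. g \<in> S \<Longrightarrow> additive_subgroup (N g) V" "\<And>g. g \<in> S \<Longrightarrow> N g \<subseteq> C g"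
    and F: "finite F" "F \<subseteq> S" "x \<in> Pi F C" "finsum V x F \<in> sum_of V S N" and i: "i \<in> F"
  shows "x i \<in> N i"
proof -
  interpret N: subgroup_family V S N using abelian_group_axioms N(1) by (rule subgroup_familyI)
  obtain F' z where F': "finite F'" "F' \<subseteq> S" "z \<in> Pi F' N" "finsum V x F = finsum V z F'"
    using F(4) by (auto simp: sum_of_def)
  have z: "z \<in> Pi F' C" using F'(2,3) N(2) by blast
  have "x i = (if i \<in> F' then z i else \<zero>)"
    using direct F(1-3) F'(1,2) z F'(4) i by (rule direct_sum_unique)
  moreover have "\<zero> \<in> N i" using i F(2) by (intro N.component_zero) auto
  moreover have "z i \<in> N i" if "i \<in> F'" using that F'(3) by auto
  ultimately show ?thesis by simp
qed

lemma (in graded_ring) graded_quotient: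
  assumes N: "\<And>g. g \<in> S \<Longrightarrow> additive_subgroup (N g) V" "\<And>g. g \<in> S \<Longrightarrow> N g \<subseteq> C g"
    and I: "ideal (sum_of V S N) V"
  shows "graded_ring (quot_alg V (sum_of V S N)) S (\<lambda>g. (+>) (sum_of V S N) ` C g)"
proof -
  let ?I = "sum_of V S N" and ?W = "quot_alg V (sum_of V S N)"
  interpret I: ideal ?I V by (fact I)
  interpret N: subgroup_family V S N using abelian_group_axioms N(1) by (rule subgroup_familyI)
  interpret W: ring ?W using I by (rule ring_quot_alg)
  note hom = I.coset_hom[folded quot_alg_simps]
  have sub: "additive_subgroup ((+>) ?I ` C g) ?W" if g: "g \<in> S" for g
  proof (rule additive_subgroupI, rule subgroup.intro)
    show "(+>) ?I ` C g \<subseteq> carrier (add_monoid ?W)"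
      using component_carrier[OF g] hom(1) by auto
    show "\<one>\<^bsub>add_monoid ?W\<^esub> \<in> (+>) ?I ` C g"
      using component_zero[OF g] hom(5) by auto
  next
    fix Y Z assume "Y \<in> (+>) ?I ` C g" "Z \<in> (+>) ?I ` C g"
    then obtain y z where "Y = ?I +> y" "Z = ?I +> z" "y \<in> C g" "z \<in> C g" by blast
    then show "Y \<otimes>\<^bsub>add_monoid ?W\<^esub> Z \<in> (+>) ?I ` C g"
      using component_carrier[OF g] component_add[OF g] hom(2)[of y z] by simp
  next
    fix Y assume "Y \<in> (+>) ?I ` C g"
    then obtain y where y: "Y = ?I +> y" "y \<in> C g" by blast
    note y' = component_carrier[OF g y(2)]
    have "\<ominus>\<^bsub>?W\<^esub> Y = ?I +> (\<ominus> y)"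
      using hom(2)[OF a_inv_closed[OF y'] y'] y' hom(1) hom(5) unfolding y(1)
      by (intro W.minus_equality) (simp_all add: l_neg)
    then show "inv\<^bsub>add_monoid ?W\<^esub> Y \<in> (+>) ?I ` C g"
      using component_uminus[OF g y(2)] by (simp add: a_inv_def)
  qed
  interpret W: subgroup_family ?W S "\<lambda>g. (+>) ?I ` C g"
    using W.abelian_group_axioms sub by (rule subgroup_familyI)
  have sum: "?I +> finsum V x F = finsum ?W (\<lambda>i. ?I +> x i) F"
    if "finite F" "F \<subseteq> S" "x \<in> Pi F C" for x F
    by (rule finsum_hom[OF abelian_group_axioms W.abelian_group_axioms hom(1) hom(2)[symmetric]
      hom(5)[symmetric] that(1) family_carrier[OF that(2,3)]])
  have "is_direct_sum_of ?W S (\<lambda>g. (+>) ?I ` C g)"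
    unfolding is_direct_sum_of_def
  proof (intro conjI allI impI equalityI subsetI)
    fix Z assume "Z \<in> carrier ?W"
    then obtain z where z: "z \<in> carrier V" "Z = ?I +> z"
      using I.coset_cases by (auto simp: quot_alg_simps)
    obtain F x where F: "finite F" "F \<subseteq> S" "x \<in> Pi F C" "z = finsum V x F"
      using z(1) by (auto simp: carrier_sum_of sum_of_def)
    have "Z = finsum ?W (\<lambda>i. ?I +> x i) F" using z F sum by simp
    moreover have "(\<lambda>i. ?I +> x i) \<in> Pi F (\<lambda>g. (+>) ?I ` C g)" using F(3) by auto
    ultimately show "Z \<in> sum_of ?W S (\<lambda>g. (+>) ?I ` C g)"
      using F(1,2) unfolding sum_of_def by blast
  next
    fix Z assume "Z \<in> sum_of ?W S (\<lambda>g. (+>) ?I ` C g)"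
    then show "Z \<in> carrier ?W" by (rule W.sum_of_carrier)
  next
    fix F y
    assume F: "finite F" "F \<subseteq> S" and y: "y \<in> Pi F (\<lambda>g. (+>) ?I ` C g)"
      and zero: "finsum ?W y F = \<zero>\<^bsub>?W\<^esub>"
    have "\<forall>g\<in>F. \<exists>x. x \<in> C g \<and> y g = ?I +> x" using y by auto
    then obtain x where x: "\<And>g. g \<in> F \<Longrightarrow> x g \<in> C g" "\<And>g. g \<in> F \<Longrightarrow> y g = ?I +> x g"
      by metis
    have xF: "x \<in> Pi F C" using x(1) by auto
    have "finsum ?W (\<lambda>i. ?I +> x i) F = finsum ?W y F"
      using W.family_carrier[OF F(2) y] x(2) by (intro W.finsum_cong') auto
    then have "?I +> finsum V x F = \<zero>\<^bsub>?W\<^esub>" using sum[OF F xF] zero by simp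
    then have "finsum V x F \<in> ?I"
      using I.coset_zero_iff finsum_closed[OF family_carrier[OF F(2) xF]]
      by (simp add: quot_alg_simps)
    then have "x g \<in> N g" if "g \<in> F" for g
      using N F xF that by (intro homogeneous_in_sum_of[of N F x g])
    then have "x g \<in> ?I" if "g \<in> F" for g
      using that F(2) N.component_sum_of by blast
    then have "y g = \<zero>\<^bsub>?W\<^esub>" if "g \<in> F" for g
      using x[OF that] that F(2) I.coset_zero_iff component_carrier[of g "x g"]
      by (simp add: quot_alg_simps subset_iff)
    then show "\<forall>g\<in>F. y g = \<zero>\<^bsub>?W\<^esub>" by blast
  qed
  moreover have "Y \<otimes>\<^bsub>?W\<^esub> Z \<in> (+>) ?I ` C (g + h)"
    if "g \<in> S" "h \<in> S" "Y \<in> (+>) ?I ` C g" "Z \<in> (+>) ?I ` C h" for g h Y Z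
  proof -
    from that obtain y z where yz: "Y = ?I +> y" "Z = ?I +> z" "y \<in> C g" "z \<in> C h" by blast
    then show ?thesis
      using hom(3)[of y z] mult_component[OF that(1,2) yz(3,4)] component_carrier that(1,2) by simp
  qed
  ultimately show ?thesis
    using zero_degree add_degree one_component hom(4)
    by (intro graded_ring.intro graded_ring_axioms.intro W.ring_axioms W.subgroup_family_axioms)
      auto
qed

context left_module
begin

lemma zero_smult: "x \<in> carrier M \<Longrightarrow> \<zero> \<odot>\<^bsub>M\<^esub> x = \<zero>\<^bsub>M\<^esub>"
  using smult_l_distr[of \<zero> \<zero> x] smult_closed[of \<zero> x] M.add.l_cancel_one[of "\<zero> \<odot>\<^bsub>M\<^esub> x" "\<zero> \<odot>\<^bsub>M\<^esub> x"]
  by (metis l_zero zero_closed)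

lemma smult_zero: "a \<in> carrier A \<Longrightarrow> a \<odot>\<^bsub>M\<^esub> \<zero>\<^bsub>M\<^esub> = \<zero>\<^bsub>M\<^esub>"
  using smult_r_distr[of a "\<zero>\<^bsub>M\<^esub>" "\<zero>\<^bsub>M\<^esub>"] smult_closed[of a "\<zero>\<^bsub>M\<^esub>"]
    M.add.l_cancel_one[of "a \<odot>\<^bsub>M\<^esub> \<zero>\<^bsub>M\<^esub>" "a \<odot>\<^bsub>M\<^esub> \<zero>\<^bsub>M\<^esub>"]
  by (metis M.l_zero M.zero_closed)

end

section \<open>The free algebra\<close>

text \<open>The degree of a word, as a sum over its letters.\<close>

definition wdeg :: "'n::finite gen list \<Rightarrow> (int, 'n) vec" where
  "wdeg a = (\<Sum>z\<leftarrow>a. case z of X i \<Rightarrow> axis i 1 | Y i \<Rightarrow> - axis i 1)"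

lemma letter_deg_Gen: "letter_deg (Gen z) = wdeg [z]"
  by (cases z) (simp_all add: wdeg_def)

lemma deg_map_Gen: "deg (map Gen a) = wdeg a"
  unfolding deg_def wdeg_def map_map
  by (rule arg_cong[of _ _ sum_list]) (auto split: gen.split)

lemma wdeg_simps:
  "wdeg [] = 0" "wdeg [X i] = axis i 1" "wdeg [Y i] = - axis i 1"
  "wdeg (a @ b) = wdeg a + wdeg b"
  by (simp_all add: wdeg_def)

lemma wdeg_Cons: "wdeg (z # a) = wdeg [z] + wdeg a"
  by (simp add: wdeg_def)

text \<open>A twisted generalized Weyl construction, given by its data.\<close>

locale tgw_algebra =
  fixes D :: "('k, 'r, 'n::{finite, linorder}) tgw_data"
  assumes data: "is_tgw_data D"
begin

abbreviation "K \<equiv> tgw_K D"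
abbreviation "R \<equiv> tgw_R D"
abbreviation "F \<equiv> free_alg D"
abbreviation "A \<equiv> tgwc D"
abbreviation "\<sigma> \<equiv> tgw_sigma D"

lemma algebra_R: "algebra K R"
  using data by (simp add: is_tgw_data_def)

sublocale K: field K
  using data by (simp add: is_tgw_data_def)

sublocale R: cring R
  using algebra_R by (rule algebra.axioms)

text \<open>The symbols that may occur in an element of the free algebra.\<close>

definition symbols :: "('r, 'n) letter set" where
  "symbols = Coef ` carrier R \<union> range Gen"

lemma free_alg_simps:
  "carrier F = {p. (\<forall>w. p w \<in> carrier K) \<and> finite {w. p w \<noteq> \<zero>\<^bsub>K\<^esub>} \<and>
     (\<forall>w. p w \<noteq> \<zero>\<^bsub>K\<^esub> \<longrightarrow> w \<in> lists symbols)}"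
  "\<one>\<^bsub>F\<^esub> = monomial D []"
  "\<zero>\<^bsub>F\<^esub> = (\<lambda>w. \<zero>\<^bsub>K\<^esub>)"
  "p \<oplus>\<^bsub>F\<^esub> q = (\<lambda>w. p w \<oplus>\<^bsub>K\<^esub> q w)"
  "c \<odot>\<^bsub>F\<^esub> p = (\<lambda>w. c \<otimes>\<^bsub>K\<^esub> p w)"
  by (simp_all add: free_alg_def Let_def monomial_def symbols_def)

lemma conv_eq: "(p \<otimes>\<^bsub>F\<^esub> q) w = (\<Oplus>\<^bsub>K\<^esub>i\<in>{..length w}. p (take i w) \<otimes>\<^bsub>K\<^esub> q (drop i w))"
  by (simp add: free_alg_def Let_def)

lemma conv_closed:
  assumes "\<And>w. p w \<in> carrier K" "\<And>w. q w \<in> carrier K"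
  shows "(p \<otimes>\<^bsub>F\<^esub> q) w \<in> carrier K"
  unfolding conv_eq using assms by (intro K.finsum_closed) auto

lemma conv_Nil:
  assumes "\<And>w. p w \<in> carrier K" "\<And>w. q w \<in> carrier K"
  shows "(p \<otimes>\<^bsub>F\<^esub> q) [] = p [] \<otimes>\<^bsub>K\<^esub> q []"
  using assms by (simp add: conv_eq)

text \<open>The laws of the convolution product follow from this recursion by induction on the word.\<close>

lemma conv_Cons:
  assumes "\<And>w. p w \<in> carrier K" "\<And>w. q w \<in> carrier K"
  shows "(p \<otimes>\<^bsub>F\<^esub> q) (x # w) = p [] \<otimes>\<^bsub>K\<^esub> q (x # w) \<oplus>\<^bsub>K\<^esub> ((\<lambda>u. p (x # u)) \<otimes>\<^bsub>F\<^esub> q) w"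
proof -
  let ?f = "\<lambda>i. p (take i (x # w)) \<otimes>\<^bsub>K\<^esub> q (drop i (x # w))"
  have "(p \<otimes>\<^bsub>F\<^esub> q) (x # w) = finsum K ?f {..Suc (length w)}"
    by (simp add: conv_eq)
  also have "\<dots> = finsum K (\<lambda>i. ?f (Suc i)) {..length w} \<oplus>\<^bsub>K\<^esub> ?f 0"
    using assms by (intro K.finsum_Suc2) auto
  also have "\<dots> = ((\<lambda>u. p (x # u)) \<otimes>\<^bsub>F\<^esub> q) w \<oplus>\<^bsub>K\<^esub> p [] \<otimes>\<^bsub>K\<^esub> q (x # w)"
    by (simp add: conv_eq)
  finally show ?thesis
    using assms conv_closed[of "\<lambda>u. p (x # u)" q w] by (simp add: K.a_comm)
qed

lemmas conv_simps = conv_Nil conv_Cons conv_closed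

lemma conv_zero_l:
  assumes "\<And>w. q w \<in> carrier K"
  shows "((\<lambda>w. \<zero>\<^bsub>K\<^esub>) \<otimes>\<^bsub>F\<^esub> q) w = \<zero>\<^bsub>K\<^esub>"
  using assms by (induction w) (simp_all add: conv_simps)

lemma conv_add_l:
  assumes "\<And>w. p w \<in> carrier K" "\<And>w. p' w \<in> carrier K" "\<And>w. q w \<in> carrier K"
  shows "((\<lambda>w. p w \<oplus>\<^bsub>K\<^esub> p' w) \<otimes>\<^bsub>F\<^esub> q) w = (p \<otimes>\<^bsub>F\<^esub> q) w \<oplus>\<^bsub>K\<^esub> (p' \<otimes>\<^bsub>F\<^esub> q) w"
  using assms
proof (induction w arbitrary: p p')
  case Nil
  then show ?case by (simp add: conv_simps K.l_distr)
next
  case (Cons x w)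
  have IH: "((\<lambda>u. p (x # u) \<oplus>\<^bsub>K\<^esub> p' (x # u)) \<otimes>\<^bsub>F\<^esub> q) w =
    ((\<lambda>u. p (x # u)) \<otimes>\<^bsub>F\<^esub> q) w \<oplus>\<^bsub>K\<^esub> ((\<lambda>u. p' (x # u)) \<otimes>\<^bsub>F\<^esub> q) w"
    using Cons.prems by (intro Cons.IH) auto
  have c: "((\<lambda>u. p (x # u)) \<otimes>\<^bsub>F\<^esub> q) w \<in> carrier K" "((\<lambda>u. p' (x # u)) \<otimes>\<^bsub>F\<^esub> q) w \<in> carrier K"
    using Cons.prems by (auto intro!: conv_closed)
  have "((\<lambda>w. p w \<oplus>\<^bsub>K\<^esub> p' w) \<otimes>\<^bsub>F\<^esub> q) (x # w) =
    (p [] \<oplus>\<^bsub>K\<^esub> p' []) \<otimes>\<^bsub>K\<^esub> q (x # w) \<oplus>\<^bsub>K\<^esub> ((\<lambda>u. p (x # u) \<oplus>\<^bsub>K\<^esub> p' (x # u)) \<otimes>\<^bsub>F\<^esub> q) w"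
    using Cons.prems by (subst conv_Cons) auto
  also have "\<dots> = (p [] \<otimes>\<^bsub>K\<^esub> q (x # w) \<oplus>\<^bsub>K\<^esub> ((\<lambda>u. p (x # u)) \<otimes>\<^bsub>F\<^esub> q) w) \<oplus>\<^bsub>K\<^esub>
      (p' [] \<otimes>\<^bsub>K\<^esub> q (x # w) \<oplus>\<^bsub>K\<^esub> ((\<lambda>u. p' (x # u)) \<otimes>\<^bsub>F\<^esub> q) w)"
    using Cons.prems c unfolding IH by (simp add: K.l_distr K.a_ac)
  also have "\<dots> = (p \<otimes>\<^bsub>F\<^esub> q) (x # w) \<oplus>\<^bsub>K\<^esub> (p' \<otimes>\<^bsub>F\<^esub> q) (x # w)"
    using Cons.prems by (simp add: conv_Cons)
  finally show ?case .
qed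

lemma conv_smult_l:
  assumes "\<And>w. p w \<in> carrier K" "\<And>w. q w \<in> carrier K" "c \<in> carrier K"
  shows "((\<lambda>w. c \<otimes>\<^bsub>K\<^esub> p w) \<otimes>\<^bsub>F\<^esub> q) w = c \<otimes>\<^bsub>K\<^esub> (p \<otimes>\<^bsub>F\<^esub> q) w"
  using assms
proof (induction w arbitrary: p)
  case Nil
  then show ?case by (simp add: conv_simps K.m_assoc)
next
  case (Cons x w)
  have IH: "((\<lambda>u. c \<otimes>\<^bsub>K\<^esub> p (x # u)) \<otimes>\<^bsub>F\<^esub> q) w = c \<otimes>\<^bsub>K\<^esub> ((\<lambda>u. p (x # u)) \<otimes>\<^bsub>F\<^esub> q) w"
    using Cons.prems by (intro Cons.IH) auto
  have c: "((\<lambda>u. p (x # u)) \<otimes>\<^bsub>F\<^esub> q) w \<in> carrier K"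
    using Cons.prems by (auto intro!: conv_closed)
  show ?case
    using Cons.prems c by (subst (1 2) conv_Cons) (auto simp: IH K.r_distr K.m_assoc)
qed

lemma conv_add_r:
  assumes "\<And>w. p w \<in> carrier K" "\<And>w. q w \<in> carrier K" "\<And>w. q' w \<in> carrier K"
  shows "(p \<otimes>\<^bsub>F\<^esub> (\<lambda>w. q w \<oplus>\<^bsub>K\<^esub> q' w)) w = (p \<otimes>\<^bsub>F\<^esub> q) w \<oplus>\<^bsub>K\<^esub> (p \<otimes>\<^bsub>F\<^esub> q') w"
proof -
  have "(p \<otimes>\<^bsub>F\<^esub> (\<lambda>w. q w \<oplus>\<^bsub>K\<^esub> q' w)) w =
    (\<Oplus>\<^bsub>K\<^esub>i\<in>{..length w}. p (take i w) \<otimes>\<^bsub>K\<^esub> q (drop i w) \<oplus>\<^bsub>K\<^esub> p (take i w) \<otimes>\<^bsub>K\<^esub> q' (drop i w))"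
    unfolding conv_eq using assms by (intro K.finsum_cong') (auto simp: K.r_distr)
  also have "\<dots> = (p \<otimes>\<^bsub>F\<^esub> q) w \<oplus>\<^bsub>K\<^esub> (p \<otimes>\<^bsub>F\<^esub> q') w"
    unfolding conv_eq using assms by (intro K.finsum_addf) auto
  finally show ?thesis .
qed

lemma conv_assoc:
  assumes "\<And>w. p w \<in> carrier K" "\<And>w. q w \<in> carrier K" "\<And>w. r w \<in> carrier K"
  shows "((p \<otimes>\<^bsub>F\<^esub> q) \<otimes>\<^bsub>F\<^esub> r) w = (p \<otimes>\<^bsub>F\<^esub> (q \<otimes>\<^bsub>F\<^esub> r)) w"
  using assms
proof (induction w arbitrary: p)
  case Nil
  then show ?case by (simp add: conv_simps K.m_assoc)
next
  case (Cons x w)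
  let ?p = "\<lambda>u. p (x # u)" and ?q = "\<lambda>u. q (x # u)"
  have IH: "((?p \<otimes>\<^bsub>F\<^esub> q) \<otimes>\<^bsub>F\<^esub> r) w = (?p \<otimes>\<^bsub>F\<^esub> (q \<otimes>\<^bsub>F\<^esub> r)) w"
    using Cons.prems by (intro Cons.IH) auto
  have c: "(?p \<otimes>\<^bsub>F\<^esub> q) u \<in> carrier K" "(?q \<otimes>\<^bsub>F\<^esub> r) u \<in> carrier K"
    "(p \<otimes>\<^bsub>F\<^esub> q) u \<in> carrier K" "(q \<otimes>\<^bsub>F\<^esub> r) u \<in> carrier K"
    "(?p \<otimes>\<^bsub>F\<^esub> (q \<otimes>\<^bsub>F\<^esub> r)) u \<in> carrier K" for u
    using Cons.prems by (auto intro!: conv_closed)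
  have "(\<lambda>u. (p \<otimes>\<^bsub>F\<^esub> q) (x # u)) = (\<lambda>u. p [] \<otimes>\<^bsub>K\<^esub> ?q u \<oplus>\<^bsub>K\<^esub> (?p \<otimes>\<^bsub>F\<^esub> q) u)"
    using Cons.prems by (simp add: conv_Cons)
  then have "((\<lambda>u. (p \<otimes>\<^bsub>F\<^esub> q) (x # u)) \<otimes>\<^bsub>F\<^esub> r) w =
    ((\<lambda>u. p [] \<otimes>\<^bsub>K\<^esub> ?q u) \<otimes>\<^bsub>F\<^esub> r) w \<oplus>\<^bsub>K\<^esub> ((?p \<otimes>\<^bsub>F\<^esub> q) \<otimes>\<^bsub>F\<^esub> r) w"
    using Cons.prems c by (simp add: conv_add_l)
  also have "\<dots> = p [] \<otimes>\<^bsub>K\<^esub> (?q \<otimes>\<^bsub>F\<^esub> r) w \<oplus>\<^bsub>K\<^esub> (?p \<otimes>\<^bsub>F\<^esub> (q \<otimes>\<^bsub>F\<^esub> r)) w"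
    using Cons.prems by (simp add: IH conv_smult_l)
  finally have tail: "((\<lambda>u. (p \<otimes>\<^bsub>F\<^esub> q) (x # u)) \<otimes>\<^bsub>F\<^esub> r) w =
    p [] \<otimes>\<^bsub>K\<^esub> (?q \<otimes>\<^bsub>F\<^esub> r) w \<oplus>\<^bsub>K\<^esub> (?p \<otimes>\<^bsub>F\<^esub> (q \<otimes>\<^bsub>F\<^esub> r)) w" .
  have "((p \<otimes>\<^bsub>F\<^esub> q) \<otimes>\<^bsub>F\<^esub> r) (x # w) =
    (p [] \<otimes>\<^bsub>K\<^esub> q []) \<otimes>\<^bsub>K\<^esub> r (x # w) \<oplus>\<^bsub>K\<^esub> ((\<lambda>u. (p \<otimes>\<^bsub>F\<^esub> q) (x # u)) \<otimes>\<^bsub>F\<^esub> r) w"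
    using Cons.prems c by (simp add: conv_Cons[of "p \<otimes>\<^bsub>F\<^esub> q"] conv_Nil)
  also have "\<dots> = p [] \<otimes>\<^bsub>K\<^esub> (q [] \<otimes>\<^bsub>K\<^esub> r (x # w) \<oplus>\<^bsub>K\<^esub> (?q \<otimes>\<^bsub>F\<^esub> r) w) \<oplus>\<^bsub>K\<^esub> (?p \<otimes>\<^bsub>F\<^esub> (q \<otimes>\<^bsub>F\<^esub> r)) w"
    using Cons.prems c by (simp add: tail K.r_distr K.m_assoc K.a_assoc)
  also have "\<dots> = (p \<otimes>\<^bsub>F\<^esub> (q \<otimes>\<^bsub>F\<^esub> r)) (x # w)"
    using Cons.prems c by (simp add: conv_Cons[of p "q \<otimes>\<^bsub>F\<^esub> r"] conv_Cons[of q r])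
  finally show ?case .
qed

lemma monomial_closed_K: "monomial D u w \<in> carrier K"
  by (simp add: monomial_def)

lemma monomial_Cons: "(\<lambda>v. monomial D (x # u) (y # v)) = (if x = y then monomial D u else (\<lambda>v. \<zero>\<^bsub>K\<^esub>))"
  by (auto simp: monomial_def)

lemma conv_one_l:
  assumes "\<And>w. q w \<in> carrier K"
  shows "(monomial D [] \<otimes>\<^bsub>F\<^esub> q) w = q w"
proof (cases w)
  case Nil
  then show ?thesis using assms by (simp add: conv_Nil monomial_closed_K) (simp add: monomial_def)
next
  case (Cons x u)
  have "(\<lambda>v. monomial D [] (x # v)) = (\<lambda>v. \<zero>\<^bsub>K\<^esub>)" by (simp add: monomial_def)
  then show ?thesis
    using Cons assms by (simp add: conv_Cons monomial_closed_K conv_zero_l) (simp add: monomial_def)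
qed

lemma conv_one_r:
  assumes "\<And>w. p w \<in> carrier K"
  shows "(p \<otimes>\<^bsub>F\<^esub> monomial D []) w = p w"
  using assms
proof (induction w arbitrary: p)
  case Nil
  then show ?case by (simp add: conv_Nil monomial_closed_K) (simp add: monomial_def)
next
  case (Cons x w)
  have IH: "((\<lambda>u. p (x # u)) \<otimes>\<^bsub>F\<^esub> monomial D []) w = p (x # w)"
    using Cons.prems by (intro Cons.IH)
  show ?case
    using Cons.prems by (simp add: conv_Cons monomial_closed_K IH) (simp add: monomial_def)
qed

lemma monomial_mult: "monomial D u \<otimes>\<^bsub>F\<^esub> monomial D v = monomial D (u @ v)"
proof (rule ext)
  show "(monomial D u \<otimes>\<^bsub>F\<^esub> monomial D v) w = monomial D (u @ v) w" for w
  proof (induction u arbitrary: w)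
    case Nil
    show ?case by (simp add: conv_one_l monomial_closed_K)
  next
    case (Cons x u)
    show ?case
    proof (cases w)
      case Nil
      then show ?thesis by (simp add: conv_Nil monomial_closed_K) (simp add: monomial_def)
    next
      case w: (Cons y w')
      show ?thesis
      proof (cases "x = y")
        case True
        then show ?thesis
          by (simp add: w conv_Cons monomial_closed_K monomial_Cons Cons.IH) (simp add: monomial_def)
      next
        case False
        then show ?thesis
          by (simp add: w conv_Cons monomial_closed_K monomial_Cons conv_zero_l) (simp add: monomial_def)
      qed
    qed
  qed
qed

lemma conv_nonzero:
  assumes "\<And>w. p w \<in> carrier K" "\<And>w. q w \<in> carrier K" "(p \<otimes>\<^bsub>F\<^esub> q) w \<noteq> \<zero>\<^bsub>K\<^esub>"
  obtains u v where "w = u @ v" "p u \<noteq> \<zero>\<^bsub>K\<^esub>" "q v \<noteq> \<zero>\<^bsub>K\<^esub>"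
proof -
  have "\<exists>i. p (take i w) \<otimes>\<^bsub>K\<^esub> q (drop i w) \<noteq> \<zero>\<^bsub>K\<^esub>"
  proof (rule ccontr)
    assume "\<not> ?thesis"
    then have "(p \<otimes>\<^bsub>F\<^esub> q) w = \<zero>\<^bsub>K\<^esub>" by (simp add: conv_eq)
    then show False using assms(3) by simp
  qed
  then obtain i where "p (take i w) \<otimes>\<^bsub>K\<^esub> q (drop i w) \<noteq> \<zero>\<^bsub>K\<^esub>" by blast
  then have "p (take i w) \<noteq> \<zero>\<^bsub>K\<^esub>" "q (drop i w) \<noteq> \<zero>\<^bsub>K\<^esub>" using assms by auto
  then show thesis using that[of "take i w" "drop i w"] by simp
qed

lemma free_algD:
  assumes "p \<in> carrier F"
  shows "p w \<in> carrier K" "finite {w. p w \<noteq> \<zero>\<^bsub>K\<^esub>}" "p w \<noteq> \<zero>\<^bsub>K\<^esub> \<Longrightarrow> w \<in> lists symbols"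
  using assms by (auto simp: free_alg_simps)

lemma free_algI:
  assumes "\<And>w. p w \<in> carrier K" "finite W" "\<And>w. p w \<noteq> \<zero>\<^bsub>K\<^esub> \<Longrightarrow> w \<in> W"
    and "\<And>w. p w \<noteq> \<zero>\<^bsub>K\<^esub> \<Longrightarrow> w \<in> lists symbols"
  shows "p \<in> carrier F"
proof -
  have "finite {w. p w \<noteq> \<zero>\<^bsub>K\<^esub>}" by (rule finite_subset[OF _ assms(2)]) (use assms(3) in auto)
  then show ?thesis using assms(1,4) by (simp add: free_alg_simps)
qed

lemma free_alg_add:
  assumes p: "p \<in> carrier F" and q: "q \<in> carrier F"
  shows "p \<oplus>\<^bsub>F\<^esub> q \<in> carrier F"
proof (rule free_algI)
  let ?W = "{w. p w \<noteq> \<zero>\<^bsub>K\<^esub>} \<union> {w. q w \<noteq> \<zero>\<^bsub>K\<^esub>}"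
  show "finite ?W" using p q by (simp add: free_algD(2))
  show "(p \<oplus>\<^bsub>F\<^esub> q) w \<in> carrier K" for w using p q by (simp add: free_alg_simps)
  fix w assume "(p \<oplus>\<^bsub>F\<^esub> q) w \<noteq> \<zero>\<^bsub>K\<^esub>"
  then have "p w \<noteq> \<zero>\<^bsub>K\<^esub> \<or> q w \<noteq> \<zero>\<^bsub>K\<^esub>" by (auto simp: free_alg_simps)
  then show "w \<in> ?W" "w \<in> lists symbols" using free_algD(3)[OF p] free_algD(3)[OF q] by blast+
qed

lemma free_alg_smult:
  assumes c: "c \<in> carrier K" and p: "p \<in> carrier F"
  shows "c \<odot>\<^bsub>F\<^esub> p \<in> carrier F"
proof (rule free_algI)
  show "finite {w. p w \<noteq> \<zero>\<^bsub>K\<^esub>}" using p by (rule free_algD(2))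
  show "(c \<odot>\<^bsub>F\<^esub> p) w \<in> carrier K" for w using c p by (simp add: free_alg_simps)
  fix w assume "(c \<odot>\<^bsub>F\<^esub> p) w \<noteq> \<zero>\<^bsub>K\<^esub>"
  then have "p w \<noteq> \<zero>\<^bsub>K\<^esub>" using c by (auto simp: free_alg_simps)
  then show "w \<in> {w. p w \<noteq> \<zero>\<^bsub>K\<^esub>}" "w \<in> lists symbols" using free_algD(3)[OF p] by blast+
qed

lemma free_alg_mult:
  assumes p: "p \<in> carrier F" and q: "q \<in> carrier F"
  shows "p \<otimes>\<^bsub>F\<^esub> q \<in> carrier F"
proof (rule free_algI)
  let ?W = "(\<lambda>(u, v). u @ v) ` ({w. p w \<noteq> \<zero>\<^bsub>K\<^esub>} \<times> {w. q w \<noteq> \<zero>\<^bsub>K\<^esub>})"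
  note pq = free_algD(1)[OF p] free_algD(1)[OF q]
  show "finite ?W" using p q by (simp add: free_algD(2))
  show "(p \<otimes>\<^bsub>F\<^esub> q) w \<in> carrier K" for w using pq by (rule conv_closed)
  fix w assume "(p \<otimes>\<^bsub>F\<^esub> q) w \<noteq> \<zero>\<^bsub>K\<^esub>"
  with pq obtain u v where *: "w = u @ v" "p u \<noteq> \<zero>\<^bsub>K\<^esub>" "q v \<noteq> \<zero>\<^bsub>K\<^esub>"
    by (rule conv_nonzero)
  then show "w \<in> ?W" by auto
  show "w \<in> lists symbols"
    using * free_algD(3)[OF p *(2)] free_algD(3)[OF q *(3)] by simp
qed

lemma monomial_closed: "u \<in> lists symbols \<Longrightarrow> monomial D u \<in> carrier F"
  by (rule free_algI[of _ "{u}"]) (auto simp: monomial_def split: if_splits)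

sublocale F: ring F
proof (rule ringI)
  show "abelian_group F"
  proof (rule abelian_groupI)
    show "\<zero>\<^bsub>F\<^esub> \<in> carrier F" by (simp add: free_alg_simps)
  next
    fix p assume p: "p \<in> carrier F"
    let ?q = "\<lambda>w. \<ominus>\<^bsub>K\<^esub> p w"
    have "p w \<noteq> \<zero>\<^bsub>K\<^esub>" if "?q w \<noteq> \<zero>\<^bsub>K\<^esub>" for w
    proof
      assume "p w = \<zero>\<^bsub>K\<^esub>"
      moreover have "\<ominus>\<^bsub>K\<^esub> \<zero>\<^bsub>K\<^esub> = \<zero>\<^bsub>K\<^esub>" by (rule K.minus_zero)
      ultimately show False using that by simp
    qed
    then have "?q \<in> carrier F"
      using p by (intro free_algI[of _ "{w. p w \<noteq> \<zero>\<^bsub>K\<^esub>}"]) (auto simp: free_alg_simps(1))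
    moreover have "?q \<oplus>\<^bsub>F\<^esub> p = \<zero>\<^bsub>F\<^esub>"
      using p by (simp add: free_alg_simps K.l_neg)
    ultimately show "\<exists>q\<in>carrier F. q \<oplus>\<^bsub>F\<^esub> p = \<zero>\<^bsub>F\<^esub>" by blast
  next
    fix p q r assume "p \<in> carrier F" "q \<in> carrier F" "r \<in> carrier F"
    then show "p \<oplus>\<^bsub>F\<^esub> q \<oplus>\<^bsub>F\<^esub> r = p \<oplus>\<^bsub>F\<^esub> (q \<oplus>\<^bsub>F\<^esub> r)"
      by (simp add: free_alg_simps K.a_assoc)
  next
    fix p q assume "p \<in> carrier F" "q \<in> carrier F"
    then show "p \<oplus>\<^bsub>F\<^esub> q = q \<oplus>\<^bsub>F\<^esub> p"
      by (simp add: free_alg_simps K.a_comm)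
  next
    fix p assume "p \<in> carrier F"
    then show "\<zero>\<^bsub>F\<^esub> \<oplus>\<^bsub>F\<^esub> p = p" by (simp add: free_alg_simps)
  qed (rule free_alg_add)
  show "Group.monoid F"
  proof (rule monoidI)
    show "\<one>\<^bsub>F\<^esub> \<in> carrier F" unfolding free_alg_simps(2) by (rule monomial_closed) simp
  next
    fix p q r assume *: "p \<in> carrier F" "q \<in> carrier F" "r \<in> carrier F"
    show "p \<otimes>\<^bsub>F\<^esub> q \<otimes>\<^bsub>F\<^esub> r = p \<otimes>\<^bsub>F\<^esub> (q \<otimes>\<^bsub>F\<^esub> r)"
      by (rule ext) (intro conv_assoc free_algD(1) *)
  next
    fix p assume *: "p \<in> carrier F"
    show "\<one>\<^bsub>F\<^esub> \<otimes>\<^bsub>F\<^esub> p = p" "p \<otimes>\<^bsub>F\<^esub> \<one>\<^bsub>F\<^esub> = p"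
      unfolding free_alg_simps(2) by (rule ext, intro conv_one_l conv_one_r free_algD(1) *)+
  qed (rule free_alg_mult)
next
  fix p q r assume *: "p \<in> carrier F" "q \<in> carrier F" "r \<in> carrier F"
  show "(p \<oplus>\<^bsub>F\<^esub> q) \<otimes>\<^bsub>F\<^esub> r = p \<otimes>\<^bsub>F\<^esub> r \<oplus>\<^bsub>F\<^esub> q \<otimes>\<^bsub>F\<^esub> r"
    unfolding free_alg_simps(4) by (rule ext) (intro conv_add_l free_algD(1) *)
  show "r \<otimes>\<^bsub>F\<^esub> (p \<oplus>\<^bsub>F\<^esub> q) = r \<otimes>\<^bsub>F\<^esub> p \<oplus>\<^bsub>F\<^esub> r \<otimes>\<^bsub>F\<^esub> q"
    unfolding free_alg_simps(4) by (rule ext) (intro conv_add_r free_algD(1) *)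
qed

lemma free_alg_smult_eq:
  assumes "c \<in> carrier K" "p \<in> carrier F"
  shows "c \<odot>\<^bsub>F\<^esub> p = (c \<odot>\<^bsub>F\<^esub> \<one>\<^bsub>F\<^esub>) \<otimes>\<^bsub>F\<^esub> p"
  unfolding free_alg_simps
  using assms by (intro ext) (simp add: conv_smult_l conv_one_l monomial_closed_K free_algD)

text \<open>
  Elements of the free algebra are sums of scaled monomials.  The set \<open>W\<close> restricts the words that
  occur; for homogeneous elements it is the set of words of their degree.
\<close>

lemma free_alg_induct:
  assumes "p \<in> carrier F" "\<And>w. p w \<noteq> \<zero>\<^bsub>K\<^esub> \<Longrightarrow> w \<in> W"
    and zero: "P \<zero>\<^bsub>F\<^esub>"
    and add: "\<And>c u q. c \<in> carrier K \<Longrightarrow> u \<in> lists symbols \<Longrightarrow> u \<in> W \<Longrightarrow> q \<in> carrier F \<Longrightarrow>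
      (\<And>w. q w \<noteq> \<zero>\<^bsub>K\<^esub> \<Longrightarrow> w \<in> W) \<Longrightarrow> P q \<Longrightarrow> P (c \<odot>\<^bsub>F\<^esub> monomial D u \<oplus>\<^bsub>F\<^esub> q)"
  shows "P p"
  using assms(1,2)
proof (induction "card {w. p w \<noteq> \<zero>\<^bsub>K\<^esub>}" arbitrary: p rule: less_induct)
  case less
  note fin = free_algD(2)[OF less.prems(1)]
  show ?case
  proof (cases "\<exists>u. p u \<noteq> \<zero>\<^bsub>K\<^esub>")
    case False
    then have "p = \<zero>\<^bsub>F\<^esub>" by (auto simp: free_alg_simps)
    then show ?thesis using zero by simp
  next
    case True
    then obtain u where u: "p u \<noteq> \<zero>\<^bsub>K\<^esub>" by blast
    define q where "q = p(u := \<zero>\<^bsub>K\<^esub>)"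
    have supp: "{w. q w \<noteq> \<zero>\<^bsub>K\<^esub>} = {w. p w \<noteq> \<zero>\<^bsub>K\<^esub>} - {u}" by (auto simp: q_def)
    have q: "q \<in> carrier F"
      using less.prems(1) fin
      by (intro free_algI[of _ "{w. p w \<noteq> \<zero>\<^bsub>K\<^esub>}"]) (auto simp: q_def free_alg_simps(1) split: if_splits)
    have qW: "w \<in> W" if "q w \<noteq> \<zero>\<^bsub>K\<^esub>" for w
      using that less.prems(2) by (auto simp: q_def split: if_splits)
    have "card {w. q w \<noteq> \<zero>\<^bsub>K\<^esub>} < card {w. p w \<noteq> \<zero>\<^bsub>K\<^esub>}"
      unfolding supp using fin by (rule card_Diff1_less) (simp add: u)
    then have "P q" using q qW by (rule less.hyps)
    then have "P (p u \<odot>\<^bsub>F\<^esub> monomial D u \<oplus>\<^bsub>F\<^esub> q)"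
      using less.prems q qW u free_algD[OF less.prems(1)] by (intro add) auto
    moreover have "p u \<odot>\<^bsub>F\<^esub> monomial D u \<oplus>\<^bsub>F\<^esub> q = p"
      using free_algD(1)[OF less.prems(1)]
      by (auto simp: free_alg_simps q_def monomial_def fun_eq_iff)
    ultimately show ?thesis by simp
  qed
qed

section \<open>The grading of the construction\<close>

lemma free_alg_uminus:
  assumes p: "p \<in> carrier F"
  shows "\<ominus>\<^bsub>F\<^esub> p = (\<lambda>w. \<ominus>\<^bsub>K\<^esub> p w)"
proof (rule ext)
  fix w
  have "(\<ominus>\<^bsub>F\<^esub> p) w \<oplus>\<^bsub>K\<^esub> p w = \<zero>\<^bsub>K\<^esub>"
    using F.l_neg[OF p] by (simp add: free_alg_simps fun_eq_iff)
  then show "(\<ominus>\<^bsub>F\<^esub> p) w = \<ominus>\<^bsub>K\<^esub> p w"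
    using K.minus_equality[of "(\<ominus>\<^bsub>F\<^esub> p) w" "p w"] free_algD(1)[OF p]
      free_algD(1)[OF F.a_inv_closed[OF p]] by simp
qed

text \<open>The homogeneous elements of degree \<open>g\<close> of the free algebra.\<close>

definition free_comp :: "(int, 'n) vec \<Rightarrow> (('r, 'n) letter list \<Rightarrow> 'k) set" where
  "free_comp g = {p \<in> carrier F. \<forall>w. p w \<noteq> \<zero>\<^bsub>K\<^esub> \<longrightarrow> deg w = g}"

lemma comp_eq: "comp D g = (+>\<^bsub>F\<^esub>) (rel_ideal D) ` free_comp g"
  by (auto simp: comp_def free_comp_def)

lemma free_compD:
  assumes "p \<in> free_comp g"
  shows "p \<in> carrier F" "deg w \<noteq> g \<Longrightarrow> p w = \<zero>\<^bsub>K\<^esub>"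
  using assms by (auto simp: free_comp_def)

lemma free_compI:
  assumes "p \<in> carrier F" "\<And>w. deg w \<noteq> g \<Longrightarrow> p w = \<zero>\<^bsub>K\<^esub>"
  shows "p \<in> free_comp g"
  using assms by (auto simp: free_comp_def)

lemma free_comp_zero: "\<zero>\<^bsub>F\<^esub> \<in> free_comp g"
  by (rule free_compI[OF F.zero_closed]) (simp add: free_alg_simps)

lemma free_comp_add: "p \<in> free_comp g \<Longrightarrow> q \<in> free_comp g \<Longrightarrow> p \<oplus>\<^bsub>F\<^esub> q \<in> free_comp g"
  by (rule free_compI, simp add: free_compD) (simp add: free_compD free_alg_simps(4))

lemma free_comp_uminus: "p \<in> free_comp g \<Longrightarrow> \<ominus>\<^bsub>F\<^esub> p \<in> free_comp g"
  by (rule free_compI, simp add: free_compD) (simp add: free_compD free_alg_uminus K.minus_zero)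

lemma free_comp_smult: "c \<in> carrier K \<Longrightarrow> p \<in> free_comp g \<Longrightarrow> c \<odot>\<^bsub>F\<^esub> p \<in> free_comp g"
  by (rule free_compI, simp add: free_compD free_alg_smult) (simp add: free_compD free_alg_simps(5))

lemma free_comp_minus: "p \<in> free_comp g \<Longrightarrow> q \<in> free_comp g \<Longrightarrow> p \<ominus>\<^bsub>F\<^esub> q \<in> free_comp g"
  unfolding a_minus_def by (intro free_comp_add free_comp_uminus)

lemma monomial_free_comp: "u \<in> lists symbols \<Longrightarrow> deg u = g \<Longrightarrow> monomial D u \<in> free_comp g"
  by (rule free_compI[OF monomial_closed]) (auto simp: monomial_def)

lemma free_comp_subgroup: "additive_subgroup (free_comp g) F"
proof (rule additive_subgroupI, rule subgroup.intro)
  show "inv\<^bsub>add_monoid F\<^esub> p \<in> free_comp g" if "p \<in> free_comp g" for p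
    using free_comp_uminus[OF that] by (simp add: a_inv_def)
qed (auto simp: free_compD free_comp_add free_comp_zero)

lemma deg_append: "deg (u @ v) = deg u + deg v"
  by (simp add: deg_def)

lemma free_comp_mult:
  assumes p: "p \<in> free_comp g" and q: "q \<in> free_comp h"
  shows "p \<otimes>\<^bsub>F\<^esub> q \<in> free_comp (g + h)"
proof (rule free_compI)
  note pq = free_compD(1)[OF p] free_compD(1)[OF q]
  show "p \<otimes>\<^bsub>F\<^esub> q \<in> carrier F" using pq by (rule free_alg_mult)
  fix w :: "('r, 'n) letter list" assume w: "deg w \<noteq> g + h"
  show "(p \<otimes>\<^bsub>F\<^esub> q) w = \<zero>\<^bsub>K\<^esub>"
  proof (rule ccontr)
    assume "(p \<otimes>\<^bsub>F\<^esub> q) w \<noteq> \<zero>\<^bsub>K\<^esub>"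
    with free_algD(1)[OF pq(1)] free_algD(1)[OF pq(2)]
    obtain u v where "w = u @ v" "p u \<noteq> \<zero>\<^bsub>K\<^esub>" "q v \<noteq> \<zero>\<^bsub>K\<^esub>" by (rule conv_nonzero)
    moreover from this have "deg u = g" "deg v = h"
      using free_compD(2)[OF p, of u] free_compD(2)[OF q, of v] by blast+
    ultimately show False using w by (simp add: deg_append)
  qed
qed

sublocale F: graded_ring F UNIV free_comp
proof -
  interpret G: subgroup_family F UNIV free_comp
    using F.abelian_group_axioms free_comp_subgroup by (rule subgroup_familyI)
  have sum: "finsum F x G w = (if deg w \<in> G then x (deg w) w else \<zero>\<^bsub>K\<^esub>)"
    if "finite G" "x \<in> Pi G free_comp" for x G w
    using that
  proof (induction G)
    case empty
    show ?case by (simp add: free_alg_simps)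
  next
    case (insert g G)
    have x: "x g \<in> free_comp g" "x \<in> Pi G free_comp" using insert.prems by auto
    have c: "x g w \<in> carrier K" "deg w \<in> G \<Longrightarrow> x (deg w) w \<in> carrier K"
      using free_algD(1)[OF free_compD(1)[OF x(1)]] free_algD(1)[OF free_compD(1), of "x (deg w)"] x(2)
      by auto
    have "finsum F x (insert g G) w = x g w \<oplus>\<^bsub>K\<^esub> finsum F x G w"
      using F.finsum_insert[OF insert.hyps G.family_carrier[OF _ x(2)] free_compD(1)[OF x(1)]]
      by (simp add: free_alg_simps)
    then show ?case
      using insert.IH[OF x(2)] insert.hyps(2) c free_compD(2)[OF x(1), of w] by auto
  qed
  have "is_direct_sum_of F UNIV free_comp"
    unfolding is_direct_sum_of_def
  proof (intro conjI allI impI equalityI subsetI ballI)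
    fix p assume "p \<in> carrier F"
    then show "p \<in> sum_of F UNIV free_comp"
    proof (rule free_alg_induct[where W = UNIV])
      show "\<zero>\<^bsub>F\<^esub> \<in> sum_of F UNIV free_comp" by (rule G.sum_of_zero)
      fix c u q assume "c \<in> carrier K" "u \<in> lists symbols" "q \<in> sum_of F UNIV free_comp"
      then show "c \<odot>\<^bsub>F\<^esub> monomial D u \<oplus>\<^bsub>F\<^esub> q \<in> sum_of F UNIV free_comp"
        by (intro G.sum_of_add_component free_comp_smult monomial_free_comp) auto
    qed simp
  next
    fix p assume "p \<in> sum_of F UNIV free_comp"
    then show "p \<in> carrier F" by (rule G.sum_of_carrier)
  next
    fix G x g
    assume G: "finite G" "x \<in> Pi G free_comp" "finsum F x G = \<zero>\<^bsub>F\<^esub>" "g \<in> G"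
    have "x g w = \<zero>\<^bsub>K\<^esub>" for w
    proof (cases "deg w = g")
      case True
      then show ?thesis using sum[OF G(1,2), of w] G(3,4) by (simp add: free_alg_simps)
    next
      case False
      have "x g \<in> free_comp g" using G(2,4) by auto
      then show ?thesis using False by (rule free_compD(2))
    qed
    then show "x g = \<zero>\<^bsub>F\<^esub>" by (simp add: free_alg_simps fun_eq_iff)
  qed
  moreover have "\<one>\<^bsub>F\<^esub> \<in> free_comp 0"
    unfolding free_alg_simps(2) by (rule monomial_free_comp) (simp_all add: deg_def)
  ultimately show "graded_ring F UNIV free_comp"
    by (intro graded_ring.intro graded_ring_axioms.intro F.ring_axioms G.subgroup_family_axioms
      free_comp_mult) auto
qed

lemma Coef_symbols: "r \<in> carrier R \<Longrightarrow> Coef r \<in> symbols" and Gen_symbols: "Gen z \<in> symbols"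
  by (auto simp: symbols_def)

lemma sigma_iso: "\<sigma> i \<in> ring_iso R R"
  using data by (simp add: is_tgw_data_def)

lemma sigma_inv_iso: "sigma_inv D i \<in> ring_iso R R"
  using R.ring_axioms sigma_iso by (rule ring_iso_set_sym)

lemma iso_closed: "h \<in> ring_iso R R \<Longrightarrow> r \<in> carrier R \<Longrightarrow> h r \<in> carrier R"
  by (auto dest: ring_iso_memE)

lemma sigma_closed: "r \<in> carrier R \<Longrightarrow> \<sigma> i r \<in> carrier R"
  and sigma_inv_closed: "r \<in> carrier R \<Longrightarrow> sigma_inv D i r \<in> carrier R"
  by (rule iso_closed[OF sigma_iso], assumption) (rule iso_closed[OF sigma_inv_iso])

lemma sigma_inverse:
  assumes "r \<in> carrier R"
  shows "\<sigma> i (sigma_inv D i r) = r" "sigma_inv D i (\<sigma> i r) = r"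
proof -
  have b: "bij_betw (\<sigma> i) (carrier R) (carrier R)" using sigma_iso by (rule ring_iso_memE(5))
  then show "\<sigma> i (sigma_inv D i r) = r" using assms by (rule bij_betw_inv_into_right)
  show "sigma_inv D i (\<sigma> i r) = r" using b assms by (rule bij_betw_inv_into_left)
qed

lemma t_closed: "tgw_t D i \<in> carrier R"
  and mu_closed: "tgw_mu D i j \<in> carrier K"
  and mu_nonzero: "tgw_mu D i j \<noteq> \<zero>\<^bsub>K\<^esub>"
  using data by (simp_all add: is_tgw_data_def)

lemma R_smult_closed: "c \<in> carrier K \<Longrightarrow> r \<in> carrier R \<Longrightarrow> c \<odot>\<^bsub>R\<^esub> r \<in> carrier R"
  by (rule module.smult_closed[OF algebra.axioms(1)[OF algebra_R]])

lemma R_smult_eq: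
  assumes "c \<in> carrier K" "r \<in> carrier R"
  shows "c \<odot>\<^bsub>R\<^esub> r = (c \<odot>\<^bsub>R\<^esub> \<one>\<^bsub>R\<^esub>) \<otimes>\<^bsub>R\<^esub> r"
  using algebra.smult_assoc2[OF algebra_R assms(1) R.one_closed assms(2)] assms by simp

text \<open>The defining relations are homogeneous.\<close>

lemma relators_homogeneous:
  assumes "p \<in> relators D"
  shows "\<exists>g. p \<in> free_comp g"
proof -
  note closed = R.a_closed R.m_closed R_smult_closed sigma_closed sigma_inv_closed t_closed mu_closed
  have m: "monomial D u \<in> free_comp (deg u)" if "set u \<subseteq> symbols" for u
    using that by (intro monomial_free_comp) (auto simp: lists_eq_set)
  have m1: "monomial D u \<in> free_comp g" if "set u \<subseteq> symbols" "deg u = g" for u g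
    using m that by blast
  have diff: "\<exists>g. monomial D u \<ominus>\<^bsub>F\<^esub> q \<in> free_comp g"
    if "set u \<subseteq> symbols" "q \<in> free_comp (deg u)" for u q
    using m that by (blast intro: free_comp_minus)
  show ?thesis
    using assms unfolding relators_def Let_def
    \<comment> \<open>One goal for each family of relators; what remains is to compare degrees.\<close>
    apply (elim UnE CollectE exE conjE)
            apply (simp_all only: singleton_iff)
            apply (rule_tac [!] diff)
                     apply (simp_all add: Coef_symbols Gen_symbols closed)
            apply (intro free_comp_add free_comp_smult m1; simp add: deg_def Coef_symbols Gen_symbols closed)+
    done
qed

lemma relators_carrier: "relators D \<subseteq> carrier F"
  using relators_homogeneous free_compD(1) by blast

sublocale I: ideal "rel_ideal D" F
  unfolding rel_ideal_def using relators_carrier by (rule F.genideal_ideal)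

lemma relators_rel_ideal: "p \<in> relators D \<Longrightarrow> p \<in> rel_ideal D"
  unfolding rel_ideal_def using F.genideal_self[OF relators_carrier] by blast

lemma rel_ideal_component_subgroup: "additive_subgroup (rel_ideal D \<inter> free_comp g) F"
proof (rule additive_subgroupI, rule F.add.subgroups_Inter_pair)
  show "subgroup (rel_ideal D) (add_monoid F)" by (rule I.a_subgroup)
  show "subgroup (free_comp g) (add_monoid F)"
    using free_comp_subgroup by (rule additive_subgroup.a_subgroup)
qed

text \<open>So the ideal of relations is homogeneous, and the construction is graded.\<close>

lemma rel_ideal_eq: "rel_ideal D = sum_of F UNIV (\<lambda>g. rel_ideal D \<inter> free_comp g)" (is "_ = ?S")
proof
  interpret N: subgroup_family F UNIV "\<lambda>g. rel_ideal D \<inter> free_comp g"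
    using F.abelian_group_axioms rel_ideal_component_subgroup by (rule subgroup_familyI)
  show "?S \<subseteq> rel_ideal D"
  proof
    fix p assume "p \<in> ?S"
    then show "p \<in> rel_ideal D"
      by (rule N.sum_of_closed_induct) (auto intro: I.a_closed)
  qed
  have "ideal ?S F"
    using rel_ideal_component_subgroup
    by (rule F.graded_ideal)
      (auto intro: I.I_l_closed I.I_r_closed free_compD(1) free_comp_mult)
  moreover have "relators D \<subseteq> ?S"
  proof
    fix p assume p: "p \<in> relators D"
    then obtain g where "p \<in> free_comp g" using relators_homogeneous by blast
    then show "p \<in> ?S" using relators_rel_ideal[OF p] by (intro N.component_sum_of) auto
  qed
  ultimately show "rel_ideal D \<subseteq> ?S"
    unfolding rel_ideal_def by (rule F.genideal_minimal)
qed

sublocale A: graded_ring A UNIV "comp D"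
proof -
  have "ideal (sum_of F UNIV (\<lambda>g. rel_ideal D \<inter> free_comp g)) F"
    using I.ideal_axioms by (simp only: rel_ideal_eq[symmetric])
  then have "graded_ring (quot_alg F (sum_of F UNIV (\<lambda>g. rel_ideal D \<inter> free_comp g))) UNIV
     (\<lambda>g. (+>\<^bsub>F\<^esub>) (sum_of F UNIV (\<lambda>g. rel_ideal D \<inter> free_comp g)) ` free_comp g)"
    using rel_ideal_component_subgroup by (intro F.graded_quotient) auto
  then show "graded_ring A UNIV (comp D)"
    by (simp add: rel_ideal_eq[symmetric] tgwc_def comp_eq[symmetric])
qed

section \<open>The action of the grading group on the ring of coefficients\<close>

lemma sigma_pow_iso: "sigma_pow D i z \<in> ring_iso R R"
proof -
  have "h ^^ n \<in> ring_iso R R" if "h \<in> ring_iso R R" for h n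
  proof (induction n)
    case 0
    show ?case using ring_iso_set_refl by (simp add: id_def)
  next
    case (Suc n)
    from Suc that show ?case unfolding funpow.simps by (rule ring_iso_set_trans)
  qed
  then show ?thesis unfolding sigma_pow_def using sigma_iso sigma_inv_iso by simp
qed

lemma act_iso: "act D g \<in> ring_iso R R"
proof -
  have "foldr (\<lambda>i. sigma_pow D i (g $ i)) L \<in> ring_iso R R" for L
  proof (induction L)
    case Nil
    show ?case using ring_iso_set_refl by (simp add: id_def)
  next
    case (Cons i L)
    show ?case unfolding foldr.simps using Cons sigma_pow_iso by (rule ring_iso_set_trans)
  qed
  then show ?thesis by (simp add: act_def)
qed

lemma act_closed: "r \<in> carrier R \<Longrightarrow> act D g r \<in> carrier R"
  by (rule iso_closed[OF act_iso])

lemma act_add_mult: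
  assumes "r \<in> carrier R" "s \<in> carrier R"
  shows "act D g (r \<oplus>\<^bsub>R\<^esub> s) = act D g r \<oplus>\<^bsub>R\<^esub> act D g s"
    and "act D g (r \<otimes>\<^bsub>R\<^esub> s) = act D g r \<otimes>\<^bsub>R\<^esub> act D g s"
  using ring_iso_memE[OF act_iso] assms by auto

lemma sigma_pow_closed: "r \<in> carrier R \<Longrightarrow> sigma_pow D i z r \<in> carrier R"
  by (rule iso_closed[OF sigma_pow_iso])

lemma sigma_pow_succ:
  assumes r: "r \<in> carrier R"
  shows "sigma_pow D i (1 + z) r = \<sigma> i (sigma_pow D i z r)"
proof (cases "0 \<le> z")
  case True
  then have "nat (1 + z) = Suc (nat z)" by simp
  then show ?thesis using True by (simp add: sigma_pow_def)
next
  case False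
  then have n: "nat (- z) = Suc (nat (- (1 + z)))" by simp
  have "sigma_pow D i (1 + z) r = (sigma_inv D i ^^ nat (- (1 + z))) r"
    using False by (simp add: sigma_pow_def)
  moreover from this have "(sigma_inv D i ^^ nat (- (1 + z))) r \<in> carrier R"
    using sigma_pow_closed[OF r, of i "1 + z"] by simp
  ultimately show ?thesis using False sigma_inverse(1) unfolding sigma_pow_def n by simp
qed

lemma sigma_inj: "r \<in> carrier R \<Longrightarrow> s \<in> carrier R \<Longrightarrow> \<sigma> i r = \<sigma> i s \<Longrightarrow> r = s"
  by (metis sigma_inverse(2))

lemma sigma_sigma_pow:
  assumes r: "r \<in> carrier R"
  shows "\<sigma> j (sigma_pow D i z r) = sigma_pow D i z (\<sigma> j r)"
proof -
  have comm: "\<sigma> i (\<sigma> j s) = \<sigma> j (\<sigma> i s)" if "s \<in> carrier R" for s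
    using data that by (simp add: is_tgw_data_def)
  \<comment> \<open>\<open>\<sigma> i\<close> is injective, so the claims for \<open>z\<close> and \<open>1 + z\<close> are equivalent.\<close>
  have step: "\<sigma> j (sigma_pow D i z r) = sigma_pow D i z (\<sigma> j r) \<longleftrightarrow>
      \<sigma> j (sigma_pow D i (1 + z) r) = sigma_pow D i (1 + z) (\<sigma> j r)" for z
  proof -
    have "\<sigma> i (\<sigma> j (sigma_pow D i z r)) = \<sigma> j (sigma_pow D i (1 + z) r)"
      using comm[OF sigma_pow_closed[OF r, of i z]] sigma_pow_succ[OF r, of i z] by simp
    moreover have "\<sigma> i (sigma_pow D i z (\<sigma> j r)) = sigma_pow D i (1 + z) (\<sigma> j r)"
      using sigma_pow_succ[OF sigma_closed[OF r], of i z j] by simp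
    ultimately show ?thesis
      using sigma_inj[OF sigma_closed[OF sigma_pow_closed[OF r, of i z], of j]
          sigma_pow_closed[OF sigma_closed[OF r, of j], of i z], of i] by metis
  qed
  show ?thesis
  proof (induction z rule: int_induct[where k = 0])
    case base
    show ?case by (simp add: sigma_pow_def)
  next
    case (step1 z)
    then show ?case using step[of z] by (simp add: add.commute)
  next
    case (step2 z)
    then show ?case using step[of "z - 1"] by simp
  qed
qed

text \<open>
  The action of \<open>\<int>\<^sup>n\<close> is defined as a product of powers in a fixed order; the automorphisms commute,
  so it is enough to know the effect of adding a basis vector to \<open>g\<close>.
\<close>

lemma act_shift:
  assumes r: "r \<in> carrier R"
  shows "act D (axis i 1 + g) r = \<sigma> i (act D g r)"
proof -
  have closed: "foldr (\<lambda>j. sigma_pow D j (h $ j)) L r \<in> carrier R" for h :: "(int, 'n) vec" and L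
    using r by (induction L) (auto intro: sigma_pow_closed)
  have "foldr (\<lambda>j. sigma_pow D j ((axis i 1 + g) $ j)) L r =
      (if i \<in> set L then \<sigma> i (foldr (\<lambda>j. sigma_pow D j (g $ j)) L r)
       else foldr (\<lambda>j. sigma_pow D j (g $ j)) L r)" if "distinct L" for L
    using that
  proof (induction L)
    case Nil
    show ?case by simp
  next
    case (Cons j L)
    then show ?case
      using sigma_pow_succ[OF closed, of i "g $ i"] sigma_sigma_pow[OF closed]
      by (auto simp: axis_def)
  qed
  from this[of "sorted_list_of_set UNIV"] show ?thesis by (simp add: act_def)
qed

lemma act_unshift:
  assumes r: "r \<in> carrier R"
  shows "act D (- axis i 1 + g) r = sigma_inv D i (act D g r)"
  using act_shift[OF r, of i "- axis i 1 + g"] sigma_inverse(2)[OF act_closed[OF r], of i "- axis i 1 + g"]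
  by simp

lemma act_zero: "act D 0 r = r"
proof -
  have "foldr (\<lambda>j. sigma_pow D j (0 $ j)) L r = r" for L :: "'n list"
    by (induction L) (auto simp: sigma_pow_def)
  then show ?thesis by (simp add: act_def)
qed

lemma int_vec_induct:
  fixes g :: "(int, 'n) vec"
  assumes zero: "P 0" and up: "\<And>i g. P g \<Longrightarrow> P (axis i 1 + g)" and down: "\<And>i g. P g \<Longrightarrow> P (- axis i 1 + g)"
  shows "P g"
proof -
  have "P g" if "finite G" "\<And>i. i \<notin> G \<Longrightarrow> g $ i = 0" for G and g :: "(int, 'n) vec"
    using that
  proof (induction G arbitrary: g)
    case empty
    then have "g = 0" by (simp add: vec_eq_iff)
    then show ?case using zero by simp
  next
    case (insert i G)
    let ?g = "\<lambda>z. \<chi> j. if j = i then z else g $ j"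
    have "P (?g z)" for z
    proof (induction z rule: int_induct[where k = 0])
      case base
      show ?case using insert.prems by (intro insert.IH) auto
    next
      case (step1 z)
      have "?g (z + 1) = axis i 1 + ?g z" by (simp add: vec_eq_iff axis_def)
      then show ?case using up[OF step1(2)] by simp
    next
      case (step2 z)
      have "?g (z - 1) = - axis i 1 + ?g z" by (simp add: vec_eq_iff axis_def)
      then show ?case using down[OF step2(2)] by simp
    qed
    moreover have "?g (g $ i) = g" by (simp add: vec_eq_iff)
    ultimately show ?case by metis
  qed
  from this[of UNIV g] show ?thesis by simp
qed

lemma act_plus:
  assumes r: "r \<in> carrier R"
  shows "act D (g + h) r = act D g (act D h r)"
proof (induction g rule: int_vec_induct)
  case 1
  show ?case by (simp add: act_zero)
next
  case (2 i g)
  then show ?case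
    using act_shift[OF r, of i "g + h"] act_shift[OF act_closed[OF r, of h], of i g] by (simp add: add.assoc)
next
  case (3 i g)
  have "- axis i 1 + g + h = - axis i 1 + (g + h)" by (rule add.assoc)
  then show ?case
    by (simp only: 3 act_unshift[OF r, of i "g + h"] act_unshift[OF act_closed[OF r, of h], of i g])
qed

lemma act_uminus: "r \<in> carrier R \<Longrightarrow> act D (- g) (act D g r) = r"
  using act_plus[of r "- g" g] by (simp add: act_zero)

section \<open>Words\<close>

text \<open>The element of the construction represented by a monomial.\<close>

abbreviation cls :: "('r, 'n) letter list \<Rightarrow> (('r, 'n) letter list \<Rightarrow> 'k) set" where
  "cls u \<equiv> rel_ideal D +>\<^bsub>F\<^esub> monomial D u"

lemmas coset_hom = I.coset_hom[folded quot_alg_simps, folded tgwc_def]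

lemma cls_closed: "u \<in> lists symbols \<Longrightarrow> cls u \<in> carrier A"
  by (rule coset_hom(1)[OF monomial_closed])

lemma cls_append: "u \<in> lists symbols \<Longrightarrow> v \<in> lists symbols \<Longrightarrow> cls (u @ v) = cls u \<otimes>\<^bsub>A\<^esub> cls v"
  using coset_hom(3)[OF monomial_closed monomial_closed] by (simp add: monomial_mult)

lemma relator_eq:
  assumes "p \<ominus>\<^bsub>F\<^esub> q \<in> relators D" "p \<in> carrier F" "q \<in> carrier F"
  shows "rel_ideal D +>\<^bsub>F\<^esub> p = rel_ideal D +>\<^bsub>F\<^esub> q"
  using F.quotient_eq_iff_same_a_r_cos[OF I.ideal_axioms assms(2,3)] relators_rel_ideal[OF assms(1)]
  by simp

lemma symbols_lists:
  "[] \<in> lists symbols" "map Gen a \<in> lists symbols"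
  "r \<in> carrier R \<Longrightarrow> w \<in> lists symbols \<Longrightarrow> Coef r # w \<in> lists symbols"
  "w \<in> lists symbols \<Longrightarrow> Gen z # w \<in> lists symbols"
  "r \<in> carrier R \<Longrightarrow> Coef r \<in> symbols" "Gen z \<in> symbols"
  by (auto simp: symbols_def)

lemmas monomial_closed' = monomial_closed symbols_lists

lemma relators_mem:
  "r \<in> carrier R \<Longrightarrow> s \<in> carrier R \<Longrightarrow>
    monomial D [Coef (r \<oplus>\<^bsub>R\<^esub> s)] \<ominus>\<^bsub>F\<^esub> (monomial D [Coef r] \<oplus>\<^bsub>F\<^esub> monomial D [Coef s]) \<in> relators D"
  "r \<in> carrier R \<Longrightarrow> s \<in> carrier R \<Longrightarrow>
    monomial D [Coef (r \<otimes>\<^bsub>R\<^esub> s)] \<ominus>\<^bsub>F\<^esub> monomial D [Coef r, Coef s] \<in> relators D"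
  "c \<in> carrier K \<Longrightarrow> r \<in> carrier R \<Longrightarrow>
    monomial D [Coef (c \<odot>\<^bsub>R\<^esub> r)] \<ominus>\<^bsub>F\<^esub> c \<odot>\<^bsub>F\<^esub> monomial D [Coef r] \<in> relators D"
  "monomial D [Coef \<one>\<^bsub>R\<^esub>] \<ominus>\<^bsub>F\<^esub> monomial D [] \<in> relators D"
  "r \<in> carrier R \<Longrightarrow>
    monomial D [Gen (X i), Coef r] \<ominus>\<^bsub>F\<^esub> monomial D [Coef (\<sigma> i r), Gen (X i)] \<in> relators D"
  "r \<in> carrier R \<Longrightarrow>
    monomial D [Gen (Y i), Coef r] \<ominus>\<^bsub>F\<^esub> monomial D [Coef (sigma_inv D i r), Gen (Y i)] \<in> relators D"
  "monomial D [Gen (Y i), Gen (X i)] \<ominus>\<^bsub>F\<^esub> monomial D [Coef (tgw_t D i)] \<in> relators D"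
  "monomial D [Gen (X i), Gen (Y i)] \<ominus>\<^bsub>F\<^esub> monomial D [Coef (\<sigma> i (tgw_t D i))] \<in> relators D"
  "i \<noteq> j \<Longrightarrow>
    monomial D [Gen (X i), Gen (Y j)] \<ominus>\<^bsub>F\<^esub> tgw_mu D i j \<odot>\<^bsub>F\<^esub> monomial D [Gen (Y j), Gen (X i)] \<in> relators D"
  unfolding relators_def Let_def by blast+

lemma emb_closed: "r \<in> carrier R \<Longrightarrow> emb D r \<in> carrier A"
  unfolding emb_def by (intro cls_closed symbols_lists)

lemma word_closed: "word D a \<in> carrier A"
  unfolding word_def by (intro cls_closed symbols_lists)

lemma emb_one: "emb D \<one>\<^bsub>R\<^esub> = \<one>\<^bsub>A\<^esub>"
proof -
  have "cls [Coef \<one>\<^bsub>R\<^esub>] = cls []"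
    by (intro relator_eq relators_mem monomial_closed' R.one_closed)
  then show ?thesis by (simp add: emb_def coset_hom(4) free_alg_simps(2))
qed

lemma emb_add:
  assumes rs: "r \<in> carrier R" "s \<in> carrier R"
  shows "emb D (r \<oplus>\<^bsub>R\<^esub> s) = emb D r \<oplus>\<^bsub>A\<^esub> emb D s"
proof -
  have "cls [Coef (r \<oplus>\<^bsub>R\<^esub> s)] = rel_ideal D +>\<^bsub>F\<^esub> (monomial D [Coef r] \<oplus>\<^bsub>F\<^esub> monomial D [Coef s])"
    by (intro relator_eq relators_mem monomial_closed' F.a_closed R.a_closed rs)
  then show ?thesis
    using rs coset_hom(2)[of "monomial D [Coef r]" "monomial D [Coef s]"]
    by (simp add: emb_def monomial_closed')
qed

lemma emb_mult:
  assumes rs: "r \<in> carrier R" "s \<in> carrier R"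
  shows "emb D (r \<otimes>\<^bsub>R\<^esub> s) = emb D r \<otimes>\<^bsub>A\<^esub> emb D s"
proof -
  have "cls [Coef (r \<otimes>\<^bsub>R\<^esub> s)] = cls [Coef r, Coef s]"
    by (intro relator_eq relators_mem monomial_closed' R.m_closed rs)
  then show ?thesis
    using rs cls_append[of "[Coef r]" "[Coef s]"] by (simp add: emb_def symbols_lists)
qed

lemma emb_zero: "emb D \<zero>\<^bsub>R\<^esub> = \<zero>\<^bsub>A\<^esub>"
proof -
  have "emb D \<zero>\<^bsub>R\<^esub> \<oplus>\<^bsub>A\<^esub> emb D \<zero>\<^bsub>R\<^esub> = emb D \<zero>\<^bsub>R\<^esub>"
    using emb_add[OF R.zero_closed R.zero_closed] by (simp only: R.l_zero R.zero_closed)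
  then show ?thesis using A.add.l_cancel_one emb_closed[OF R.zero_closed] by blast
qed

text \<open>The scalar \<open>c\<close> acts on the algebra as the element \<open>c 1\<close> of \<open>R\<close>.\<close>

abbreviation scal :: "'k \<Rightarrow> 'r" where
  "scal c \<equiv> c \<odot>\<^bsub>R\<^esub> \<one>\<^bsub>R\<^esub>"

lemma coset_smult:
  assumes c: "c \<in> carrier K" and p: "p \<in> carrier F"
  shows "rel_ideal D +>\<^bsub>F\<^esub> (c \<odot>\<^bsub>F\<^esub> p) = emb D (scal c) \<otimes>\<^bsub>A\<^esub> (rel_ideal D +>\<^bsub>F\<^esub> p)"
proof -
  have "emb D (scal c) = rel_ideal D +>\<^bsub>F\<^esub> (c \<odot>\<^bsub>F\<^esub> monomial D [Coef \<one>\<^bsub>R\<^esub>])"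
    unfolding emb_def
    by (intro relator_eq relators_mem monomial_closed' R_smult_closed free_alg_smult R.one_closed c)
  also have "\<dots> = rel_ideal D +>\<^bsub>F\<^esub> ((c \<odot>\<^bsub>F\<^esub> \<one>\<^bsub>F\<^esub>) \<otimes>\<^bsub>F\<^esub> monomial D [Coef \<one>\<^bsub>R\<^esub>])"
    by (simp only: free_alg_smult_eq[OF c monomial_closed[OF symbols_lists(3)[OF R.one_closed symbols_lists(1)]]])
  also have "\<dots> = (rel_ideal D +>\<^bsub>F\<^esub> (c \<odot>\<^bsub>F\<^esub> \<one>\<^bsub>F\<^esub>)) \<otimes>\<^bsub>A\<^esub> \<one>\<^bsub>A\<^esub>"
    unfolding emb_one[symmetric] emb_def
    by (intro coset_hom(3)[symmetric] free_alg_smult[OF c] F.one_closed monomial_closed' R.one_closed)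
  also have "\<dots> = rel_ideal D +>\<^bsub>F\<^esub> (c \<odot>\<^bsub>F\<^esub> \<one>\<^bsub>F\<^esub>)"
    using c by (simp add: coset_hom(1) free_alg_smult)
  finally show ?thesis
    unfolding free_alg_smult_eq[OF c p] using c p by (simp add: coset_hom(3) free_alg_smult)
qed

lemma A_smult:
  assumes c: "c \<in> carrier K" and x: "x \<in> carrier A"
  shows "c \<odot>\<^bsub>A\<^esub> x = emb D (scal c) \<otimes>\<^bsub>A\<^esub> x"
proof -
  obtain p where p: "p \<in> carrier F" "x = rel_ideal D +>\<^bsub>F\<^esub> p"
    using x I.coset_cases by (auto simp: tgwc_def quot_alg_simps)
  have "c \<odot>\<^bsub>A\<^esub> x = rel_ideal D +>\<^bsub>F\<^esub> ((c \<odot>\<^bsub>F\<^esub> \<one>\<^bsub>F\<^esub>) \<otimes>\<^bsub>F\<^esub> p)"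
    unfolding p(2) tgwc_def
    using I.ideal_axioms free_alg_smult[OF c F.one_closed] free_alg_smult_eq[OF c] p(1)
    by (rule quot_alg_smult)
  then show ?thesis using coset_smult[OF c p(1)] p(2) unfolding free_alg_smult_eq[OF c p(1)] by simp
qed

lemma word_append: "word D (a @ b) = word D a \<otimes>\<^bsub>A\<^esub> word D b"
  unfolding word_def map_append by (intro cls_append symbols_lists)

lemma word_Cons: "word D (z # a) = word D [z] \<otimes>\<^bsub>A\<^esub> word D a"
  using word_append[of "[z]" a] by simp

lemma word_Nil: "word D [] = \<one>\<^bsub>A\<^esub>"
  by (simp add: word_def coset_hom(4) free_alg_simps(2))

lemma word_comp: "word D a \<in> comp D (wdeg a)"
  unfolding comp_eq word_def by (intro imageI monomial_free_comp symbols_lists deg_map_Gen)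

lemma emb_comp: "r \<in> carrier R \<Longrightarrow> emb D r \<in> comp D 0"
  unfolding comp_eq emb_def by (intro imageI monomial_free_comp symbols_lists) (simp_all add: deg_def)

lemma gen_emb:
  assumes r: "r \<in> carrier R"
  shows "word D [z] \<otimes>\<^bsub>A\<^esub> emb D r = emb D (act D (wdeg [z]) r) \<otimes>\<^bsub>A\<^esub> word D [z]"
proof (cases z)
  case (X i)
  have "cls [Gen (X i), Coef r] = cls [Coef (\<sigma> i r), Gen (X i)]"
    by (intro relator_eq relators_mem monomial_closed' sigma_closed r)
  moreover have "act D (wdeg [z]) r = \<sigma> i r"
    using act_shift[OF r, of i 0] X by (simp add: wdeg_simps act_zero)
  ultimately show ?thesis
    using r X cls_append[of "[Gen (X i)]" "[Coef r]"] cls_append[of "[Coef (\<sigma> i r)]" "[Gen (X i)]"]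
    by (simp add: emb_def word_def symbols_lists sigma_closed)
next
  case (Y i)
  have "cls [Gen (Y i), Coef r] = cls [Coef (sigma_inv D i r), Gen (Y i)]"
    by (intro relator_eq relators_mem monomial_closed' sigma_inv_closed r)
  moreover have "act D (wdeg [z]) r = sigma_inv D i r"
    using act_unshift[OF r, of i 0] Y by (simp add: wdeg_simps act_zero)
  ultimately show ?thesis
    using r Y cls_append[of "[Gen (Y i)]" "[Coef r]"]
      cls_append[of "[Coef (sigma_inv D i r)]" "[Gen (Y i)]"]
    by (simp add: emb_def word_def symbols_lists sigma_inv_closed)
qed

lemma word_emb:
  assumes r: "r \<in> carrier R"
  shows "word D a \<otimes>\<^bsub>A\<^esub> emb D r = emb D (act D (wdeg a) r) \<otimes>\<^bsub>A\<^esub> word D a"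
proof (induction a)
  case Nil
  show ?case using r by (simp add: word_Nil emb_closed wdeg_simps(1) act_zero)
next
  case (Cons z a)
  let ?s = "act D (wdeg a) r"
  have s: "?s \<in> carrier R" using r by (rule act_closed)
  have "word D (z # a) \<otimes>\<^bsub>A\<^esub> emb D r = word D [z] \<otimes>\<^bsub>A\<^esub> (emb D ?s \<otimes>\<^bsub>A\<^esub> word D a)"
    using r Cons by (simp add: word_Cons[of z a] A.m_assoc word_closed emb_closed)
  also have "\<dots> = (word D [z] \<otimes>\<^bsub>A\<^esub> emb D ?s) \<otimes>\<^bsub>A\<^esub> word D a"
    using s by (simp add: A.m_assoc word_closed emb_closed)
  also have "\<dots> = emb D (act D (wdeg [z]) ?s) \<otimes>\<^bsub>A\<^esub> word D (z # a)"
    unfolding gen_emb[OF s] word_Cons[of z a] using s by (simp add: A.m_assoc word_closed emb_closed act_closed)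
  finally show ?case using r by (simp add: wdeg_Cons[of z a] act_plus)
qed

lemma cls_normal:
  assumes "u \<in> lists symbols"
  shows "\<exists>r\<in>carrier R. \<exists>a. wdeg a = deg u \<and> cls u = emb D r \<otimes>\<^bsub>A\<^esub> word D a"
  using assms
proof (induction u)
  case Nil
  have "cls [] = emb D \<one>\<^bsub>R\<^esub> \<otimes>\<^bsub>A\<^esub> word D []"
    using word_Nil A.l_one[OF A.one_closed] by (simp add: emb_one word_def)
  then show ?case by (intro bexI[of _ "\<one>\<^bsub>R\<^esub>"] exI[of _ "[]"]) (simp_all add: deg_def wdeg_def)
next
  case (Cons x u)
  then obtain r a where ra: "r \<in> carrier R" "wdeg a = deg u" "cls u = emb D r \<otimes>\<^bsub>A\<^esub> word D a"
    by blast
  have xu: "cls (x # u) = cls [x] \<otimes>\<^bsub>A\<^esub> cls u"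
    using Cons.hyps cls_append[of "[x]" u] by simp
  show ?case
  proof (cases x)
    case (Coef s)
    then have s: "s \<in> carrier R" using Cons.hyps by (auto simp: symbols_def)
    have "cls (x # u) = emb D (s \<otimes>\<^bsub>R\<^esub> r) \<otimes>\<^bsub>A\<^esub> word D a"
      unfolding xu ra(3) using s ra(1) by (simp add: Coef emb_mult emb_def[symmetric] A.m_assoc emb_closed word_closed)
    moreover have "wdeg a = deg (x # u)" using ra Coef by (simp add: deg_def)
    ultimately show ?thesis using s ra(1) by blast
  next
    case (Gen z)
    have "cls (x # u) = (word D [z] \<otimes>\<^bsub>A\<^esub> emb D r) \<otimes>\<^bsub>A\<^esub> word D a"
      unfolding xu ra(3) using ra(1) by (simp add: Gen word_def[of D "[z]"] A.m_assoc emb_closed word_closed cls_closed symbols_lists)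
    also have "\<dots> = emb D (act D (wdeg [z]) r) \<otimes>\<^bsub>A\<^esub> word D (z # a)"
      unfolding gen_emb[OF ra(1)] word_Cons[of z a]
      using ra(1) by (simp add: A.m_assoc word_closed emb_closed act_closed)
    finally have "cls (x # u) = emb D (act D (wdeg [z]) r) \<otimes>\<^bsub>A\<^esub> word D (z # a)" .
    moreover have "wdeg (z # a) = deg (x # u)"
      using ra(2) Gen by (simp add: wdeg_Cons[of z a] deg_def letter_deg_Gen)
    ultimately show ?thesis using act_closed[OF ra(1)] by blast
  qed
qed

text \<open>The component of degree \<open>g\<close> is spanned over \<open>R\<close> by the words of degree \<open>g\<close>.\<close>

lemma comp_induct:
  assumes x: "x \<in> comp D g" and zero: "P \<zero>\<^bsub>A\<^esub>"
    and add: "\<And>r a y. r \<in> carrier R \<Longrightarrow> wdeg a = g \<Longrightarrow> y \<in> carrier A \<Longrightarrow> P y \<Longrightarrow>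
      P (emb D r \<otimes>\<^bsub>A\<^esub> word D a \<oplus>\<^bsub>A\<^esub> y)"
  shows "P x"
proof -
  obtain p where p: "p \<in> free_comp g" "x = rel_ideal D +>\<^bsub>F\<^esub> p"
    using x by (auto simp: comp_eq)
  have "P (rel_ideal D +>\<^bsub>F\<^esub> p)"
  proof (rule free_alg_induct[of p "{w. deg w = g}"])
    show "p \<in> carrier F" using p(1) by (rule free_compD(1))
    show "w \<in> {w. deg w = g}" if "p w \<noteq> \<zero>\<^bsub>K\<^esub>" for w using that free_compD(2)[OF p(1), of w] by blast
    show "P (rel_ideal D +>\<^bsub>F\<^esub> \<zero>\<^bsub>F\<^esub>)" using zero by (simp add: coset_hom(5))
    fix c u q
    assume c: "c \<in> carrier K" and u: "u \<in> lists symbols" "u \<in> {w. deg w = g}"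
      and q: "q \<in> carrier F" "P (rel_ideal D +>\<^bsub>F\<^esub> q)"
    obtain r a where ra: "r \<in> carrier R" "wdeg a = g" "cls u = emb D r \<otimes>\<^bsub>A\<^esub> word D a"
      using cls_normal[OF u(1)] u(2) by auto
    have cR: "scal c \<in> carrier R" using c by (simp add: R_smult_closed)
    have "rel_ideal D +>\<^bsub>F\<^esub> (c \<odot>\<^bsub>F\<^esub> monomial D u) = emb D (scal c \<otimes>\<^bsub>R\<^esub> r) \<otimes>\<^bsub>A\<^esub> word D a"
      using c cR u ra
      by (simp add: coset_smult monomial_closed emb_mult A.m_assoc emb_closed word_closed)
    then show "P (rel_ideal D +>\<^bsub>F\<^esub> (c \<odot>\<^bsub>F\<^esub> monomial D u \<oplus>\<^bsub>F\<^esub> q))"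
      using add[OF R.m_closed[OF cR ra(1)] ra(2) coset_hom(1)[OF q(1)] q(2)]
        coset_hom(2)[OF free_alg_smult[OF c monomial_closed[OF u(1)]] q(1)] by simp
  qed
  then show ?thesis using p by simp
qed

lemma comp_carrier: "x \<in> comp D g \<Longrightarrow> x \<in> carrier A"
  by (rule A.component_carrier[OF UNIV_I])

lemma comp_emb:
  assumes x: "x \<in> comp D g" and r: "r \<in> carrier R"
  shows "x \<otimes>\<^bsub>A\<^esub> emb D r = emb D (act D g r) \<otimes>\<^bsub>A\<^esub> x"
  using x
proof (rule comp_induct)
  show "\<zero>\<^bsub>A\<^esub> \<otimes>\<^bsub>A\<^esub> emb D r = emb D (act D g r) \<otimes>\<^bsub>A\<^esub> \<zero>\<^bsub>A\<^esub>"
    using r by (simp add: emb_closed act_closed)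
next
  fix s a y assume s: "s \<in> carrier R" and a: "wdeg a = g" and y: "y \<in> carrier A"
    and IH: "y \<otimes>\<^bsub>A\<^esub> emb D r = emb D (act D g r) \<otimes>\<^bsub>A\<^esub> y"
  have gr: "act D g r \<in> carrier R" using r by (rule act_closed)
  have "emb D s \<otimes>\<^bsub>A\<^esub> word D a \<otimes>\<^bsub>A\<^esub> emb D r = emb D s \<otimes>\<^bsub>A\<^esub> (emb D (act D g r) \<otimes>\<^bsub>A\<^esub> word D a)"
    using s r a word_emb[OF r, of a] by (simp add: A.m_assoc emb_closed word_closed)
  also have "\<dots> = emb D (s \<otimes>\<^bsub>R\<^esub> act D g r) \<otimes>\<^bsub>A\<^esub> word D a"
    using s gr by (simp add: A.m_assoc emb_closed word_closed emb_mult)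
  also have "\<dots> = emb D (act D g r) \<otimes>\<^bsub>A\<^esub> (emb D s \<otimes>\<^bsub>A\<^esub> word D a)"
    using s gr R.m_comm[OF s gr] by (simp add: A.m_assoc emb_closed word_closed emb_mult)
  finally show "(emb D s \<otimes>\<^bsub>A\<^esub> word D a \<oplus>\<^bsub>A\<^esub> y) \<otimes>\<^bsub>A\<^esub> emb D r =
      emb D (act D g r) \<otimes>\<^bsub>A\<^esub> (emb D s \<otimes>\<^bsub>A\<^esub> word D a \<oplus>\<^bsub>A\<^esub> y)"
    using IH s r gr y by (simp add: A.l_distr A.r_distr emb_closed word_closed)
qed

section \<open>The component of degree zero\<close>

text \<open>
  A word of degree zero lies in \<open>R\<close>.  Up to a coefficient, an \<open>X\<close> and a \<open>Y\<close> of different index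
  commute, and an \<open>X\<close> and a \<open>Y\<close> of the same index cancel when they meet.  So every word can be
  sorted into letters \<open>Y\<close> followed by letters \<open>X\<close>, and in degree zero these cancel completely.  No two
  letters \<open>X\<close> are ever exchanged, since there is no relation between them.  The predicate says of
  which kind a letter is.
\<close>

definition is_X :: "'n gen \<Rightarrow> bool" where
  "is_X z \<longleftrightarrow> z \<in> range X"

lemma is_X_simps: "is_X (X i)" "\<not> is_X (Y i)"
  by (auto simp: is_X_def)

lemma scal_closed: "c \<in> carrier K \<Longrightarrow> scal c \<in> carrier R"
  by (simp add: R_smult_closed)

lemma X_Y_swap:
  assumes "i \<noteq> j"
  shows "word D [X i, Y j] = emb D (scal (tgw_mu D i j)) \<otimes>\<^bsub>A\<^esub> word D [Y j, X i]"
proof -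
  have "cls [Gen (X i), Gen (Y j)] =
      rel_ideal D +>\<^bsub>F\<^esub> (tgw_mu D i j \<odot>\<^bsub>F\<^esub> monomial D [Gen (Y j), Gen (X i)])"
    by (intro relator_eq relators_mem monomial_closed' free_alg_smult mu_closed assms)
  then show ?thesis
    using coset_smult[OF mu_closed, of "monomial D [Gen (Y j), Gen (X i)]" i j]
    by (simp add: word_def monomial_closed')
qed

lemma Y_X_swap:
  assumes "i \<noteq> j"
  shows "word D [Y j, X i] = emb D (scal (inv\<^bsub>K\<^esub> (tgw_mu D i j))) \<otimes>\<^bsub>A\<^esub> word D [X i, Y j]"
proof -
  let ?c = "tgw_mu D i j"
  have c: "?c \<in> Units K" using mu_closed mu_nonzero by (simp add: K.field_Units)
  then have ic: "inv\<^bsub>K\<^esub> ?c \<in> carrier K" by (rule K.Units_inv_closed)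
  have "scal (inv\<^bsub>K\<^esub> ?c) \<otimes>\<^bsub>R\<^esub> scal ?c = inv\<^bsub>K\<^esub> ?c \<odot>\<^bsub>R\<^esub> (?c \<odot>\<^bsub>R\<^esub> \<one>\<^bsub>R\<^esub>)"
    by (rule R_smult_eq[OF ic scal_closed[OF mu_closed], symmetric])
  also have "\<dots> = (inv\<^bsub>K\<^esub> ?c \<otimes>\<^bsub>K\<^esub> ?c) \<odot>\<^bsub>R\<^esub> \<one>\<^bsub>R\<^esub>"
    by (rule module.smult_assoc1[OF algebra.axioms(1)[OF algebra_R] ic mu_closed R.one_closed, symmetric])
  also have "\<dots> = \<one>\<^bsub>R\<^esub>"
    using K.Units_l_inv[OF c] module.smult_one[OF algebra.axioms(1)[OF algebra_R] R.one_closed] by simp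
  finally have "emb D (scal (inv\<^bsub>K\<^esub> ?c)) \<otimes>\<^bsub>A\<^esub> emb D (scal ?c) = \<one>\<^bsub>A\<^esub>"
    using emb_mult[OF scal_closed[OF ic] scal_closed[OF mu_closed], of i j] by (simp add: emb_one)
  then show ?thesis
    unfolding X_Y_swap[OF assms]
    using emb_closed[OF scal_closed[OF ic]] emb_closed[OF scal_closed[OF mu_closed]]
    by (simp add: A.m_assoc[symmetric] word_closed)
qed

lemma opposite_swap:
  assumes "is_X z \<noteq> is_X u" "u \<noteq> gen_star z"
  shows "\<exists>r\<in>carrier R. word D [z, u] = emb D r \<otimes>\<^bsub>A\<^esub> word D [u, z]"
proof (cases z)
  case (X i)
  then obtain j where u: "u = Y j" using assms(1) by (cases u) (auto simp: is_X_simps)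
  then show ?thesis using X_Y_swap[of i j] assms(2) X scal_closed[OF mu_closed] by auto
next
  case (Y j)
  then obtain i where u: "u = X i" using assms(1) by (cases u) (auto simp: is_X_simps)
  then have ij: "i \<noteq> j" using assms(2) Y by auto
  have "inv\<^bsub>K\<^esub> (tgw_mu D i j) \<in> carrier K"
    using mu_closed mu_nonzero by (intro K.Units_inv_closed) (simp add: K.field_Units)
  then show ?thesis using Y_X_swap[OF ij] Y u scal_closed by blast
qed

lemma star_cancel: "\<exists>r\<in>carrier R. word D [z, gen_star z] = emb D r"
proof (cases z)
  case (X i)
  have "cls [Gen (X i), Gen (Y i)] = cls [Coef (\<sigma> i (tgw_t D i))]"
    by (intro relator_eq relators_mem monomial_closed' sigma_closed t_closed)
  then show ?thesis
    using X sigma_closed[OF t_closed] by (intro bexI[of _ "\<sigma> i (tgw_t D i)"]) (simp_all add: word_def emb_def)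
next
  case (Y i)
  have "cls [Gen (Y i), Gen (X i)] = cls [Coef (tgw_t D i)]"
    by (intro relator_eq relators_mem monomial_closed' t_closed)
  then show ?thesis
    using Y t_closed by (intro bexI[of _ "tgw_t D i"]) (simp_all add: word_def emb_def)
qed

lemma wdeg_star_cancel: "wdeg [z] + wdeg [gen_star z] = 0"
  by (cases z) (simp_all add: wdeg_simps)

text \<open>
  A letter in front of letters of the other kind moves to the right, until it cancels with its
  partner or reaches the end.
\<close>

lemma move_right:
  assumes "\<And>u. u \<in> set us \<Longrightarrow> is_X z \<noteq> is_X u"
  shows "\<exists>r\<in>carrier R. \<exists>b. word D (z # us) = emb D r \<otimes>\<^bsub>A\<^esub> word D b \<and> wdeg b = wdeg (z # us) \<and>
    b = (if gen_star z \<in> set us then remove1 (gen_star z) us else us @ [z])"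
  using assms
proof (induction us)
  case Nil
  show ?case
    by (rule bexI[of _ "\<one>\<^bsub>R\<^esub>"]) (simp_all add: emb_one word_closed)
next
  case (Cons u us)
  have split: "word D (z # u # us) = word D [z, u] \<otimes>\<^bsub>A\<^esub> word D us"
    using word_append[of "[z, u]" us] by simp
  show ?case
  proof (cases "u = gen_star z")
    case True
    obtain r where "r \<in> carrier R" "word D [z, u] = emb D r" using star_cancel True by blast
    moreover have "wdeg us = wdeg (z # u # us)"
      unfolding True wdeg_Cons[of z "gen_star z # us"] wdeg_Cons[of "gen_star z" us]
      by (simp only: add.assoc[symmetric] wdeg_star_cancel) simp
    ultimately show ?thesis using split True by auto
  next
    case False
    obtain c where c: "c \<in> carrier R" "word D [z, u] = emb D c \<otimes>\<^bsub>A\<^esub> word D [u, z]"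
      using opposite_swap[of z u] Cons.prems False by auto
    obtain r b where b: "r \<in> carrier R" "word D (z # us) = emb D r \<otimes>\<^bsub>A\<^esub> word D b"
        "wdeg b = wdeg (z # us)"
        "b = (if gen_star z \<in> set us then remove1 (gen_star z) us else us @ [z])"
      using Cons by auto
    let ?r = "act D (wdeg [u]) r"
    have ur: "?r \<in> carrier R" using b(1) by (rule act_closed)
    have "word D (z # u # us) = emb D c \<otimes>\<^bsub>A\<^esub> (word D [u, z] \<otimes>\<^bsub>A\<^esub> word D us)"
      using c by (simp add: split A.m_assoc emb_closed word_closed)
    also have "word D [u, z] \<otimes>\<^bsub>A\<^esub> word D us = word D [u] \<otimes>\<^bsub>A\<^esub> word D (z # us)"
      using word_append[of "[u, z]" us] word_append[of "[u]" "z # us"] by simp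
    also have "\<dots> = (word D [u] \<otimes>\<^bsub>A\<^esub> emb D r) \<otimes>\<^bsub>A\<^esub> word D b"
      using b(1,2) by (simp add: A.m_assoc emb_closed word_closed)
    also have "\<dots> = emb D ?r \<otimes>\<^bsub>A\<^esub> word D (u # b)"
      unfolding gen_emb[OF b(1)] word_Cons[of u b] using ur by (simp add: A.m_assoc emb_closed word_closed)
    finally have "word D (z # u # us) = emb D (c \<otimes>\<^bsub>R\<^esub> ?r) \<otimes>\<^bsub>A\<^esub> word D (u # b)"
      using c(1) ur by (simp add: A.m_assoc emb_closed word_closed emb_mult)
    moreover have "wdeg (u # b) = wdeg (z # u # us)"
      using b(3) by (simp add: wdeg_Cons[of u b] wdeg_Cons[of z "u # us"] wdeg_Cons[of u us] wdeg_Cons[of z us])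
    moreover have "u # b = (if gen_star z \<in> set (u # us) then remove1 (gen_star z) (u # us) else (u # us) @ [z])"
      using False b(4) by auto
    ultimately show ?thesis using c(1) ur by blast
  qed
qed

lemma word_sorted:
  "\<exists>r\<in>carrier R. \<exists>ys xs. set ys \<subseteq> range Y \<and> set xs \<subseteq> range X \<and>
    word D a = emb D r \<otimes>\<^bsub>A\<^esub> word D (ys @ xs) \<and> wdeg (ys @ xs) = wdeg a"
proof (induction a)
  case Nil
  show ?case
    by (intro bexI[of _ "\<one>\<^bsub>R\<^esub>"] exI[of _ "[]"]) (simp_all add: emb_one word_closed)
next
  case (Cons z a)
  then obtain r ys xs where IH: "r \<in> carrier R" "set ys \<subseteq> range Y" "set xs \<subseteq> range X"
      "word D a = emb D r \<otimes>\<^bsub>A\<^esub> word D (ys @ xs)" "wdeg (ys @ xs) = wdeg a"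
    by blast
  let ?r = "act D (wdeg [z]) r"
  have zr: "?r \<in> carrier R" using IH(1) by (rule act_closed)
  have "word D (z # a) = (word D [z] \<otimes>\<^bsub>A\<^esub> emb D r) \<otimes>\<^bsub>A\<^esub> word D (ys @ xs)"
    using IH(1,4) by (simp add: word_Cons[of z a] A.m_assoc emb_closed word_closed)
  also have "\<dots> = emb D ?r \<otimes>\<^bsub>A\<^esub> word D (z # ys @ xs)"
    unfolding gen_emb[OF IH(1)] word_Cons[of z "ys @ xs"]
    using zr by (simp add: A.m_assoc emb_closed word_closed)
  finally have za: "word D (z # a) = emb D ?r \<otimes>\<^bsub>A\<^esub> word D (z # ys @ xs)" .
  have deg_za: "wdeg (z # ys @ xs) = wdeg (z # a)"
    using IH(5) by (simp add: wdeg_Cons[of z a] wdeg_Cons[of z "ys @ xs"])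
  show ?case
  proof (cases "is_X z")
    case False
    then have "set (z # ys) \<subseteq> range Y" using IH(2) by (cases z) (auto simp: is_X_simps)
    then show ?thesis
      using zr IH(3) za deg_za by (intro bexI[of _ ?r] exI[of _ "z # ys"] exI[of _ xs]) simp_all
  next
    case True
    have "is_X z \<noteq> is_X u" if "u \<in> set ys" for u
      using True that IH(2) by (auto simp: is_X_simps)
    then obtain c b where c: "c \<in> carrier R" "word D (z # ys) = emb D c \<otimes>\<^bsub>A\<^esub> word D b"
        "wdeg b = wdeg (z # ys)"
        "b = (if gen_star z \<in> set ys then remove1 (gen_star z) ys else ys @ [z])"
      using move_right[of ys z] by blast
    have "word D (z # a) = emb D ?r \<otimes>\<^bsub>A\<^esub> (emb D c \<otimes>\<^bsub>A\<^esub> word D b \<otimes>\<^bsub>A\<^esub> word D xs)"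
      using za word_append[of "z # ys" xs] c(2) by simp
    also have "\<dots> = emb D (?r \<otimes>\<^bsub>R\<^esub> c) \<otimes>\<^bsub>A\<^esub> word D (b @ xs)"
      using zr c(1) by (simp add: word_append A.m_assoc emb_closed word_closed emb_mult)
    finally have w: "word D (z # a) = emb D (?r \<otimes>\<^bsub>R\<^esub> c) \<otimes>\<^bsub>A\<^esub> word D (b @ xs)" .
    have d: "wdeg (b @ xs) = wdeg (z # a)"
      using c(3) deg_za wdeg_simps(4)[of b xs] wdeg_simps(4)[of "z # ys" xs] by simp
    have rc: "?r \<otimes>\<^bsub>R\<^esub> c \<in> carrier R" using zr c(1) by simp
    show ?thesis
    proof (cases "gen_star z \<in> set ys")
      case True
      then have "set b \<subseteq> range Y" using c(4) IH(2) set_remove1_subset[of "gen_star z" ys] by auto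
      then show ?thesis using rc IH(3) w d by blast
    next
      case False
      then have "b @ xs = ys @ (z # xs)" using c(4) by simp
      moreover have "set (z # xs) \<subseteq> range X" using True IH(3) by (auto simp: is_X_def)
      ultimately show ?thesis using rc IH(2) w d by metis
    qed
  qed
qed

lemma wdeg_nth_X: "set xs \<subseteq> range X \<Longrightarrow> wdeg xs $ i = int (count_list xs (X i))"
proof (induction xs)
  case Nil
  show ?case by (simp add: wdeg_simps)
next
  case (Cons z xs)
  then obtain j where "z = X j" by auto
  then show ?case using Cons by (simp add: wdeg_Cons[of "X j" xs] wdeg_simps axis_def)
qed

lemma wdeg_nth_Y: "set ys \<subseteq> range Y \<Longrightarrow> wdeg ys $ i = - int (count_list ys (Y i))"
proof (induction ys)
  case Nil
  show ?case by (simp add: wdeg_simps)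
next
  case (Cons z ys)
  then obtain j where "z = Y j" by auto
  then show ?case using Cons by (simp add: wdeg_Cons[of "Y j" ys] wdeg_simps axis_def)
qed

lemma word_degree_zero_sorted:
  assumes "set ys \<subseteq> range Y" "set xs \<subseteq> range X" "wdeg (ys @ xs) = 0"
  shows "word D (ys @ xs) \<in> emb D ` carrier R"
  using assms
proof (induction ys arbitrary: xs rule: rev_induct)
  case Nil
  have "xs = []"
  proof (cases xs)
    case (Cons z zs)
    then obtain i where "z = X i" using Nil.prems(2) by auto
    then have "count_list xs (X i) \<noteq> 0" using Cons by simp
    then show ?thesis using wdeg_nth_X[OF Nil.prems(2), of i] Nil.prems(3) by simp
  qed
  then show ?case using emb_one[symmetric] by (auto simp: word_Nil)
next
  case (snoc z ys)
  then obtain i where z: "z = Y i" by auto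
  have "wdeg (ys @ [z]) $ i + wdeg xs $ i = 0"
    using snoc.prems(3) wdeg_simps(4)[of "ys @ [z]" xs] by (simp add: vec_eq_iff)
  then have "count_list xs (X i) \<noteq> 0"
    using wdeg_nth_Y[OF snoc.prems(1), of i] wdeg_nth_X[OF snoc.prems(2), of i] z by auto
  then have Xi: "gen_star z \<in> set xs" using z count_notin by fastforce
  have "is_X z \<noteq> is_X u" if "u \<in> set xs" for u
    using z that snoc.prems(2) by (auto simp: is_X_simps)
  then obtain r b where b: "r \<in> carrier R" "word D (z # xs) = emb D r \<otimes>\<^bsub>A\<^esub> word D b"
      "wdeg b = wdeg (z # xs)" "b = remove1 (gen_star z) xs"
    using move_right[of xs z] Xi by auto
  have "set b \<subseteq> range X" using b(4) snoc.prems(2) set_remove1_subset[of "gen_star z" xs] by auto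
  moreover have "wdeg (ys @ b) = 0"
    using b(3) snoc.prems(3) by (simp add: wdeg_simps(4) wdeg_Cons[of z xs] add.assoc)
  ultimately obtain s where s: "s \<in> carrier R" "word D (ys @ b) = emb D s"
    using snoc.IH[of b] snoc.prems(1) by auto
  let ?r = "act D (wdeg ys) r"
  have yr: "?r \<in> carrier R" using b(1) by (rule act_closed)
  have "word D ((ys @ [z]) @ xs) = word D ys \<otimes>\<^bsub>A\<^esub> emb D r \<otimes>\<^bsub>A\<^esub> word D b"
    using word_append[of ys "z # xs"] b(1,2) by (simp add: A.m_assoc emb_closed word_closed)
  also have "\<dots> = emb D ?r \<otimes>\<^bsub>A\<^esub> word D (ys @ b)"
    unfolding word_emb[OF b(1)] using yr by (simp add: word_append A.m_assoc emb_closed word_closed)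
  also have "\<dots> = emb D (?r \<otimes>\<^bsub>R\<^esub> s)" using yr s by (simp add: emb_mult)
  finally show ?case using yr s(1) by blast
qed

lemma comp_zero: "comp D 0 = emb D ` carrier R"
proof
  show "emb D ` carrier R \<subseteq> comp D 0" using emb_comp by blast
  show "comp D 0 \<subseteq> emb D ` carrier R"
  proof
    fix x assume "x \<in> comp D 0"
    then show "x \<in> emb D ` carrier R"
    proof (rule comp_induct)
      show "\<zero>\<^bsub>A\<^esub> \<in> emb D ` carrier R" using emb_zero[symmetric] by auto
      fix r y and a :: "'n gen list"
      assume r: "r \<in> carrier R" and a: "wdeg a = 0" and y: "y \<in> emb D ` carrier R"
      obtain c ys xs where c: "c \<in> carrier R" "set ys \<subseteq> range Y" "set xs \<subseteq> range X"
          "word D a = emb D c \<otimes>\<^bsub>A\<^esub> word D (ys @ xs)" "wdeg (ys @ xs) = wdeg a"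
        using word_sorted[of a] by blast
      obtain s where s: "s \<in> carrier R" "word D (ys @ xs) = emb D s"
        using word_degree_zero_sorted[OF c(2,3)] c(5) a by auto
      obtain y' where y': "y' \<in> carrier R" "y = emb D y'" using y by blast
      have "emb D r \<otimes>\<^bsub>A\<^esub> word D a \<oplus>\<^bsub>A\<^esub> y = emb D (r \<otimes>\<^bsub>R\<^esub> (c \<otimes>\<^bsub>R\<^esub> s) \<oplus>\<^bsub>R\<^esub> y')"
        using r c s y' by (simp add: emb_mult emb_add)
      then show "emb D r \<otimes>\<^bsub>A\<^esub> word D a \<oplus>\<^bsub>A\<^esub> y \<in> emb D ` carrier R"
        using r c(1) s(1) y'(1) by blast
    qed
  qed
qed

end

section \<open>Reduction modulo a maximal ideal\<close>

text \<open>
  The setting of the theorem.  \<open>S\<close> is the stabilizer \<open>\<int>\<^sup>n\<^sub>\<omega>\<close>, \<open>B\<close> is \<open>B(\<omega>)\<close>, and \<open>Q\<close> is its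
  quotient \<open>B\<^sub>\<mm>\<close>.
\<close>

locale tgw_maximal = tgw_algebra D
  for D :: "('k, 'r, 'n::{finite, linorder}) tgw_data" +
  fixes \<mm> :: "'r set"
  assumes emb_inj: "inj_on (emb D) (carrier (tgw_R D))"
    and maximal: "\<mm> \<in> max_spec D"
begin

abbreviation "S \<equiv> stab D \<mm>"
abbreviation "B \<equiv> Bomega D \<mm>"
abbreviation "Q \<equiv> Bm D \<mm>"

sublocale m: maximalideal \<mm> R
  using maximal by (simp add: max_spec_def)

lemma stab_act: "g \<in> S \<Longrightarrow> r \<in> \<mm> \<Longrightarrow> act D g r \<in> \<mm>"
  by (auto simp: stab_def)

lemma stab_zero: "0 \<in> S"
  using m.Icarr by (auto simp: stab_def act_zero)

lemma act_image_plus: "act D (g + h) ` \<mm> = act D g ` act D h ` \<mm>"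
  unfolding image_image using m.Icarr by (intro image_cong refl act_plus)

lemma stab_plus: "g \<in> S \<Longrightarrow> h \<in> S \<Longrightarrow> g + h \<in> S"
  by (simp add: stab_def act_image_plus)

lemma stab_uminus: "g \<in> S \<Longrightarrow> - g \<in> S"
  using act_image_plus[of "- g" g] stab_zero by (simp add: stab_def)

sublocale B: graded_ring B S "comp D"
  unfolding Bomega_def using stab_zero stab_plus by (intro A.restrict_degrees) auto

lemma B_simps:
  "carrier B = sum_of A S (comp D)"
  "mult B = mult A" "one B = one A" "add B = add A" "zero B = zero A" "smult B = smult A"
  by (simp_all add: Bomega_def)

lemma emb_B: "r \<in> carrier R \<Longrightarrow> emb D r \<in> carrier B"
  by (rule B.component_carrier[OF stab_zero emb_comp])

lemma B_smult:
  assumes "c \<in> carrier K" "x \<in> carrier B"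
  shows "c \<odot>\<^bsub>B\<^esub> x = emb D (scal c) \<otimes>\<^bsub>B\<^esub> x"
proof -
  have "x \<in> carrier A"
    using assms(2) A.subfamily[OF subset_UNIV] unfolding B_simps(1)
    by (rule subgroup_family.sum_of_carrier[rotated])
  then show ?thesis using A_smult[OF assms(1)] by (simp add: B_simps)
qed

lemmas comp_emb_B = comp_emb[folded B_simps(2)]

text \<open>The subgroup \<open>A\<^sub>g \<mm>\<close> of \<open>A\<^sub>g\<close>: finite sums of products \<open>x r\<close> with \<open>r\<close> in \<open>\<mm>\<close>.\<close>

definition m_comp :: "(int, 'n) vec \<Rightarrow> (('r, 'n) letter list \<Rightarrow> 'k) set set" where
  "m_comp g = sum_of B (comp D g) (\<lambda>x. {x \<otimes>\<^bsub>B\<^esub> emb D r | r. r \<in> \<mm>})"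

lemma comp_B: "g \<in> S \<Longrightarrow> x \<in> comp D g \<Longrightarrow> x \<in> carrier B"
  by (rule B.component_carrier)

lemma m_comp_family:
  assumes g: "g \<in> S"
  shows "subgroup_family B (comp D g) (\<lambda>x. {x \<otimes>\<^bsub>B\<^esub> emb D r | r. r \<in> \<mm>})"
proof (rule subgroup_familyI[OF B.abelian_group_axioms], rule additive_subgroupI, rule subgroup.intro)
  fix x assume "x \<in> comp D g"
  with g have x: "x \<in> carrier B" by (rule comp_B)
  let ?C = "{x \<otimes>\<^bsub>B\<^esub> emb D r | r. r \<in> \<mm>}"
  show "?C \<subseteq> carrier (add_monoid B)" using x emb_B m.Icarr by auto
  show "\<one>\<^bsub>add_monoid B\<^esub> \<in> ?C"
    using emb_zero m.zero_closed B.r_null[OF x]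
    by (intro CollectI exI[of _ "\<zero>\<^bsub>R\<^esub>"]) (simp add: B_simps)
  show "y \<otimes>\<^bsub>add_monoid B\<^esub> z \<in> ?C" if "y \<in> ?C" "z \<in> ?C" for y z
  proof -
    from that obtain r s where rs: "r \<in> \<mm>" "y = x \<otimes>\<^bsub>B\<^esub> emb D r" "s \<in> \<mm>" "z = x \<otimes>\<^bsub>B\<^esub> emb D s" by blast
    note rs' = m.Icarr[OF rs(1)] m.Icarr[OF rs(3)]
    have "y \<oplus>\<^bsub>B\<^esub> z = x \<otimes>\<^bsub>B\<^esub> emb D (r \<oplus>\<^bsub>R\<^esub> s)"
      using B.r_distr[OF emb_B[OF rs'(1)] emb_B[OF rs'(2)] x] rs rs' by (simp add: emb_add B_simps)
    then show ?thesis using m.a_closed[OF rs(1,3)] by auto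
  qed
  show "inv\<^bsub>add_monoid B\<^esub> y \<in> ?C" if "y \<in> ?C" for y
  proof -
    from that obtain r where r: "r \<in> \<mm>" "y = x \<otimes>\<^bsub>B\<^esub> emb D r" by blast
    note r' = m.Icarr[OF r(1)] R.a_inv_closed[OF m.Icarr[OF r(1)]]
    have "x \<otimes>\<^bsub>B\<^esub> emb D (\<ominus>\<^bsub>R\<^esub> r) \<oplus>\<^bsub>B\<^esub> y = x \<otimes>\<^bsub>B\<^esub> emb D (\<ominus>\<^bsub>R\<^esub> r \<oplus>\<^bsub>R\<^esub> r)"
      using B.r_distr[OF emb_B[OF r'(2)] emb_B[OF r'(1)] x] r r' by (simp add: emb_add B_simps)
    also have "\<dots> = \<zero>\<^bsub>B\<^esub>"
      using B.r_null[OF x] by (simp add: R.l_neg[OF r'(1)] emb_zero B_simps)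
    finally have "\<ominus>\<^bsub>B\<^esub> y = x \<otimes>\<^bsub>B\<^esub> emb D (\<ominus>\<^bsub>R\<^esub> r)"
      using x emb_B[OF r'(1)] emb_B[OF r'(2)] r(2) by (intro B.minus_equality) simp_all
    then show ?thesis using m.a_inv_closed[OF r(1)] by (auto simp: a_inv_def)
  qed
qed

lemma m_comp_subgroup: "g \<in> S \<Longrightarrow> additive_subgroup (m_comp g) B"
  unfolding m_comp_def by (rule subgroup_family.sum_of_subgroup[OF m_comp_family])

lemma m_comp_induct:
  assumes "g \<in> S" "x \<in> m_comp g" "P \<zero>\<^bsub>B\<^esub>"
    and "\<And>y r z. y \<in> comp D g \<Longrightarrow> r \<in> \<mm> \<Longrightarrow> z \<in> carrier B \<Longrightarrow> P z \<Longrightarrow> P (y \<otimes>\<^bsub>B\<^esub> emb D r \<oplus>\<^bsub>B\<^esub> z)"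
  shows "P x"
proof -
  interpret M: subgroup_family B "comp D g" "\<lambda>x. {x \<otimes>\<^bsub>B\<^esub> emb D r | r. r \<in> \<mm>}"
    using assms(1) by (rule m_comp_family)
  show ?thesis
    using assms(2,3) unfolding m_comp_def
    by (rule M.sum_of_closed_induct) (use assms(4) M.sum_of_carrier in blast)
qed

lemma m_compI:
  assumes g: "g \<in> S" and y: "y \<in> comp D g" and r: "r \<in> \<mm>" and z: "z \<in> m_comp g"
  shows "y \<otimes>\<^bsub>B\<^esub> emb D r \<oplus>\<^bsub>B\<^esub> z \<in> m_comp g"
  unfolding m_comp_def
  by (rule subgroup_family.sum_of_add_component[OF m_comp_family[OF g] y _ z[unfolded m_comp_def]])
    (use r in blast)

lemma m_comp_zero: "g \<in> S \<Longrightarrow> \<zero>\<^bsub>B\<^esub> \<in> m_comp g"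
  by (rule additive_subgroup.zero_closed[OF m_comp_subgroup])

lemma m_comp_subset:
  assumes g: "g \<in> S"
  shows "m_comp g \<subseteq> comp D g"
proof
  fix x assume "x \<in> m_comp g"
  with g show "x \<in> comp D g"
  proof (rule m_comp_induct)
    show "\<zero>\<^bsub>B\<^esub> \<in> comp D g" using g by (rule B.component_zero)
    fix y r z assume y: "y \<in> comp D g" and r: "r \<in> \<mm>" and z: "z \<in> comp D g"
    have "y \<otimes>\<^bsub>B\<^esub> emb D r \<in> comp D g"
      using B.mult_component[OF g stab_zero y emb_comp[OF m.Icarr[OF r]]] by simp
    then show "y \<otimes>\<^bsub>B\<^esub> emb D r \<oplus>\<^bsub>B\<^esub> z \<in> comp D g" using z by (rule B.component_add[OF g])
  qed
qed

lemma m_comp_mult_l: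
  assumes g: "g \<in> S" and h: "h \<in> S" and x: "x \<in> comp D h" and y: "y \<in> m_comp g"
  shows "x \<otimes>\<^bsub>B\<^esub> y \<in> m_comp (h + g)"
  using g y
proof (rule m_comp_induct)
  note hg = stab_plus[OF h g] and xB = comp_B[OF h x]
  show "x \<otimes>\<^bsub>B\<^esub> \<zero>\<^bsub>B\<^esub> \<in> m_comp (h + g)" using m_comp_zero[OF hg] xB by simp
  fix y r z assume y: "y \<in> comp D g" and r: "r \<in> \<mm>" and z: "z \<in> carrier B"
    and IH: "x \<otimes>\<^bsub>B\<^esub> z \<in> m_comp (h + g)"
  have "x \<otimes>\<^bsub>B\<^esub> (y \<otimes>\<^bsub>B\<^esub> emb D r \<oplus>\<^bsub>B\<^esub> z) = (x \<otimes>\<^bsub>B\<^esub> y) \<otimes>\<^bsub>B\<^esub> emb D r \<oplus>\<^bsub>B\<^esub> x \<otimes>\<^bsub>B\<^esub> z"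
    using xB comp_B[OF g y] emb_B[OF m.Icarr[OF r]] z by (simp add: B.r_distr B.m_assoc)
  then show "x \<otimes>\<^bsub>B\<^esub> (y \<otimes>\<^bsub>B\<^esub> emb D r \<oplus>\<^bsub>B\<^esub> z) \<in> m_comp (h + g)"
    using m_compI[OF hg B.mult_component[OF h g x y] r IH] by simp
qed

text \<open>
  Here it matters that \<open>h\<close> stabilizes \<open>\<mm>\<close>: in \<open>y r x\<close> the coefficient \<open>r\<close> moves past \<open>x\<close>
  of degree \<open>h\<close> and becomes the translate of \<open>r\<close> by \<open>- h\<close>.
\<close>

lemma m_comp_mult_r:
  assumes g: "g \<in> S" and h: "h \<in> S" and x: "x \<in> comp D h" and y: "y \<in> m_comp g"
  shows "y \<otimes>\<^bsub>B\<^esub> x \<in> m_comp (g + h)"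
  using g y
proof (rule m_comp_induct)
  note gh = stab_plus[OF g h] and xB = comp_B[OF h x]
  show "\<zero>\<^bsub>B\<^esub> \<otimes>\<^bsub>B\<^esub> x \<in> m_comp (g + h)" using m_comp_zero[OF gh] xB by simp
  fix y r z assume y: "y \<in> comp D g" and r: "r \<in> \<mm>" and z: "z \<in> carrier B"
    and IH: "z \<otimes>\<^bsub>B\<^esub> x \<in> m_comp (g + h)"
  let ?r = "act D (- h) r"
  have r': "?r \<in> \<mm>" using stab_uminus[OF h] r by (rule stab_act)
  have "act D h ?r = r" using act_uminus[OF m.Icarr[OF r], of "- h"] by simp
  then have *: "x \<otimes>\<^bsub>B\<^esub> emb D ?r = emb D r \<otimes>\<^bsub>B\<^esub> x"
    using comp_emb_B[OF x m.Icarr[OF r']] by simp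
  have "(y \<otimes>\<^bsub>B\<^esub> emb D r \<oplus>\<^bsub>B\<^esub> z) \<otimes>\<^bsub>B\<^esub> x = y \<otimes>\<^bsub>B\<^esub> (emb D r \<otimes>\<^bsub>B\<^esub> x) \<oplus>\<^bsub>B\<^esub> z \<otimes>\<^bsub>B\<^esub> x"
    using xB comp_B[OF g y] emb_B[OF m.Icarr[OF r]] z by (simp add: B.l_distr B.m_assoc)
  also have "\<dots> = (y \<otimes>\<^bsub>B\<^esub> x) \<otimes>\<^bsub>B\<^esub> emb D ?r \<oplus>\<^bsub>B\<^esub> z \<otimes>\<^bsub>B\<^esub> x"
    using xB comp_B[OF g y] emb_B[OF m.Icarr[OF r']] by (simp add: *[symmetric] B.m_assoc)
  finally show "(y \<otimes>\<^bsub>B\<^esub> emb D r \<oplus>\<^bsub>B\<^esub> z) \<otimes>\<^bsub>B\<^esub> x \<in> m_comp (g + h)"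
    using m_compI[OF gh B.mult_component[OF g h y x] r' IH] by simp
qed

lemma m_comp_degree_zero:
  assumes "x \<in> m_comp 0"
  shows "x \<in> emb D ` \<mm>"
  using stab_zero assms
proof (rule m_comp_induct)
  show "\<zero>\<^bsub>B\<^esub> \<in> emb D ` \<mm>" using emb_zero m.zero_closed by (auto simp: B_simps)
  fix y r z assume y: "y \<in> comp D 0" and r: "r \<in> \<mm>" and z: "z \<in> emb D ` \<mm>"
  obtain s where s: "s \<in> carrier R" "y = emb D s" using y comp_zero by auto
  obtain z' where z': "z' \<in> \<mm>" "z = emb D z'" using z by auto
  have "y \<otimes>\<^bsub>B\<^esub> emb D r \<oplus>\<^bsub>B\<^esub> z = emb D (s \<otimes>\<^bsub>R\<^esub> r \<oplus>\<^bsub>R\<^esub> z')"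
    using s r z' m.Icarr by (simp add: emb_add emb_mult B_simps)
  then show "y \<otimes>\<^bsub>B\<^esub> emb D r \<oplus>\<^bsub>B\<^esub> z \<in> emb D ` \<mm>"
    using m.a_closed[OF m.I_l_closed[OF r s(1)] z'(1)] by auto
qed

text \<open>The ideal \<open>(\<mm>)\<close> of \<open>B(\<omega>)\<close> is the sum of the \<open>A\<^sub>g \<mm>\<close>, because \<open>\<int>\<^sup>n\<^sub>\<omega>\<close> stabilizes \<open>\<mm>\<close>.\<close>

lemma m_sum_ideal: "ideal (sum_of B S m_comp) B"
  using m_comp_subgroup m_comp_mult_l m_comp_mult_r by (rule B.graded_ideal)

lemma m_ideal_eq: "m_ideal D \<mm> = sum_of B S m_comp"
proof
  have sub: "emb D ` \<mm> \<subseteq> carrier B" using emb_B m.Icarr by blast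
  interpret M: subgroup_family B S m_comp
    using B.abelian_group_axioms m_comp_subgroup by (rule subgroup_familyI)
  interpret I: ideal "m_ideal D \<mm>" B
    unfolding m_ideal_def using sub by (rule B.genideal_ideal)
  have emb_I: "emb D r \<in> m_ideal D \<mm>" if "r \<in> \<mm>" for r
    unfolding m_ideal_def using B.genideal_self[OF sub] that by blast
  have comp_I: "x \<in> m_ideal D \<mm>" if "g \<in> S" "x \<in> m_comp g" for g x
    using that
  proof (rule m_comp_induct)
    show "\<zero>\<^bsub>B\<^esub> \<in> m_ideal D \<mm>" by (rule I.zero_closed)
    fix y r z assume "y \<in> comp D g" "r \<in> \<mm>" "z \<in> m_ideal D \<mm>"
    then show "y \<otimes>\<^bsub>B\<^esub> emb D r \<oplus>\<^bsub>B\<^esub> z \<in> m_ideal D \<mm>"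
      using comp_B[OF \<open>g \<in> S\<close>] emb_I by (intro I.a_closed I.I_l_closed) auto
  qed
  have "x \<in> m_ideal D \<mm>" if "x \<in> sum_of B S m_comp" for x
    using that
  proof (rule M.sum_of_closed_induct)
    show "\<zero>\<^bsub>B\<^esub> \<in> m_ideal D \<mm>" by (rule I.zero_closed)
  qed (rule I.a_closed[OF comp_I])
  then show "sum_of B S m_comp \<subseteq> m_ideal D \<mm>" by blast
  have "emb D r \<in> sum_of B S m_comp" if "r \<in> \<mm>" for r
  proof -
    have "\<one>\<^bsub>B\<^esub> \<otimes>\<^bsub>B\<^esub> emb D r \<oplus>\<^bsub>B\<^esub> \<zero>\<^bsub>B\<^esub> \<in> m_comp 0"
      by (rule m_compI[OF stab_zero B.one_component that m_comp_zero[OF stab_zero]])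
    then show ?thesis using emb_B[OF m.Icarr[OF that]] M.component_sum_of[OF stab_zero] by simp
  qed
  then show "m_ideal D \<mm> \<subseteq> sum_of B S m_comp"
    unfolding m_ideal_def by (intro B.genideal_minimal m_sum_ideal) blast
qed

sublocale mB: ideal "m_ideal D \<mm>" B
  unfolding m_ideal_eq by (rule m_sum_ideal)

text \<open>The component of degree \<open>g\<close> of \<open>B\<^sub>\<mm>\<close>.\<close>

abbreviation Qc :: "(int, 'n) vec \<Rightarrow> (('r, 'n) letter list \<Rightarrow> 'k) set set set" where
  "Qc g \<equiv> phi D \<mm> ` comp D g"

lemma phi_eq: "phi D \<mm> = (+>\<^bsub>B\<^esub>) (m_ideal D \<mm>)"
  by (rule ext) (simp add: phi_def)

sublocale Q: graded_ring Q S Qc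
proof -
  have "graded_ring (quot_alg B (sum_of B S m_comp)) S
      (\<lambda>g. (+>\<^bsub>B\<^esub>) (sum_of B S m_comp) ` comp D g)"
    using m_comp_subgroup m_comp_subset m_sum_ideal by (rule B.graded_quotient)
  then show "graded_ring Q S Qc" by (simp only: phi_eq m_ideal_eq Bm_def)
qed

lemmas phi_hom = mB.coset_hom[folded quot_alg_simps, folded Bm_def phi_def]

lemma Q_cases:
  assumes "z \<in> carrier Q"
  obtains x where "x \<in> carrier B" "z = phi D \<mm> x"
  using mB.coset_cases[of z] assms by (auto simp: Bm_def quot_alg_simps phi_def)

lemma phi_zero_iff: "x \<in> carrier B \<Longrightarrow> phi D \<mm> x = \<zero>\<^bsub>Q\<^esub> \<longleftrightarrow> x \<in> m_ideal D \<mm>"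
  using mB.coset_zero_iff by (simp add: phi_def Bm_def quot_alg_simps)

text \<open>Hence \<open>(\<mm>)\<close> meets \<open>R\<close> in \<open>\<mm>\<close>, and \<open>R\<^sub>\<mm>\<close> is embedded in \<open>B\<^sub>\<mm>\<close>.\<close>

lemma phi_emb_zero_iff:
  assumes r: "r \<in> carrier R"
  shows "phi D \<mm> (emb D r) = \<zero>\<^bsub>Q\<^esub> \<longleftrightarrow> r \<in> \<mm>"
proof
  assume "phi D \<mm> (emb D r) = \<zero>\<^bsub>Q\<^esub>"
  then have "emb D r \<in> sum_of B S m_comp"
    using phi_zero_iff[OF emb_B[OF r]] by (simp add: m_ideal_eq)
  then have "finsum B (\<lambda>_. emb D r) {0} \<in> sum_of B S m_comp"
    using emb_B[OF r] by simp
  then have "emb D r \<in> m_comp 0"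
    using B.homogeneous_in_sum_of[of m_comp "{0}" "\<lambda>_. emb D r" 0]
      m_comp_subgroup m_comp_subset stab_zero emb_comp[OF r] by simp
  then obtain r' where "r' \<in> \<mm>" "emb D r = emb D r'"
    using m_comp_degree_zero by blast
  then show "r \<in> \<mm>" using emb_inj r m.Icarr by (auto dest: inj_onD)
next
  assume "r \<in> \<mm>"
  then have "emb D r \<in> m_ideal D \<mm>"
    unfolding m_ideal_def using B.genideal_self[of "emb D ` \<mm>"] emb_B m.Icarr by blast
  then show "phi D \<mm> (emb D r) = \<zero>\<^bsub>Q\<^esub>" using phi_zero_iff[OF emb_B[OF r]] by simp
qed

text \<open>The composite of \<open>R \<rightarrow> B(\<omega>)\<close> with the projection to \<open>B\<^sub>\<mm>\<close>.\<close>

abbreviation pe :: "'r \<Rightarrow> (('r, 'n) letter list \<Rightarrow> 'k) set set" where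
  "pe r \<equiv> phi D \<mm> (emb D r)"

lemma pe_hom:
  "r \<in> carrier R \<Longrightarrow> pe r \<in> carrier Q"
  "r \<in> carrier R \<Longrightarrow> s \<in> carrier R \<Longrightarrow> pe (r \<oplus>\<^bsub>R\<^esub> s) = pe r \<oplus>\<^bsub>Q\<^esub> pe s"
  "r \<in> carrier R \<Longrightarrow> s \<in> carrier R \<Longrightarrow> pe (r \<otimes>\<^bsub>R\<^esub> s) = pe r \<otimes>\<^bsub>Q\<^esub> pe s"
  "pe \<one>\<^bsub>R\<^esub> = \<one>\<^bsub>Q\<^esub>"
  using phi_hom emb_B by (simp_all add: emb_add emb_mult emb_one B_simps(2-5)[symmetric])

lemma Q_one_not_zero: "\<one>\<^bsub>Q\<^esub> \<noteq> \<zero>\<^bsub>Q\<^esub>"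
  using phi_emb_zero_iff[OF R.one_closed] m.I_notcarr m.one_imp_carrier by (auto simp: pe_hom)

lemma Q_smult:
  assumes c: "c \<in> carrier K" and z: "z \<in> carrier Q"
  shows "c \<odot>\<^bsub>Q\<^esub> z = pe (scal c) \<otimes>\<^bsub>Q\<^esub> z"
proof -
  obtain x where x: "x \<in> carrier B" "z = phi D \<mm> x" using z by (rule Q_cases)
  have "c \<odot>\<^bsub>Q\<^esub> z = phi D \<mm> (emb D (scal c) \<otimes>\<^bsub>B\<^esub> x)"
    unfolding x(2) Bm_def phi_def
    using mB.ideal_axioms emb_B[OF scal_closed[OF c]] B_smult[OF c] x(1) by (rule quot_alg_smult)
  then show ?thesis using x phi_hom(3)[OF emb_B[OF scal_closed[OF c]] x(1)] by simp
qed

section \<open>The residue field\<close>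

abbreviation "k\<mm> \<equiv> Rm D \<mm>"

lemma cring_Rm: "cring k\<mm>"
  unfolding Rm_def using m.ideal_axioms R.cring_axioms by (rule cring_quot_alg)

sublocale Rm: cring k\<mm>
  by (rule cring_Rm)

lemmas coset_Rm = m.coset_hom[folded quot_alg_simps, folded Rm_def]

lemma Rm_cases:
  assumes "l \<in> carrier k\<mm>"
  obtains r where "r \<in> carrier R" "l = \<mm> +>\<^bsub>R\<^esub> r"
  using m.coset_cases[of l] assms by (auto simp: Rm_def quot_alg_simps)

lemma Rm_emb_coset:
  assumes r: "r \<in> carrier R"
  shows "Rm_emb D \<mm> (\<mm> +>\<^bsub>R\<^esub> r) = pe r"
proof -
  have "pe r' = pe r" if r': "r' \<in> \<mm> +>\<^bsub>R\<^esub> r" for r'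
  proof -
    obtain h where h: "h \<in> \<mm>" "r' = h \<oplus>\<^bsub>R\<^esub> r"
      using r' by (auto simp: a_r_coset_def')
    then show ?thesis
      using pe_hom(2)[OF m.Icarr[OF h(1)] r] phi_emb_zero_iff[OF m.Icarr[OF h(1)]] pe_hom(1)[OF r]
      by simp
  qed
  moreover have "r \<in> \<mm> +>\<^bsub>R\<^esub> r" using r by (rule m.a_rcos_self)
  ultimately have "pe ` (\<mm> +>\<^bsub>R\<^esub> r) = {pe r}" by blast
  then show ?thesis by (simp add: Rm_emb_def)
qed

lemma Rm_emb_hom:
  assumes "l \<in> carrier k\<mm>" "l' \<in> carrier k\<mm>"
  shows "Rm_emb D \<mm> l \<in> carrier Q"
    and "Rm_emb D \<mm> (l \<oplus>\<^bsub>k\<mm>\<^esub> l') = Rm_emb D \<mm> l \<oplus>\<^bsub>Q\<^esub> Rm_emb D \<mm> l'"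
proof -
  obtain r r' where r: "r \<in> carrier R" "l = \<mm> +>\<^bsub>R\<^esub> r" "r' \<in> carrier R" "l' = \<mm> +>\<^bsub>R\<^esub> r'"
    using assms by (metis Rm_cases)
  show "Rm_emb D \<mm> l \<in> carrier Q" using r by (simp add: Rm_emb_coset pe_hom)
  show "Rm_emb D \<mm> (l \<oplus>\<^bsub>k\<mm>\<^esub> l') = Rm_emb D \<mm> l \<oplus>\<^bsub>Q\<^esub> Rm_emb D \<mm> l'"
    using r by (simp add: coset_Rm Rm_emb_coset pe_hom)
qed

lemma Rm_emb_zero_iff:
  assumes "l \<in> carrier k\<mm>"
  shows "Rm_emb D \<mm> l = \<zero>\<^bsub>Q\<^esub> \<longleftrightarrow> l = \<zero>\<^bsub>k\<mm>\<^esub>"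
proof -
  obtain r where r: "r \<in> carrier R" "l = \<mm> +>\<^bsub>R\<^esub> r" using assms by (rule Rm_cases)
  then show ?thesis
    using m.coset_zero_iff[OF r(1)] by (simp add: Rm_emb_coset phi_emb_zero_iff Rm_def quot_alg_simps)
qed

lemma Rm_smult:
  assumes c: "c \<in> carrier K" and l: "l \<in> carrier k\<mm>"
  shows "c \<odot>\<^bsub>k\<mm>\<^esub> l \<in> carrier k\<mm>"
    and "Rm_emb D \<mm> (c \<odot>\<^bsub>k\<mm>\<^esub> l) = c \<odot>\<^bsub>Q\<^esub> Rm_emb D \<mm> l"
proof -
  obtain r where r: "r \<in> carrier R" "l = \<mm> +>\<^bsub>R\<^esub> r" using l by (rule Rm_cases)
  have cr: "scal c \<otimes>\<^bsub>R\<^esub> r \<in> carrier R" using scal_closed[OF c] r(1) by simp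
  have *: "c \<odot>\<^bsub>k\<mm>\<^esub> l = \<mm> +>\<^bsub>R\<^esub> (scal c \<otimes>\<^bsub>R\<^esub> r)"
    unfolding r(2) Rm_def using m.ideal_axioms scal_closed[OF c] R_smult_eq[OF c] r(1)
    by (rule quot_alg_smult)
  then show "c \<odot>\<^bsub>k\<mm>\<^esub> l \<in> carrier k\<mm>" using cr by (simp add: coset_Rm)
  show "Rm_emb D \<mm> (c \<odot>\<^bsub>k\<mm>\<^esub> l) = c \<odot>\<^bsub>Q\<^esub> Rm_emb D \<mm> l"
    unfolding * using cr r scal_closed[OF c] by (simp add: Rm_emb_coset Q_smult[OF c] pe_hom)
qed

lemma Qc_zero: "Qc 0 = Rm_emb D \<mm> ` carrier k\<mm>"
proof
  show "Qc 0 \<subseteq> Rm_emb D \<mm> ` carrier k\<mm>"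
  proof
    fix z assume "z \<in> Qc 0"
    then obtain r where "r \<in> carrier R" "z = pe r" using comp_zero by auto
    then show "z \<in> Rm_emb D \<mm> ` carrier k\<mm>"
      using Rm_emb_coset[symmetric] coset_Rm(1) by blast
  qed
  show "Rm_emb D \<mm> ` carrier k\<mm> \<subseteq> Qc 0"
  proof
    fix z assume "z \<in> Rm_emb D \<mm> ` carrier k\<mm>"
    then obtain l where l: "l \<in> carrier k\<mm>" "z = Rm_emb D \<mm> l" by blast
    obtain r where "r \<in> carrier R" "l = \<mm> +>\<^bsub>R\<^esub> r" using l(1) by (rule Rm_cases)
    then show "z \<in> Qc 0" using l(2) emb_comp by (auto simp: Rm_emb_coset)
  qed
qed

text \<open>Elements of degree \<open>g\<close> commute with \<open>R\<^sub>\<mm>\<close> up to the action of \<open>g\<close>.\<close>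

lemma Qc_commute:
  assumes g: "g \<in> S" and z: "z \<in> Qc g" and l: "l \<in> carrier k\<mm>"
  shows "z \<otimes>\<^bsub>Q\<^esub> Rm_emb D \<mm> l = Rm_emb D \<mm> (Rm_act D g l) \<otimes>\<^bsub>Q\<^esub> z"
proof -
  obtain x where x: "x \<in> comp D g" "z = phi D \<mm> x" using z by blast
  obtain r where r: "r \<in> carrier R" "l = \<mm> +>\<^bsub>R\<^esub> r" using l by (rule Rm_cases)
  have gr: "act D g r \<in> carrier R" using r(1) by (rule act_closed)
  have "Rm_act D g l = \<mm> +>\<^bsub>R\<^esub> act D g r"
  proof -
    have "act D g ` (\<mm> +>\<^bsub>R\<^esub> r) = (\<lambda>h. act D g h \<oplus>\<^bsub>R\<^esub> act D g r) ` \<mm>"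
      unfolding a_r_coset_def' using r(1) m.Icarr act_add_mult(1) by (auto simp: image_iff)
    also have "\<dots> = (\<lambda>h. h \<oplus>\<^bsub>R\<^esub> act D g r) ` act D g ` \<mm>" by (simp add: image_image)
    also have "\<dots> = \<mm> +>\<^bsub>R\<^esub> act D g r"
      using g by (auto simp: a_r_coset_def' stab_def)
    finally show ?thesis by (simp add: Rm_act_def r(2))
  qed
  moreover have "x \<otimes>\<^bsub>B\<^esub> emb D r = emb D (act D g r) \<otimes>\<^bsub>B\<^esub> x"
    using x(1) r(1) by (rule comp_emb_B)
  ultimately show ?thesis
    using phi_hom(3)[OF comp_B[OF g x(1)] emb_B[OF r(1)]] phi_hom(3)[OF emb_B[OF gr] comp_B[OF g x(1)]]
      x(2) r gr by (simp add: Rm_emb_coset)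
qed

section \<open>Homogeneous units\<close>

text \<open>The units of \<open>B\<^sub>\<mm>\<close> that are homogeneous of degree \<open>g\<close>, with homogeneous inverse.\<close>

definition hunits :: "(int, 'n) vec \<Rightarrow> (('r, 'n) letter list \<Rightarrow> 'k) set set set" where
  "hunits g = {u \<in> Units Q. u \<in> Qc g \<and> inv\<^bsub>Q\<^esub> u \<in> Qc (- g)}"

lemma hunitsI:
  assumes "u \<in> carrier Q" "v \<in> carrier Q" "u \<otimes>\<^bsub>Q\<^esub> v = \<one>\<^bsub>Q\<^esub>" "v \<otimes>\<^bsub>Q\<^esub> u = \<one>\<^bsub>Q\<^esub>"
    and "u \<in> Qc g" "v \<in> Qc (- g)"
  shows "u \<in> hunits g"
proof -
  have "u \<in> Units Q" using assms by (auto simp: Units_def)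
  moreover have "inv\<^bsub>Q\<^esub> u = v" using Q.inv_unique'[OF assms(1-4)] by simp
  ultimately show ?thesis using assms by (simp add: hunits_def)
qed

lemma hunits_one: "\<one>\<^bsub>Q\<^esub> \<in> hunits 0"
  by (rule hunitsI[of _ "\<one>\<^bsub>Q\<^esub>"]) (simp_all add: Q.one_component)

lemma hunits_inv:
  assumes "u \<in> hunits g"
  shows "inv\<^bsub>Q\<^esub> u \<in> hunits (- g)"
  using assms by (simp add: hunits_def Q.Units_inv_inv)

lemma hunits_mult:
  assumes g: "g \<in> S" and h: "h \<in> S" and u: "u \<in> hunits g" and v: "v \<in> hunits h"
  shows "u \<otimes>\<^bsub>Q\<^esub> v \<in> hunits (g + h)"
proof -
  have U: "u \<in> Units Q" "v \<in> Units Q" "u \<in> Qc g" "v \<in> Qc h" "inv\<^bsub>Q\<^esub> u \<in> Qc (- g)" "inv\<^bsub>Q\<^esub> v \<in> Qc (- h)"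
    using u v by (simp_all add: hunits_def)
  note c = Q.Units_closed[OF U(1)] Q.Units_closed[OF U(2)] Q.Units_inv_closed[OF U(1)] Q.Units_inv_closed[OF U(2)]
  show ?thesis
  proof (rule hunitsI)
    show "u \<otimes>\<^bsub>Q\<^esub> v \<in> carrier Q" "inv\<^bsub>Q\<^esub> v \<otimes>\<^bsub>Q\<^esub> inv\<^bsub>Q\<^esub> u \<in> carrier Q" using c by simp_all
    have "u \<otimes>\<^bsub>Q\<^esub> v \<otimes>\<^bsub>Q\<^esub> (inv\<^bsub>Q\<^esub> v \<otimes>\<^bsub>Q\<^esub> inv\<^bsub>Q\<^esub> u) = u \<otimes>\<^bsub>Q\<^esub> (v \<otimes>\<^bsub>Q\<^esub> inv\<^bsub>Q\<^esub> v) \<otimes>\<^bsub>Q\<^esub> inv\<^bsub>Q\<^esub> u"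
      using c by (simp add: Q.m_assoc del: Q.Units_r_inv)
    then show "u \<otimes>\<^bsub>Q\<^esub> v \<otimes>\<^bsub>Q\<^esub> (inv\<^bsub>Q\<^esub> v \<otimes>\<^bsub>Q\<^esub> inv\<^bsub>Q\<^esub> u) = \<one>\<^bsub>Q\<^esub>" using U(1,2) c by simp
    have "inv\<^bsub>Q\<^esub> v \<otimes>\<^bsub>Q\<^esub> inv\<^bsub>Q\<^esub> u \<otimes>\<^bsub>Q\<^esub> (u \<otimes>\<^bsub>Q\<^esub> v) = inv\<^bsub>Q\<^esub> v \<otimes>\<^bsub>Q\<^esub> (inv\<^bsub>Q\<^esub> u \<otimes>\<^bsub>Q\<^esub> u) \<otimes>\<^bsub>Q\<^esub> v"
      using c by (simp add: Q.m_assoc del: Q.Units_l_inv)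
    then show "inv\<^bsub>Q\<^esub> v \<otimes>\<^bsub>Q\<^esub> inv\<^bsub>Q\<^esub> u \<otimes>\<^bsub>Q\<^esub> (u \<otimes>\<^bsub>Q\<^esub> v) = \<one>\<^bsub>Q\<^esub>" using U(1,2) c by simp
    show "u \<otimes>\<^bsub>Q\<^esub> v \<in> Qc (g + h)" using Q.mult_component[OF g h] U by simp
    have "inv\<^bsub>Q\<^esub> v \<otimes>\<^bsub>Q\<^esub> inv\<^bsub>Q\<^esub> u \<in> Qc (- h + - g)"
      using Q.mult_component[OF stab_uminus[OF h] stab_uminus[OF g]] U by simp
    moreover have "- h + - g = - (g + h)" by simp
    ultimately show "inv\<^bsub>Q\<^esub> v \<otimes>\<^bsub>Q\<^esub> inv\<^bsub>Q\<^esub> u \<in> Qc (- (g + h))" by (simp only:)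
  qed
qed

lemma stab_scale_nat: "g \<in> S \<Longrightarrow> int n *s g \<in> S"
proof (induction n)
  case 0
  show ?case using stab_zero by (simp add: vec_eq_iff zero_vec_def vector_scalar_mult_def)
next
  case (Suc n)
  have "int (Suc n) *s g = g + int n *s g" by (simp add: vec_eq_iff algebra_simps)
  then show ?case using Suc stab_plus by simp
qed

lemma hunits_nat_pow:
  assumes g: "g \<in> S" and u: "u \<in> hunits g"
  shows "u [^]\<^bsub>Q\<^esub> (n::nat) \<in> hunits (int n *s g)"
proof (induction n)
  case 0
  have "(0::int) *s g = 0" by (simp add: vec_eq_iff)
  then show ?case using hunits_one by simp
next
  case (Suc n)
  have "int (Suc n) *s g = int n *s g + g" by (simp add: vec_eq_iff algebra_simps)
  then show ?case using hunits_mult[OF stab_scale_nat[OF g] g Suc u] by simp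
qed

lemma hunits_int_pow:
  assumes g: "g \<in> S" and u: "u \<in> hunits g"
  shows "u [^]\<^bsub>Q\<^esub> (z::int) \<in> hunits (z *s g)"
proof (cases "z < 0")
  case True
  have "- (int (nat (- z)) *s g) = z *s g" using True by (simp add: vec_eq_iff)
  then show ?thesis
    using hunits_inv[OF hunits_nat_pow[OF g u, of "nat (- z)"]] True by (simp add: int_pow_def2 del: pow_nat)
next
  case False
  then show ?thesis using hunits_nat_pow[OF g u, of "nat z"] by (simp add: int_pow_def2 del: pow_nat)
qed

lemma stab_scale:
  assumes g: "g \<in> S"
  shows "z *s g \<in> S"
proof (cases "z < 0")
  case True
  have "- (int (nat (- z)) *s g) = z *s g" using True by (simp add: vec_eq_iff)
  then show ?thesis using stab_uminus[OF stab_scale_nat[OF g, of "nat (- z)"]] by simp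
next
  case False
  then show ?thesis using stab_scale_nat[OF g, of "nat z"] by simp
qed

lemma hunits_ordered_monomial:
  assumes s: "\<And>i. i < n \<Longrightarrow> s i \<in> S" and b: "\<And>i. i < n \<Longrightarrow> b i \<in> hunits (s i)"
  shows "ordered_monomial Q n b l \<in> hunits (\<Sum>i<n. l i *s s i)"
proof -
  have "foldr (\<lambda>i p. b i [^]\<^bsub>Q\<^esub> l i \<otimes>\<^bsub>Q\<^esub> p) L \<one>\<^bsub>Q\<^esub> \<in> hunits (\<Sum>i\<leftarrow>L. l i *s s i) \<and>
      (\<Sum>i\<leftarrow>L. l i *s s i) \<in> S"
    if "set L \<subseteq> {..<n}" for L
    using that
  proof (induction L)
    case Nil
    show ?case using hunits_one stab_zero by simp
  next
    case (Cons i L)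
    then have i: "s i \<in> S" "b i \<in> hunits (s i)" using s b by auto
    show ?case
      using Cons hunits_mult[OF stab_scale[OF i(1)] _ hunits_int_pow[OF i]]
        stab_plus[OF stab_scale[OF i(1)]] by simp
  qed
  from this[of "[0..<n]"] show ?thesis
    by (simp add: ordered_monomial_def interv_sum_list_conv_sum_set_nat atLeast0LessThan subset_eq)
qed

text \<open>A component that contains a homogeneous unit consists of its \<open>R\<^sub>\<mm>\<close>-multiples.\<close>

lemma Qc_unit_multiple:
  assumes g: "g \<in> S" and u: "u \<in> hunits g" and z: "z \<in> Qc g"
  shows "\<exists>l\<in>carrier k\<mm>. z = Rm_emb D \<mm> l \<otimes>\<^bsub>Q\<^esub> u"
proof -
  have U: "u \<in> Units Q" "inv\<^bsub>Q\<^esub> u \<in> Qc (- g)" using u by (simp_all add: hunits_def)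
  have zQ: "z \<in> carrier Q" using g z by (rule Q.component_carrier)
  have "z \<otimes>\<^bsub>Q\<^esub> inv\<^bsub>Q\<^esub> u \<in> Qc (g + - g)"
    using g stab_uminus[OF g] z U(2) by (rule Q.mult_component)
  then obtain l where l: "l \<in> carrier k\<mm>" "z \<otimes>\<^bsub>Q\<^esub> inv\<^bsub>Q\<^esub> u = Rm_emb D \<mm> l"
    using Qc_zero by auto
  have "z = z \<otimes>\<^bsub>Q\<^esub> (inv\<^bsub>Q\<^esub> u \<otimes>\<^bsub>Q\<^esub> u)" using U(1) zQ by simp
  also have "\<dots> = Rm_emb D \<mm> l \<otimes>\<^bsub>Q\<^esub> u"
    using U(1) zQ by (simp add: l(2)[symmetric] Q.m_assoc Q.Units_closed del: Q.Units_l_inv)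
  finally show ?thesis using l(1) by blast
qed

lemma pe_unit:
  assumes r: "r \<in> carrier R" "r \<notin> \<mm>"
  shows "\<exists>s\<in>carrier R. pe s \<otimes>\<^bsub>Q\<^esub> pe r = \<one>\<^bsub>Q\<^esub> \<and> pe r \<otimes>\<^bsub>Q\<^esub> pe s = \<one>\<^bsub>Q\<^esub>"
proof -
  interpret Quot: field "R Quot \<mm>" using R.cring_axioms by (rule m.quotient_is_field)
  have "\<mm> +>\<^bsub>R\<^esub> r \<in> carrier (R Quot \<mm>) - {\<zero>\<^bsub>R Quot \<mm>\<^esub>}"
    using r m.coset_hom(1) m.coset_zero_iff by simp
  then have U: "\<mm> +>\<^bsub>R\<^esub> r \<in> Units (R Quot \<mm>)" by (simp only: Quot.field_Units)
  then obtain s where s: "s \<in> carrier R" "inv\<^bsub>R Quot \<mm>\<^esub> (\<mm> +>\<^bsub>R\<^esub> r) = \<mm> +>\<^bsub>R\<^esub> s"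
    using Quot.Units_inv_closed m.coset_cases by metis
  have "\<mm> +>\<^bsub>R\<^esub> (s \<otimes>\<^bsub>R\<^esub> r) = \<mm> +>\<^bsub>R\<^esub> \<one>\<^bsub>R\<^esub>"
    using Quot.Units_l_inv[OF U] s r(1) m.coset_hom(3)[OF s(1) r(1)] m.coset_hom(4) by simp
  then have "pe (s \<otimes>\<^bsub>R\<^esub> r) = \<one>\<^bsub>Q\<^esub>"
    using Rm_emb_coset[of "s \<otimes>\<^bsub>R\<^esub> r"] Rm_emb_coset[of "\<one>\<^bsub>R\<^esub>"] s(1) r(1) by (simp add: pe_hom)
  then show ?thesis
    using s(1) r(1) pe_hom(3)[OF s(1) r(1)] pe_hom(3)[OF r(1) s(1)] R.m_comm[OF r(1) s(1)] by auto
qed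

lemma wdeg_star: "wdeg (star a) = - wdeg a"
proof (induction a)
  case Nil
  show ?case by (simp add: star_def wdeg_simps)
next
  case (Cons z a)
  have "wdeg (star (z # a)) = wdeg (star a) + wdeg [gen_star z]"
    by (simp add: star_def wdeg_simps(4))
  moreover have "wdeg [gen_star z] = - wdeg [z]"
    using wdeg_star_cancel[of z] by (metis add_eq_0_iff)
  ultimately show ?case using Cons wdeg_Cons[of z a] by simp
qed

lemma comp_disjoint:
  assumes "x \<in> comp D g" "x \<in> comp D h" "g \<noteq> h"
  shows "x = \<zero>\<^bsub>A\<^esub>"
proof -
  have "finsum A (\<lambda>_. x) {g} = finsum A (\<lambda>_. x) {h}" using comp_carrier[OF assms(1)] by simp
  then have "x = (if g \<in> {h} then x else \<zero>\<^bsub>A\<^esub>)"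
    using assms(1,2) A.direct
    by (intro A.direct_sum_unique[of "{g}" "\<lambda>_. x" "{h}" "\<lambda>_. x" g]) auto
  then show ?thesis using assms(3) by simp
qed

text \<open>
  Let the degree of \<open>a\<close> stabilize \<open>\<mm>\<close>.  If \<open>a\<^sup>*a\<close> is not in \<open>\<mm>\<close>, then neither is \<open>a a\<^sup>*\<close>, since \<open>(a\<^sup>*a)\<^sup>2 = a\<^sup>*(a a\<^sup>*)a\<close> is the product of
  \<open>a\<^sup>*a\<close> with a translate of \<open>a a\<^sup>*\<close>.  So \<open>a\<close> has a left and a right inverse in \<open>B\<^sub>\<mm>\<close>.
\<close>

lemma word_hunit:
  assumes g: "g \<in> S" and a: "word D a \<in> comp D g" and star: "star_notin D a \<mm>"
  shows "phi D \<mm> (word D a) \<in> hunits g"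
proof -
  let ?w = "word D a" and ?v = "word D (star a)"
  \<comment> \<open>A nonzero word has only one degree, so \<open>a\<^sup>*\<close> is in degree \<open>- g\<close>.\<close>
  have nonzero: "?w \<noteq> \<zero>\<^bsub>A\<^esub>"
  proof
    assume "?w = \<zero>\<^bsub>A\<^esub>"
    then have "?v \<otimes>\<^bsub>A\<^esub> ?w = emb D \<zero>\<^bsub>R\<^esub>" by (simp add: emb_zero word_closed)
    then show False using star m.zero_closed by (auto simp: star_notin_def)
  qed
  then have wdeg: "wdeg a = g" using comp_disjoint[OF word_comp a] by blast
  have v: "?v \<in> comp D (- g)" using word_comp[of "star a"] by (simp add: wdeg_star wdeg)
  note mg = stab_uminus[OF g]
  note wB = comp_B[OF g a] and vB = comp_B[OF mg v]
  have "?v \<otimes>\<^bsub>B\<^esub> ?w \<in> comp D 0" "?w \<otimes>\<^bsub>B\<^esub> ?v \<in> comp D 0"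
    using B.mult_component[OF mg g v a] B.mult_component[OF g mg a v] by simp_all
  then obtain r r2 where r: "r \<in> carrier R" "?v \<otimes>\<^bsub>B\<^esub> ?w = emb D r"
      and r2: "r2 \<in> carrier R" "?w \<otimes>\<^bsub>B\<^esub> ?v = emb D r2"
    unfolding comp_zero by blast
  have rm: "r \<notin> \<mm>" using star r(2) by (auto simp: star_notin_def B_simps)
  have r2m: "r2 \<notin> \<mm>"
  proof
    assume "r2 \<in> \<mm>"
    then have t: "act D (- g) r2 \<in> \<mm>" by (rule stab_act[OF mg])
    have "emb D (r \<otimes>\<^bsub>R\<^esub> r) = ?v \<otimes>\<^bsub>B\<^esub> ?w \<otimes>\<^bsub>B\<^esub> (?v \<otimes>\<^bsub>B\<^esub> ?w)"
      using r by (simp add: emb_mult B_simps)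
    also have "\<dots> = ?v \<otimes>\<^bsub>B\<^esub> (?w \<otimes>\<^bsub>B\<^esub> ?v) \<otimes>\<^bsub>B\<^esub> ?w" using wB vB by (simp add: B.m_assoc)
    also have "\<dots> = emb D (act D (- g) r2) \<otimes>\<^bsub>B\<^esub> ?v \<otimes>\<^bsub>B\<^esub> ?w"
      unfolding r2(2) comp_emb_B[OF v r2(1)] by simp
    also have "\<dots> = emb D (act D (- g) r2) \<otimes>\<^bsub>B\<^esub> (?v \<otimes>\<^bsub>B\<^esub> ?w)"
      by (rule B.m_assoc[OF emb_B[OF m.Icarr[OF t]] vB wB])
    also have "\<dots> = emb D (act D (- g) r2 \<otimes>\<^bsub>R\<^esub> r)"
      unfolding r(2) using m.Icarr[OF t] r(1) by (simp add: emb_mult B_simps)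
    finally have "r \<otimes>\<^bsub>R\<^esub> r = act D (- g) r2 \<otimes>\<^bsub>R\<^esub> r"
      using emb_inj r(1) m.Icarr[OF t] by (auto dest: inj_onD)
    then have "r \<otimes>\<^bsub>R\<^esub> r \<in> \<mm>" using m.I_r_closed[OF t r(1)] by simp
    moreover have "primeideal \<mm> R" using m.is_maximalideal by (rule R.maximalideal_prime)
    ultimately show False using primeideal.I_prime[of \<mm> R r r] r(1) rm by blast
  qed
  let ?W = "phi D \<mm> ?w" and ?V = "phi D \<mm> ?v"
  note WV = phi_hom(1)[OF wB] phi_hom(1)[OF vB]
  have prod: "?V \<otimes>\<^bsub>Q\<^esub> ?W = pe r" "?W \<otimes>\<^bsub>Q\<^esub> ?V = pe r2"
    using phi_hom(3)[OF vB wB] phi_hom(3)[OF wB vB] r(2) r2(2) by simp_all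
  obtain s where s: "s \<in> carrier R" "pe s \<otimes>\<^bsub>Q\<^esub> pe r = \<one>\<^bsub>Q\<^esub>" using pe_unit[OF r(1) rm] by blast
  obtain s2 where s2: "s2 \<in> carrier R" "pe r2 \<otimes>\<^bsub>Q\<^esub> pe s2 = \<one>\<^bsub>Q\<^esub>" using pe_unit[OF r2(1) r2m] by blast
  let ?L = "pe s \<otimes>\<^bsub>Q\<^esub> ?V" and ?R = "?V \<otimes>\<^bsub>Q\<^esub> pe s2"
  have LR: "?L \<in> carrier Q" "?R \<in> carrier Q" using WV s(1) s2(1) by (simp_all add: pe_hom)
  have L: "?L \<otimes>\<^bsub>Q\<^esub> ?W = \<one>\<^bsub>Q\<^esub>" and R: "?W \<otimes>\<^bsub>Q\<^esub> ?R = \<one>\<^bsub>Q\<^esub>"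
    using Q.m_assoc[OF pe_hom(1)[OF s(1)] WV(2) WV(1)] Q.m_assoc[OF WV(1) WV(2) pe_hom(1)[OF s2(1)]]
      prod s(2) s2(2) by simp_all
  have "?L = ?R" using L R WV(1) LR(1) LR(2) by (rule Q.inv_unique)
  then have R': "?W \<otimes>\<^bsub>Q\<^esub> ?L = \<one>\<^bsub>Q\<^esub>" using R by simp
  have "?L \<in> Qc (0 + - g)"
    using emb_comp[OF s(1)] v by (intro Q.mult_component stab_zero mg) auto
  then show ?thesis using a WV(1) LR(1) R' L by (intro hunitsI[of ?W ?L]) auto
qed

section \<open>Modules without proper inner breaks\<close>

lemma B_A: "x \<in> carrier B \<Longrightarrow> x \<in> carrier A"
  unfolding B_simps(1)
  by (rule subgroup_family.sum_of_carrier[OF A.subfamily[OF subset_UNIV]])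

lemma m_ideal_kills:
  assumes M: "left_module A M" and v: "v \<in> weight_space D M \<mm>" and x: "x \<in> m_ideal D \<mm>"
  shows "x \<odot>\<^bsub>M\<^esub> v = \<zero>\<^bsub>M\<^esub>"
proof -
  interpret M: left_module A M by (fact M)
  have vM: "v \<in> carrier M" and kill: "\<And>r. r \<in> \<mm> \<Longrightarrow> emb D r \<odot>\<^bsub>M\<^esub> v = \<zero>\<^bsub>M\<^esub>"
    using v by (auto simp: weight_space_def)
  interpret N: subgroup_family B S m_comp
    using B.abelian_group_axioms m_comp_subgroup by (rule subgroup_familyI)
  have comp: "y \<odot>\<^bsub>M\<^esub> v = \<zero>\<^bsub>M\<^esub>" if "g \<in> S" "y \<in> m_comp g" for g y
    using that
  proof (rule m_comp_induct)
    show "\<zero>\<^bsub>B\<^esub> \<odot>\<^bsub>M\<^esub> v = \<zero>\<^bsub>M\<^esub>" using M.zero_smult[OF vM] by (simp add: B_simps)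
    fix y r z assume *: "y \<in> comp D g" "r \<in> \<mm>" "z \<in> carrier B" "z \<odot>\<^bsub>M\<^esub> v = \<zero>\<^bsub>M\<^esub>"
    note c = comp_carrier[OF *(1)] emb_closed[OF m.Icarr[OF *(2)]]
    have "(y \<otimes>\<^bsub>A\<^esub> emb D r) \<odot>\<^bsub>M\<^esub> v = \<zero>\<^bsub>M\<^esub>"
      using M.smult_assoc[OF c vM] kill[OF *(2)] M.smult_zero[OF c(1)] by simp
    then show "(y \<otimes>\<^bsub>B\<^esub> emb D r \<oplus>\<^bsub>B\<^esub> z) \<odot>\<^bsub>M\<^esub> v = \<zero>\<^bsub>M\<^esub>"
      using M.smult_l_distr[OF A.m_closed[OF c] B_A[OF *(3)] vM] *(4) by (simp add: B_simps)
  qed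
  show ?thesis
    using x unfolding m_ideal_eq
  proof (rule N.sum_of_closed_induct)
    show "\<zero>\<^bsub>B\<^esub> \<odot>\<^bsub>M\<^esub> v = \<zero>\<^bsub>M\<^esub>" using M.zero_smult[OF vM] by (simp add: B_simps)
    fix g y z assume *: "g \<in> S" "y \<in> m_comp g" "z \<in> sum_of B S m_comp" "z \<odot>\<^bsub>M\<^esub> v = \<zero>\<^bsub>M\<^esub>"
    show "(y \<oplus>\<^bsub>B\<^esub> z) \<odot>\<^bsub>M\<^esub> v = \<zero>\<^bsub>M\<^esub>"
      using M.smult_l_distr[OF B_A[OF N.component_carrier[OF *(1,2)]] B_A[OF N.sum_of_carrier[OF *(3)]] vM]
        comp[OF *(1,2)] *(4) by (simp add: B_simps)
  qed
qed

lemma Bm_act_phi: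
  assumes M: "left_module A M" and v: "v \<in> weight_space D M \<mm>" and x: "x \<in> carrier B"
  shows "Bm_act M (phi D \<mm> x) v = x \<odot>\<^bsub>M\<^esub> v"
proof -
  interpret M: left_module A M by (fact M)
  have vM: "v \<in> carrier M" using v by (simp add: weight_space_def)
  have "y \<odot>\<^bsub>M\<^esub> v = x \<odot>\<^bsub>M\<^esub> v" if "y \<in> phi D \<mm> x" for y
  proof -
    obtain h where h: "h \<in> m_ideal D \<mm>" "y = h \<oplus>\<^bsub>B\<^esub> x"
      using \<open>y \<in> phi D \<mm> x\<close> by (auto simp: phi_def a_r_coset_def')
    then show ?thesis
      using M.smult_l_distr[OF B_A[OF mB.Icarr[OF h(1)]] B_A[OF x] vM] m_ideal_kills[OF M v h(1)]
        M.smult_closed[OF B_A[OF x] vM] by (simp add: B_simps)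
  qed
  moreover have "x \<in> phi D \<mm> x" using mB.a_rcos_self[OF x] by (simp add: phi_def)
  ultimately have "(\<lambda>x. x \<odot>\<^bsub>M\<^esub> v) ` phi D \<mm> x = {x \<odot>\<^bsub>M\<^esub> v}" by blast
  then show ?thesis by (simp add: Bm_act_def)
qed

text \<open>
  A word that does not kill \<open>M\<^sub>\<mm>\<close>, of degree \<open>g\<close> in the stabilizer, shows that \<open>g\<close> is in \<open>G\<^sub>\<mm>\<close>, because \<open>M\<close> has no
  proper inner breaks.
\<close>

lemma comp_kills:
  assumes M: "left_module A M" and breaks: "no_proper_inner_breaks D M"
    and v: "v \<in> weight_space D M \<mm>" and g: "g \<in> S - Gm D \<mm>" and x: "x \<in> comp D g"
  shows "x \<odot>\<^bsub>M\<^esub> v = \<zero>\<^bsub>M\<^esub>"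
  using x
proof (rule comp_induct)
  interpret M: left_module A M by (fact M)
  have vM: "v \<in> carrier M" using v by (simp add: weight_space_def)
  show "\<zero>\<^bsub>A\<^esub> \<odot>\<^bsub>M\<^esub> v = \<zero>\<^bsub>M\<^esub>" by (rule M.zero_smult[OF vM])
  fix r and a :: "'n gen list" and y
  assume r: "r \<in> carrier R" and a: "wdeg a = g" and y: "y \<in> carrier A" "y \<odot>\<^bsub>M\<^esub> v = \<zero>\<^bsub>M\<^esub>"
  have "word D a \<odot>\<^bsub>M\<^esub> v = \<zero>\<^bsub>M\<^esub>"
  proof (rule ccontr)
    assume nz: "word D a \<odot>\<^bsub>M\<^esub> v \<noteq> \<zero>\<^bsub>M\<^esub>"
    then have "v \<noteq> \<zero>\<^bsub>M\<^esub>" using M.smult_zero[OF word_closed] by auto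
    then have "\<mm> \<in> supp D M" using v maximal by (auto simp: supp_def)
    then have "star_notin D a \<mm>" using breaks nz v by (auto simp: no_proper_inner_breaks_def)
    then have "g \<in> Gtilde D \<mm>" using word_comp[of a] a by (auto simp: Gtilde_def)
    then show False using g by (auto simp: Gm_def)
  qed
  then have "(emb D r \<otimes>\<^bsub>A\<^esub> word D a) \<odot>\<^bsub>M\<^esub> v = \<zero>\<^bsub>M\<^esub>"
    using M.smult_assoc[OF emb_closed[OF r] word_closed vM, of a] M.smult_zero[OF emb_closed[OF r]] by simp
  then show "(emb D r \<otimes>\<^bsub>A\<^esub> word D a \<oplus>\<^bsub>A\<^esub> y) \<odot>\<^bsub>M\<^esub> v = \<zero>\<^bsub>M\<^esub>"
    using M.smult_l_distr[OF A.m_closed[OF emb_closed[OF r] word_closed] y(1) vM, of a] y(2) by simp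
qed

lemma Bm0_kills:
  assumes M: "left_module A M" and breaks: "no_proper_inner_breaks D M"
    and v: "v \<in> weight_space D M \<mm>" and z: "z \<in> Bm0 D \<mm>"
  shows "Bm_act M z v = \<zero>\<^bsub>M\<^esub>"
proof -
  interpret M: left_module A M by (fact M)
  have vM: "v \<in> carrier M" using v by (simp add: weight_space_def)
  interpret Q0: subgroup_family Q "S - Gm D \<mm>" Qc by (rule Q.subfamily) blast
  have "\<exists>x\<in>carrier B. z = phi D \<mm> x \<and> x \<odot>\<^bsub>M\<^esub> v = \<zero>\<^bsub>M\<^esub>"
    using z unfolding Bm0_def
  proof (rule Q0.sum_of_closed_induct)
    show "\<exists>x\<in>carrier B. \<zero>\<^bsub>Q\<^esub> = phi D \<mm> x \<and> x \<odot>\<^bsub>M\<^esub> v = \<zero>\<^bsub>M\<^esub>"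
    proof (intro bexI conjI)
      show "\<zero>\<^bsub>Q\<^esub> = phi D \<mm> \<zero>\<^bsub>B\<^esub>" by (rule phi_hom(5))
      show "\<zero>\<^bsub>B\<^esub> \<odot>\<^bsub>M\<^esub> v = \<zero>\<^bsub>M\<^esub>" using M.zero_smult[OF vM] by (simp add: B_simps(5))
    qed simp
    fix g y z'
    assume g: "g \<in> S - Gm D \<mm>" and "y \<in> Qc g" "\<exists>x\<in>carrier B. z' = phi D \<mm> x \<and> x \<odot>\<^bsub>M\<^esub> v = \<zero>\<^bsub>M\<^esub>"
    then obtain p x where p: "p \<in> comp D g" "y = phi D \<mm> p"
        and x: "x \<in> carrier B" "z' = phi D \<mm> x" "x \<odot>\<^bsub>M\<^esub> v = \<zero>\<^bsub>M\<^esub>" by blast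
    have pB: "p \<in> carrier B" using g p(1) by (intro comp_B[of g]) auto
    have "y \<oplus>\<^bsub>Q\<^esub> z' = phi D \<mm> (p \<oplus>\<^bsub>B\<^esub> x)" using phi_hom(2)[OF pB x(1)] p x by simp
    moreover have "(p \<oplus>\<^bsub>B\<^esub> x) \<odot>\<^bsub>M\<^esub> v = \<zero>\<^bsub>M\<^esub>"
      using M.smult_l_distr[OF B_A[OF pB] B_A[OF x(1)] vM] comp_kills[OF M breaks v g p(1)] x(3)
      by (simp add: B_simps)
    moreover have "p \<oplus>\<^bsub>B\<^esub> x \<in> carrier B" using pB x(1) by simp
    ultimately show "\<exists>x\<in>carrier B. y \<oplus>\<^bsub>Q\<^esub> z' = phi D \<mm> x \<and> x \<odot>\<^bsub>M\<^esub> v = \<zero>\<^bsub>M\<^esub>" by blast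
  qed
  then show ?thesis using Bm_act_phi[OF M v] by metis
qed

section \<open>Bases from homogeneous units\<close>

lemma smult_line_subgroup:
  assumes x: "x \<in> carrier Q"
  shows "additive_subgroup {c \<odot>\<^bsub>Q\<^esub> x | c. c \<in> carrier K} Q"
proof (rule additive_subgroupI, rule subgroup.intro)
  let ?C = "{c \<odot>\<^bsub>Q\<^esub> x | c. c \<in> carrier K}"
  note mod = algebra.axioms(1)[OF algebra_R]
  have pc: "pe (scal c) \<in> carrier Q" if "c \<in> carrier K" for c using that by (simp add: pe_hom scal_closed)
  have add: "(c \<oplus>\<^bsub>K\<^esub> d) \<odot>\<^bsub>Q\<^esub> x = c \<odot>\<^bsub>Q\<^esub> x \<oplus>\<^bsub>Q\<^esub> d \<odot>\<^bsub>Q\<^esub> x"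
    if cd: "c \<in> carrier K" "d \<in> carrier K" for c d
  proof -
    have "scal (c \<oplus>\<^bsub>K\<^esub> d) = scal c \<oplus>\<^bsub>R\<^esub> scal d"
      using mod cd R.one_closed by (rule module.smult_l_distr)
    then show ?thesis using cd x pc by (simp add: Q_smult pe_hom scal_closed Q.l_distr)
  qed
  have zero: "\<zero>\<^bsub>K\<^esub> \<odot>\<^bsub>Q\<^esub> x = \<zero>\<^bsub>Q\<^esub>"
  proof -
    have "scal \<zero>\<^bsub>K\<^esub> = \<zero>\<^bsub>R\<^esub>" using mod R.one_closed by (rule module.smult_l_null)
    then show ?thesis
      using x phi_emb_zero_iff[OF R.zero_closed] m.zero_closed by (simp add: Q_smult)
  qed
  show "?C \<subseteq> carrier (add_monoid Q)" using x pc by (auto simp: Q_smult)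
  show "\<one>\<^bsub>add_monoid Q\<^esub> \<in> ?C" using zero[symmetric] by auto
  show "y \<otimes>\<^bsub>add_monoid Q\<^esub> z \<in> ?C" if yz: "y \<in> ?C" "z \<in> ?C" for y z
  proof -
    obtain c d where "y = c \<odot>\<^bsub>Q\<^esub> x" "c \<in> carrier K" "z = d \<odot>\<^bsub>Q\<^esub> x" "d \<in> carrier K" using yz by blast
    then show ?thesis using add[of c d, symmetric] K.a_closed by auto
  qed
  show "inv\<^bsub>add_monoid Q\<^esub> y \<in> ?C" if y: "y \<in> ?C" for y
  proof -
    obtain c where c: "y = c \<odot>\<^bsub>Q\<^esub> x" "c \<in> carrier K" using y by blast
    have "(\<ominus>\<^bsub>K\<^esub> c) \<odot>\<^bsub>Q\<^esub> x \<oplus>\<^bsub>Q\<^esub> y = \<zero>\<^bsub>Q\<^esub>"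
      using add[of "\<ominus>\<^bsub>K\<^esub> c" c] c zero by (simp add: K.l_neg)
    then have "\<ominus>\<^bsub>Q\<^esub> y = (\<ominus>\<^bsub>K\<^esub> c) \<odot>\<^bsub>Q\<^esub> x"
      using c x pc by (intro Q.minus_equality) (simp_all add: Q_smult)
    then have "\<ominus>\<^bsub>Q\<^esub> y \<in> ?C" using K.a_inv_closed[OF c(2)] by auto
    then show ?thesis unfolding a_inv_def[of Q] .
  qed
qed

lemma Gm_stab: "Gm D \<mm> \<subseteq> S"
  by (auto simp: Gm_def)

text \<open>
  A \<open>K\<close>-basis of \<open>R\<^sub>\<mm>\<close> together with one homogeneous unit in every degree of \<open>G\<^sub>\<mm>\<close> gives a
  \<open>K\<close>-basis: the components of degree in \<open>G\<^sub>\<mm>\<close> are independent, and each is \<open>R\<^sub>\<mm>\<close> times a unit.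
\<close>

lemma basis_Bm1:
  assumes rho: "is_basis K k\<mm> J \<rho>"
    and d: "bij_betw d L (Gm D \<mm>)" and u: "\<And>l. l \<in> L \<Longrightarrow> u l \<in> hunits (d l)"
  shows "is_basis K (Q\<lparr>carrier := Bm1 D \<mm>\<rparr>) (J \<times> L) (\<lambda>(j, l). Rm_emb D \<mm> (\<rho> j) \<otimes>\<^bsub>Q\<^esub> u l)"
proof -
  interpret G: subgroup_family Q "Gm D \<mm>" Qc using Gm_stab by (rule Q.subfamily)
  let ?V = "Q\<lparr>carrier := Bm1 D \<mm>\<rparr>"
  define e where "e p = Rm_emb D \<mm> (\<rho> (fst p)) \<otimes>\<^bsub>Q\<^esub> u (snd p)" for p
  have e_eq: "e = (\<lambda>(j, l). Rm_emb D \<mm> (\<rho> j) \<otimes>\<^bsub>Q\<^esub> u l)" by (auto simp: e_def fun_eq_iff)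
  have dG: "d l \<in> Gm D \<mm>" if "l \<in> L" for l using d that by (auto simp: bij_betw_def)
  have dS: "d l \<in> S" if "l \<in> L" for l using dG[OF that] Gm_stab by blast
  have uU: "u l \<in> Units Q" "u l \<in> Qc (d l)" if "l \<in> L" for l using u[OF that] by (simp_all add: hunits_def)
  have uQ: "u l \<in> carrier Q" if "l \<in> L" for l using uU(1)[OF that] by (rule Q.Units_closed)
  have rhoR: "\<rho> j \<in> carrier k\<mm>" if "j \<in> J" for j using rho that by (auto simp: is_basis_def)
  have smult_e: "c \<odot>\<^bsub>Q\<^esub> e (j, l) = Rm_emb D \<mm> (c \<odot>\<^bsub>k\<mm>\<^esub> \<rho> j) \<otimes>\<^bsub>Q\<^esub> u l"
    if "c \<in> carrier K" "j \<in> J" "l \<in> L" for c j l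
    using that rhoR uQ Rm_emb_hom(1)[OF rhoR rhoR] Rm_smult(2)
    by (simp add: e_def Q_smult pe_hom scal_closed Q.m_assoc)
  have multiple_comp: "Rm_emb D \<mm> r \<otimes>\<^bsub>Q\<^esub> u l \<in> Qc (d l)" if "r \<in> carrier k\<mm>" "l \<in> L" for r l
  proof -
    have "Rm_emb D \<mm> r \<in> Qc 0" using that(1) Qc_zero by simp
    then show ?thesis using Q.mult_component[OF stab_zero dS[OF that(2)] _ uU(2)[OF that(2)]] by simp
  qed
  have e_comp: "e (j, l) \<in> Qc (d l)" if "j \<in> J" "l \<in> L" for j l
    using multiple_comp[OF rhoR[OF that(1)] that(2)] by (simp add: e_def)
  have smult_comp: "c \<odot>\<^bsub>Q\<^esub> e (j, l) \<in> Qc (d l)" if "c \<in> carrier K" "j \<in> J" "l \<in> L" for c j l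
    using that multiple_comp[OF Rm_smult(1)] rhoR by (simp add: smult_e)
  have finsum_V: "finsum ?V f F = finsum Q f F" if "f \<in> F \<rightarrow> Bm1 D \<mm>" for f F
    using Q.abelian_group_axioms G.sum_of_subgroup[folded Bm1_def] that by (rule finsum_carrier_update)
  have comp_Bm1: "x \<in> Bm1 D \<mm>" if "l \<in> L" "x \<in> Qc (d l)" for l x
    unfolding Bm1_def using dG[OF that(1)] that(2) by (rule G.component_sum_of)
  have smult_Bm1: "(\<lambda>p. c p \<odot>\<^bsub>Q\<^esub> e p) \<in> F \<rightarrow> Bm1 D \<mm>" if "F \<subseteq> J \<times> L" "c \<in> F \<rightarrow> carrier K" for F c
  proof
    fix p assume p: "p \<in> F"
    with that(1) obtain j l where "p = (j, l)" "j \<in> J" "l \<in> L" by auto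
    moreover have "c p \<in> carrier K" using that(2) p by auto
    ultimately show "c p \<odot>\<^bsub>Q\<^esub> e p \<in> Bm1 D \<mm>"
      using smult_comp[of "c p" j l] comp_Bm1[of l] by simp
  qed
  have e_Bm1: "e \<in> J \<times> L \<rightarrow> carrier ?V"
    using comp_Bm1 e_comp by auto
  have independent: "\<forall>p\<in>F. c p = \<zero>\<^bsub>K\<^esub>"
    if F: "finite F" "F \<subseteq> J \<times> L" and c: "c \<in> F \<rightarrow> carrier K"
      and zero: "finsum Q (\<lambda>p. c p \<odot>\<^bsub>Q\<^esub> e p) F = \<zero>\<^bsub>Q\<^esub>" for F c
  proof
    fix p assume p: "p \<in> F"
    let ?f = "\<lambda>p. c p \<odot>\<^bsub>Q\<^esub> e p"
    \<comment> \<open>Group the sum by degree: all terms of one degree have the same second index.\<close>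
    define A where "A g = {p \<in> F. d (snd p) = g}" for g
    let ?E = "(\<lambda>p. d (snd p)) ` F"
    have fC: "?f q \<in> Qc (d (snd q))" if "q \<in> F" for q
    proof -
      from that F(2) obtain j l where q: "q = (j, l)" "j \<in> J" "l \<in> L" by auto
      moreover have "c q \<in> carrier K" using c that by auto
      ultimately show ?thesis using smult_comp[of "c q" j l] by simp
    qed
    have fQ: "?f q \<in> carrier Q" if "q \<in> F" for q
    proof -
      have "d (snd q) \<in> S" using that F(2) dS by auto
      then show ?thesis using fC[OF that] by (rule Q.component_carrier)
    qed
    have E: "?E \<subseteq> S" "finite ?E" using F dS by auto
    have F_eq: "F = (\<Union>g\<in>?E. A g)" by (auto simp: A_def)
    have A_sum: "finsum Q ?f (A g) \<in> Qc g" if "g \<in> ?E" for g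
    proof (rule finsum_subgroup[OF Q.abelian_group_axioms Q.component])
      show "g \<in> S" using that E by blast
      show "?f \<in> A g \<rightarrow> Qc g" using fC by (auto simp: A_def)
    qed
    have "finsum Q ?f (\<Union>g\<in>?E. A g) = finsum Q (\<lambda>g. finsum Q ?f (A g)) ?E"
      using E F(1) fQ by (intro Q.add.finprod_UN_disjoint) (auto simp: A_def pairwise_def disjnt_def)
    then have "finsum Q (\<lambda>g. finsum Q ?f (A g)) ?E = \<zero>\<^bsub>Q\<^esub>" using zero F_eq by simp
    then have "finsum Q ?f (A g) = \<zero>\<^bsub>Q\<^esub>" if "g \<in> ?E" for g
    proof -
      have "(\<lambda>g. finsum Q ?f (A g)) \<in> Pi ?E Qc" using A_sum by (rule Pi_I)
      then show ?thesis
        using Q.direct[unfolded is_direct_sum_of_def, THEN conjunct2, rule_format, OF E(2,1)]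
          \<open>finsum Q (\<lambda>g. finsum Q ?f (A g)) ?E = \<zero>\<^bsub>Q\<^esub>\<close> that by blast
    qed
    then have zero': "finsum Q ?f (A (d (snd p))) = \<zero>\<^bsub>Q\<^esub>" using p by blast
    obtain j l where pjl: "p = (j, l)" "j \<in> J" "l \<in> L" using p F(2) by auto
    let ?A = "A (d l)"
    have A: "snd q = l" "fst q \<in> J" "q \<in> F" if "q \<in> ?A" for q
    proof -
      have q: "q \<in> F" "d (snd q) = d l" using that by (auto simp: A_def)
      then have "fst q \<in> J" "snd q \<in> L" using F(2) by auto
      then show "snd q = l" "fst q \<in> J" "q \<in> F"
        using d q pjl(3) by (auto simp: bij_betw_def dest: inj_onD)
    qed
    have finA: "finite ?A" using F(1) by (simp add: A_def)
    have cK: "c q \<in> carrier K" if "q \<in> ?A" for q using A(3)[OF that] c by auto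
    let ?t = "\<lambda>q. c q \<odot>\<^bsub>k\<mm>\<^esub> \<rho> (fst q)"
    have tR: "?t \<in> ?A \<rightarrow> carrier k\<mm>" using cK A(2) rhoR Rm_smult(1) by auto
    have tQ: "(\<lambda>q. Rm_emb D \<mm> (?t q)) \<in> ?A \<rightarrow> carrier Q"
      using tR Rm_emb_hom(1) by auto
    have ft: "?f q = Rm_emb D \<mm> (?t q) \<otimes>\<^bsub>Q\<^esub> u l" if "q \<in> ?A" for q
      using smult_e[OF cK[OF that] A(2)[OF that] pjl(3)] A(1)[OF that] by (cases q) simp
    have "finsum Q ?f ?A = finsum Q (\<lambda>q. Rm_emb D \<mm> (?t q) \<otimes>\<^bsub>Q\<^esub> u l) ?A"
      using ft tQ uQ[OF pjl(3)] by (intro Q.finsum_cong') auto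
    also have "\<dots> = finsum Q (\<lambda>q. Rm_emb D \<mm> (?t q)) ?A \<otimes>\<^bsub>Q\<^esub> u l"
      using finA uQ[OF pjl(3)] tQ by (rule Q.finsum_ldistr[symmetric])
    also have "finsum Q (\<lambda>q. Rm_emb D \<mm> (?t q)) ?A = Rm_emb D \<mm> (finsum k\<mm> ?t ?A)"
      using Rm_emb_hom Rm_emb_zero_iff[OF Rm.zero_closed] finA tR
      by (intro finsum_hom[symmetric] Rm.abelian_group_axioms Q.abelian_group_axioms) auto
    finally have prod: "Rm_emb D \<mm> (finsum k\<mm> ?t ?A) \<otimes>\<^bsub>Q\<^esub> u l = \<zero>\<^bsub>Q\<^esub>"
      using zero' pjl(1) by simp
    have tc: "finsum k\<mm> ?t ?A \<in> carrier k\<mm>" using tR by (rule Rm.finsum_closed)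
    have rc: "Rm_emb D \<mm> (finsum k\<mm> ?t ?A) \<in> carrier Q" using tc tc by (rule Rm_emb_hom(1))
    have "Rm_emb D \<mm> (finsum k\<mm> ?t ?A) \<otimes>\<^bsub>Q\<^esub> u l \<otimes>\<^bsub>Q\<^esub> inv\<^bsub>Q\<^esub> u l =
        Rm_emb D \<mm> (finsum k\<mm> ?t ?A)"
      using rc uU(1)[OF pjl(3)] uQ[OF pjl(3)] by (simp add: Q.m_assoc)
    then have "Rm_emb D \<mm> (finsum k\<mm> ?t ?A) = \<zero>\<^bsub>Q\<^esub>"
      unfolding prod using uU(1)[OF pjl(3)] by simp
    then have tz: "finsum k\<mm> ?t ?A = \<zero>\<^bsub>k\<mm>\<^esub>" using Rm_emb_zero_iff[OF tc] by simp
    have inj: "inj_on fst ?A"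
    proof (rule inj_onI)
      fix q q' assume "q \<in> ?A" "q' \<in> ?A" "fst q = fst q'"
      then show "q = q'" using A(1)[of q] A(1)[of q'] by (simp add: prod_eq_iff)
    qed
    let ?s = "\<lambda>i. c (i, l) \<odot>\<^bsub>k\<mm>\<^esub> \<rho> i"
    have pair: "(fst q, l) = q" if "q \<in> ?A" for q using A(1)[OF that] by (auto simp: prod_eq_iff)
    have sK: "?s i \<in> carrier k\<mm>" "c (i, l) \<in> carrier K" if "i \<in> fst ` ?A" for i
    proof -
      from that obtain q where q: "q \<in> ?A" "i = fst q" by blast
      show "c (i, l) \<in> carrier K" using cK[OF q(1)] pair[OF q(1)] q(2) by simp
      then show "?s i \<in> carrier k\<mm>" using rhoR[OF A(2)[OF q(1)]] q(2) by (simp add: Rm_smult(1))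
    qed
    have "finsum k\<mm> ?s (fst ` ?A) = finsum k\<mm> (\<lambda>q. ?s (fst q)) ?A"
      using Pi_I[OF sK(1)] inj by (rule Rm.finsum_reindex)
    also have "\<dots> = finsum k\<mm> ?t ?A" using refl tR by (rule Rm.finsum_cong') (simp add: pair)
    finally have sum: "finsum k\<mm> ?s (fst ` ?A) = \<zero>\<^bsub>k\<mm>\<^esub>" using tz by simp
    have finite: "finite (fst ` ?A)" "fst ` ?A \<subseteq> J" using finA A(2) by auto
    have "p \<in> ?A" using p pjl(1) by (simp add: A_def)
    then have "j \<in> fst ` ?A" using pjl(1) by (intro image_eqI[of _ _ p]) simp_all
    with rho finite Pi_I[OF sK(2)] sum have "c (j, l) = \<zero>\<^bsub>K\<^esub>" by (rule is_basis_independent)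
    then show "c p = \<zero>\<^bsub>K\<^esub>" using pjl(1) by simp
  qed
  let ?T = "\<lambda>p. {c \<odot>\<^bsub>Q\<^esub> e p | c. c \<in> carrier K}"
  have eQ: "e p \<in> carrier Q" if "p \<in> J \<times> L" for p
    using that e_comp Q.component_carrier[OF dS] by auto
  interpret T: subgroup_family Q "J \<times> L" ?T
    using Q.abelian_group_axioms smult_line_subgroup[OF eQ] by (rule subgroup_familyI)
  have comp_span: "x \<in> sum_of Q (J \<times> L) ?T" if g: "g \<in> Gm D \<mm>" and x: "x \<in> Qc g" for g x
  proof -
    obtain l where l: "l \<in> L" "g = d l" using d g by (auto simp: bij_betw_def)
    obtain r where r: "r \<in> carrier k\<mm>" "x = Rm_emb D \<mm> r \<otimes>\<^bsub>Q\<^esub> u l"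
      using Qc_unit_multiple[OF dS[OF l(1)] u[OF l(1)]] x l(2) by blast
    obtain E c where E: "finite E" "E \<subseteq> J" "c \<in> E \<rightarrow> carrier K"
        "r = finsum k\<mm> (\<lambda>j. c j \<odot>\<^bsub>k\<mm>\<^esub> \<rho> j) E"
      using rho[unfolded is_basis_def, THEN conjunct2, THEN conjunct2, rule_format, OF r(1)] by blast
    let ?t = "\<lambda>j. c j \<odot>\<^bsub>k\<mm>\<^esub> \<rho> j"
    have tR: "?t \<in> E \<rightarrow> carrier k\<mm>"
      using E(2,3) by (intro Pi_I Rm_smult(1) rhoR) auto
    have tQ: "(\<lambda>j. Rm_emb D \<mm> (?t j)) \<in> E \<rightarrow> carrier Q" using tR Rm_emb_hom(1) by auto
    have "Rm_emb D \<mm> r = finsum Q (\<lambda>j. Rm_emb D \<mm> (?t j)) E"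
      unfolding E(4) using Rm_emb_hom Rm_emb_zero_iff[OF Rm.zero_closed] E(1) tR
      by (intro finsum_hom Rm.abelian_group_axioms Q.abelian_group_axioms) auto
    then have x_eq: "x = finsum Q (\<lambda>j. Rm_emb D \<mm> (?t j) \<otimes>\<^bsub>Q\<^esub> u l) E"
      unfolding r(2) using Q.finsum_ldistr[OF E(1) uQ[OF l(1)] tQ] by simp
    have mem: "Rm_emb D \<mm> (?t j) \<otimes>\<^bsub>Q\<^esub> u l \<in> sum_of Q (J \<times> L) ?T" if "j \<in> E" for j
    proof (rule T.component_sum_of[of "(j, l)"])
      show "(j, l) \<in> J \<times> L" using that E(2) l(1) by auto
      have "c j \<in> carrier K" "j \<in> J" using that E(2,3) by auto
      then show "Rm_emb D \<mm> (?t j) \<otimes>\<^bsub>Q\<^esub> u l \<in> ?T (j, l)"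
        using smult_e[of "c j" j l] l(1) by auto
    qed
    show ?thesis
      unfolding x_eq using Q.abelian_group_axioms T.sum_of_subgroup Pi_I[OF mem] by (rule finsum_subgroup)
  qed
  have span: "v \<in> sum_of Q (J \<times> L) ?T" if "v \<in> Bm1 D \<mm>" for v
    using that unfolding Bm1_def
  proof (rule G.sum_of_closed_induct)
    show "\<zero>\<^bsub>Q\<^esub> \<in> sum_of Q (J \<times> L) ?T" by (rule T.sum_of_zero)
  qed (rule T.sum_of_add[OF comp_span])
  show ?thesis
    unfolding is_basis_def e_eq[symmetric]
  proof (intro conjI allI impI ballI e_Bm1)
    fix F c p
    assume "finite F" "F \<subseteq> J \<times> L" "c \<in> F \<rightarrow> carrier K" "p \<in> F"
      and "finsum ?V (\<lambda>p. c p \<odot>\<^bsub>?V\<^esub> e p) F = \<zero>\<^bsub>?V\<^esub>"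
    then show "c p = \<zero>\<^bsub>K\<^esub>"
      using independent[of F c] finsum_V[OF smult_Bm1[of F c]] by simp
  next
    fix v assume "v \<in> carrier ?V"
    then have "v \<in> sum_of Q (J \<times> L) ?T" by (intro span) simp
    then obtain F x where F: "finite F" "F \<subseteq> J \<times> L" "x \<in> Pi F ?T" "v = finsum Q x F"
      by (auto simp: sum_of_def)
    have "\<forall>p\<in>F. \<exists>c. c \<in> carrier K \<and> x p = c \<odot>\<^bsub>Q\<^esub> e p" using F(3) by auto
    then obtain c where c: "\<And>p. p \<in> F \<Longrightarrow> c p \<in> carrier K" "\<And>p. p \<in> F \<Longrightarrow> x p = c p \<odot>\<^bsub>Q\<^esub> e p"
      by metis
    have cF: "c \<in> F \<rightarrow> carrier K" using c(1) by blast
    have "v = finsum Q (\<lambda>p. c p \<odot>\<^bsub>Q\<^esub> e p) F"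
      unfolding F(4) by (rule Q.finsum_cong'[OF refl T.family_carrier[OF F(2,3)] c(2)[symmetric], symmetric])
    then have "v = finsum ?V (\<lambda>p. c p \<odot>\<^bsub>?V\<^esub> e p) F"
      using finsum_V[OF smult_Bm1[OF F(2) cF]] by simp
    then show "\<exists>F c. finite F \<and> F \<subseteq> J \<times> L \<and> c \<in> F \<rightarrow> carrier K \<and> v = finsum ?V (\<lambda>p. c p \<odot>\<^bsub>?V\<^esub> e p) F"
      using F(1,2) cF by blast
  qed
qed

text \<open>The quotient of two homogeneous units of the same degree is a nonzero element of \<open>R\<^sub>\<mm>\<close>.\<close>

lemma hunits_same_degree:
  assumes g: "g \<in> S" and u: "u \<in> hunits g" and v: "v \<in> hunits g"
  shows "\<exists>l\<in>carrier k\<mm> - {\<zero>\<^bsub>k\<mm>\<^esub>}. u = Rm_emb D \<mm> l \<otimes>\<^bsub>Q\<^esub> v"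
proof -
  have "u \<in> Qc g" "u \<in> Units Q" "v \<in> carrier Q" using u v by (auto simp: hunits_def)
  then obtain l where l: "l \<in> carrier k\<mm>" "u = Rm_emb D \<mm> l \<otimes>\<^bsub>Q\<^esub> v"
    using Qc_unit_multiple[OF g v] by blast
  have "l \<noteq> \<zero>\<^bsub>k\<mm>\<^esub>"
  proof
    assume "l = \<zero>\<^bsub>k\<mm>\<^esub>"
    then have "u = \<zero>\<^bsub>Q\<^esub>" using l Rm_emb_zero_iff[OF l(1)] \<open>v \<in> carrier Q\<close> by simp
    then have "\<one>\<^bsub>Q\<^esub> = \<zero>\<^bsub>Q\<^esub>"
      using Q.Units_l_inv[OF \<open>u \<in> Units Q\<close>] Q.Units_inv_closed[OF \<open>u \<in> Units Q\<close>] by simp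
    then show False using Q_one_not_zero by simp
  qed
  then show ?thesis using l by blast
qed

end

section \<open>The basis and the commutation relations\<close>

lemma Z_basis_mem:
  assumes "is_Z_basis k s G" "i < k"
  shows "s i \<in> G"
proof -
  let ?l = "\<lambda>j\<in>{..<k}. if j = i then 1 else (0::int)"
  have "(\<Sum>j<k. ?l j *s s j) = (\<Sum>j<k. if j = i then s j else 0)"
    by (intro sum.cong) (auto simp: vec_eq_iff)
  also have "\<dots> = s i" using assms(2) by simp
  finally have "s i = (\<Sum>j<k. ?l j *s s j)" by simp
  moreover have "(\<Sum>j<k. ?l j *s s j) \<in> G"
    using bij_betwE[OF assms(1)[unfolded is_Z_basis_def], rule_format, of ?l] by simp
  ultimately show ?thesis by simp
qed

theorem theorem4p5:
  fixes D :: "('k, 'r, 'n::{finite, linorder}) tgw_data"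
    and \<mm> :: "'r set"
    and a :: "(int, 'n) vec \<Rightarrow> 'n gen list"
    and k :: nat
    and s :: "nat \<Rightarrow> (int, 'n) vec"
    and b :: "nat \<Rightarrow> (('r, 'n) letter list \<Rightarrow> 'k) set set"
    and J :: "'j set"
    and \<rho> :: "'j \<Rightarrow> 'r set"
  assumes D: "is_tgw_data D"
    and R_sub_A: "inj_on (emb D) (carrier (tgw_R D))"
    and m: "\<mm> \<in> max_spec D"
    and a: "word_choice D \<mm> a"
    and s: "is_Z_basis k s (Gm D \<mm>)"
    and b: "\<And>i. i < k \<Longrightarrow> b i = phi D \<mm> (word D (a (s i)))"
    and rho: "is_basis (tgw_K D) (Rm D \<mm>) J \<rho>"
  shows
    "(\<forall>M :: ((('r, 'n) letter list \<Rightarrow> 'k) set, 'm) module.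
        simple_module (tgwc D) M \<longrightarrow> weight_module D M \<longrightarrow> no_proper_inner_breaks D M \<longrightarrow>
        (\<forall>x\<in>Bm0 D \<mm>. \<forall>v\<in>weight_space D M \<mm>. Bm_act M x v = \<zero>\<^bsub>M\<^esub>)) \<and>
     (\<forall>i<k. b i \<in> Units (Bm D \<mm>)) \<and>
     is_basis (tgw_K D) ((Bm D \<mm>)\<lparr>carrier := Bm1 D \<mm>\<rparr>) (J \<times> ({..<k} \<rightarrow>\<^sub>E (UNIV :: int set)))
       (\<lambda>(j, l). Rm_emb D \<mm> (\<rho> j) \<otimes>\<^bsub>Bm D \<mm>\<^esub> ordered_monomial (Bm D \<mm>) k b l) \<and>
     (\<forall>i<k. \<forall>l\<in>carrier (Rm D \<mm>).
        b i \<otimes>\<^bsub>Bm D \<mm>\<^esub> Rm_emb D \<mm> l = Rm_emb D \<mm> (Rm_act D (s i) l) \<otimes>\<^bsub>Bm D \<mm>\<^esub> b i) \<and>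
     (\<exists>\<Lambda>. \<forall>i<k. \<forall>j<k. \<Lambda> i j \<in> carrier (Rm D \<mm>) - {\<zero>\<^bsub>Rm D \<mm>\<^esub>} \<and>
        b i \<otimes>\<^bsub>Bm D \<mm>\<^esub> b j = Rm_emb D \<mm> (\<Lambda> i j) \<otimes>\<^bsub>Bm D \<mm>\<^esub> (b j \<otimes>\<^bsub>Bm D \<mm>\<^esub> b i))"
proof -
  interpret tgw_maximal D \<mm>
    using D R_sub_A m by (intro tgw_maximal.intro tgw_algebra.intro tgw_maximal_axioms.intro)
  have sG: "s i \<in> Gm D \<mm>" if "i < k" for i using s that by (rule Z_basis_mem)
  have sS: "s i \<in> stab D \<mm>" if "i < k" for i using sG[OF that] Gm_stab by blast
  have bU: "b i \<in> hunits (s i)" if "i < k" for i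
  proof -
    have "s i \<in> Gtilde D \<mm>" using sG[OF that] by (simp add: Gm_def)
    then show ?thesis
      using a word_hunit[OF sS[OF that]] by (simp add: b[OF that] word_choice_def)
  qed
  have bQ: "b i \<in> Units (Bm D \<mm>)" "b i \<in> phi D \<mm> ` comp D (s i)" if "i < k" for i
    using bU[OF that] by (simp_all add: hunits_def)
  have "\<exists>l\<in>carrier (Rm D \<mm>) - {\<zero>\<^bsub>Rm D \<mm>\<^esub>}.
      b i \<otimes>\<^bsub>Bm D \<mm>\<^esub> b j = Rm_emb D \<mm> l \<otimes>\<^bsub>Bm D \<mm>\<^esub> (b j \<otimes>\<^bsub>Bm D \<mm>\<^esub> b i)"
    if ij: "i < k" "j < k" for i j
    using stab_plus[OF sS[OF ij(1)] sS[OF ij(2)]]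
      hunits_mult[OF sS[OF ij(1)] sS[OF ij(2)] bU[OF ij(1)] bU[OF ij(2)]]
      hunits_mult[OF sS[OF ij(2)] sS[OF ij(1)] bU[OF ij(2)] bU[OF ij(1)], unfolded add.commute[of "s j"]]
    by (rule hunits_same_degree)
  then have commute: "\<exists>\<Lambda>. \<forall>i<k. \<forall>j<k. \<Lambda> i j \<in> carrier (Rm D \<mm>) - {\<zero>\<^bsub>Rm D \<mm>\<^esub>} \<and>
      b i \<otimes>\<^bsub>Bm D \<mm>\<^esub> b j = Rm_emb D \<mm> (\<Lambda> i j) \<otimes>\<^bsub>Bm D \<mm>\<^esub> (b j \<otimes>\<^bsub>Bm D \<mm>\<^esub> b i)"
    by metis
  have "ordered_monomial (Bm D \<mm>) k b l \<in> hunits (\<Sum>i<k. l i *s s i)" for l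
    using sS bU by (rule hunits_ordered_monomial)
  then have basis: "is_basis (tgw_K D) ((Bm D \<mm>)\<lparr>carrier := Bm1 D \<mm>\<rparr>)
      (J \<times> ({..<k} \<rightarrow>\<^sub>E (UNIV :: int set)))
      (\<lambda>(j, l). Rm_emb D \<mm> (\<rho> j) \<otimes>\<^bsub>Bm D \<mm>\<^esub> ordered_monomial (Bm D \<mm>) k b l)"
    by (intro basis_Bm1[OF rho s[unfolded is_Z_basis_def]])
  show ?thesis
  proof (intro conjI commute basis allI impI ballI)
    show "Bm_act M x v = \<zero>\<^bsub>M\<^esub>"
      if "simple_module (tgwc D) M" "no_proper_inner_breaks D M" "x \<in> Bm0 D \<mm>" "v \<in> weight_space D M \<mm>"
      for M :: "((('r, 'n) letter list \<Rightarrow> 'k) set, 'm) module" and x v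
      using Bm0_kills[of M v x] that by (simp add: simple_module_def)
    show "b i \<in> Units (Bm D \<mm>)" if "i < k" for i using that by (rule bQ(1))
    show "b i \<otimes>\<^bsub>Bm D \<mm>\<^esub> Rm_emb D \<mm> l = Rm_emb D \<mm> (Rm_act D (s i) l) \<otimes>\<^bsub>Bm D \<mm>\<^esub> b i"
      if "i < k" "l \<in> carrier (Rm D \<mm>)" for i l
      using sS[OF that(1)] bQ(2)[OF that(1)] that(2) by (rule Qc_commute)
  qed
qed

end
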